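(* One has $[\mathbb{R}\mathrm{P}^3,S^2]=\{[h'_n] : n\in\mathbb{Z}\}$, and the function $\hat{\mathfrak{p}}_3:[\mathbb{R}\mathrm{P}^3,S^2]\to\pi_3(S^2)$ given by $\hat{\mathfrak{p}}_3([f])=[f\circ\mathfrak{p}_3]$ is a bijection.
   Context: "Map" means continuous map, $[X,Y]$ is the set of homotopy classes of maps $X\to Y$ and $[f]$ is the homotopy class of $f$. The set $[S^3,S^2]$ is identified with $\pi_3(S^2)$. Hopf fibration: $S^3=\{(z_1,z_2)\in\mathbb{C}^2 : |z_1|^2+|z_2|^2=1\}$; the circle $S^1$ acts by $(\lambda,(z_1,z_2))\mapsto(\lambda z_1,\lambda z_2)$; $S^1(z_1,z_2)$ is the orbit of $(z_1,z_2)$; the orbit space $S^3/S^1=\mathbb{C}\mathrm{P}^1$ is identified with $S^2$; and $h:S^3\to S^2$ is $h(z_1,z_2)=[S^1(z_1,z_2)]$. The group $\pi_3(S^2)\approx\mathbb{Z}$ is generated by $[h]$, and $nh:S^3\to S^2$ denotes a map in the class $n[h]$ (the composite of a self-map of $S^3$ of degree $n$ with $h$). Projective space: $\mathfrak{p}_3:S^3\to\mathbb{R}\mathrm{P}^3$, $(z_1,z_2)\mapsto[z_1,z_2]$, is the double covering identifying antipodal points. $\mathfrak{q}_3:\mathbb{R}\mathrm{P}^3\to\mathbb{R}\mathrm{P}^3/\mathbb{R}\mathrm{P}^2\cong S^3$ is the map collapsing the $2$-skeleton $\mathbb{R}\mathrm{P}^2\subset\mathbb{R}\mathrm{P}^3$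 to a point, with orientations chosen so that $\deg\mathfrak{q}_3=1$ and $\mathfrak{q}_3\circ\mathfrak{p}_3$ has degree $2$. The maps $h'_n:\mathbb{R}\mathrm{P}^3\to S^2$, $n\in\mathbb{Z}$: let $h':\mathbb{R}\mathrm{P}^3\to S^2$ be $h'([z_1,z_2])=[S^1(z_1,z_2)]$. For $k$ odd, let $\mathfrak{a}_k:S^3\to S^3$ be $\mathfrak{a}_k(z_1,z_2)=(z_1^k,z_2)/|(z_1^k,z_2)|$, a map of degree $k$ (for $k<0$, $z_1^k$ is understood as $\overline{z_1}^{\,|k|}$), let $\mathfrak{a}'_k:\mathbb{R}\mathrm{P}^3\to\mathbb{R}\mathrm{P}^3$ be the induced map $\mathfrak{a}'_k([z_1,z_2])=[\mathfrak{a}_k(z_1,z_2)]$, and set $h'_k=h'\circ\mathfrak{a}'_k$. For even indices set $h'_{2n}=nh\circ\mathfrak{q}_3$ for $n\in\mathbb{Z}$ ($h'_0$ is taken to be a constant map). *)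

theory Defs
  imports "HOL-Analysis.Analysis" "HOL-Homology.Homology"
begin

section \<open>Homotopy classes of maps\<close>

definition homotopy_class :: "'a topology \<Rightarrow> 'b topology \<Rightarrow> ('a \<Rightarrow> 'b) \<Rightarrow> ('a \<Rightarrow> 'b) set" where
  "homotopy_class X Y f = {g. homotopic_with (\<lambda>_. True) X Y f g}"

definition homotopy_classes :: "'a topology \<Rightarrow> 'b topology \<Rightarrow> ('a \<Rightarrow> 'b) set set" where
  "homotopy_classes X Y = homotopy_class X Y ` {f. continuous_map X Y f}"

text \<open>The function on homotopy classes induced by precomposition with \<open>p : W \<rightarrow> X\<close>.  The union
  merges equal classes, see \<open>precomp_class_eq\<close>.\<close>

definition precomp_class ::
    "'w topology \<Rightarrow> 'b topology \<Rightarrow> ('w \<Rightarrow> 'a) \<Rightarrow> ('a \<Rightarrow> 'b) set \<Rightarrow> ('w \<Rightarrow> 'b) set" where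
  "precomp_class W Y p C = (\<Union>f\<in>C. homotopy_class W Y (f \<circ> p))"

lemma homotopy_class_eq:
  "homotopic_with (\<lambda>_. True) X Y f g \<Longrightarrow> homotopy_class X Y f = homotopy_class X Y g"
  unfolding homotopy_class_def
  by (blast intro: homotopic_with_trans homotopic_with_symD)

lemma precomp_class_eq:
  assumes p: "continuous_map W X p" and f: "continuous_map X Y f"
  shows "precomp_class W Y p (homotopy_class X Y f) = homotopy_class W Y (f \<circ> p)"
proof -
  have "homotopy_class W Y (g \<circ> p) = homotopy_class W Y (f \<circ> p)"
    if "g \<in> homotopy_class X Y f" for g
    using that p homotopy_class_eq [of W Y "f \<circ> p" "g \<circ> p"]
    by (auto simp: homotopy_class_def intro: homotopic_with_compose_continuous_map_right)
  moreover have "f \<in> homotopy_class X Y f"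
    using f by (simp add: homotopy_class_def)
  ultimately show ?thesis
    unfolding precomp_class_def by blast
qed

section \<open>Quotient spaces\<close>

definition quotient_topology :: "'a topology \<Rightarrow> ('a \<Rightarrow> 'b) \<Rightarrow> 'b topology" where
  "quotient_topology X p =
     topology (\<lambda>U. U \<subseteq> p ` topspace X \<and> openin X {x \<in> topspace X. p x \<in> U})"

lemma openin_quotient_topology:
  "openin (quotient_topology X p) U \<longleftrightarrow>
     U \<subseteq> p ` topspace X \<and> openin X {x \<in> topspace X. p x \<in> U}"
proof -
  have "istopology (\<lambda>U. U \<subseteq> p ` topspace X \<and> openin X {x \<in> topspace X. p x \<in> U})"
    unfolding istopology_def
  proof (intro conjI allI impI)
    fix S T
    assume "S \<subseteq> p ` topspace X \<and> openin X {x \<in> topspace X. p x \<in> S}"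
      and "T \<subseteq> p ` topspace X \<and> openin X {x \<in> topspace X. p x \<in> T}"
    moreover have "{x \<in> topspace X. p x \<in> S \<inter> T} =
        {x \<in> topspace X. p x \<in> S} \<inter> {x \<in> topspace X. p x \<in> T}"
      by blast
    ultimately show "S \<inter> T \<subseteq> p ` topspace X" "openin X {x \<in> topspace X. p x \<in> S \<inter> T}"
      by auto
  next
    fix K
    assume K: "\<forall>S\<in>K. S \<subseteq> p ` topspace X \<and> openin X {x \<in> topspace X. p x \<in> S}"
    then show "\<Union>K \<subseteq> p ` topspace X"
      by blast
    have "{x \<in> topspace X. p x \<in> \<Union>K} = (\<Union>S\<in>K. {x \<in> topspace X. p x \<in> S})"
      by blast
    then show "openin X {x \<in> topspace X. p x \<in> \<Union>K}"
      using K by auto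
  qed
  then show ?thesis
    by (simp add: quotient_topology_def topology_inverse')
qed

lemma topspace_quotient_topology: "topspace (quotient_topology X p) = p ` topspace X"
proof -
  have "{x \<in> topspace X. p x \<in> p ` topspace X} = topspace X"
    by blast
  then have "openin (quotient_topology X p) (p ` topspace X)"
    by (simp add: openin_quotient_topology)
  then show ?thesis
    by (metis openin_quotient_topology openin_subset openin_topspace subset_antisym)
qed

lemma quotient_map_quotient_topology: "quotient_map X (quotient_topology X p) p"
  by (auto simp: quotient_map_def topspace_quotient_topology openin_quotient_topology)

text \<open>The space \<open>X/A\<close>: the points of \<open>A\<close> become the single point \<open>A\<close>, every other point
  \<open>x\<close> becomes \<open>{x}\<close>.\<close>

definition collapse_map :: "'a set \<Rightarrow> 'a \<Rightarrow> 'a set" where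
  "collapse_map A x = (if x \<in> A then A else {x})"

definition collapse :: "'a topology \<Rightarrow> 'a set \<Rightarrow> 'a set topology" where
  "collapse X A = quotient_topology X (collapse_map A)"

section \<open>The spaces\<close>

definition S3 :: "(complex \<times> complex) topology" where
  "S3 = top_of_set {(z1, z2). (cmod z1)\<^sup>2 + (cmod z2)\<^sup>2 = 1}"

definition S2 :: "(real ^ 3) topology" where
  "S2 = top_of_set (sphere 0 1)"

definition circle_orbit :: "complex \<times> complex \<Rightarrow> (complex \<times> complex) set" where
  "circle_orbit z = {(c * fst z, c * snd z) | c. cmod c = 1}"

definition CP1 :: "(complex \<times> complex) set topology" where
  "CP1 = quotient_topology S3 circle_orbit"

definition proj3 :: "complex \<times> complex \<Rightarrow> (complex \<times> complex) set" where
  "proj3 z = {z, - z}"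

definition RP3 :: "(complex \<times> complex) set topology" where
  "RP3 = quotient_topology S3 proj3"

text \<open>The \<open>2\<close>-skeleton: the points whose last real homogeneous coordinate vanishes.\<close>

definition RP2 :: "(complex \<times> complex) set set" where
  "RP2 = proj3 ` {z \<in> topspace S3. Im (snd z) = 0}"

lemma topspace_S3: "topspace S3 = {(z1, z2). (cmod z1)\<^sup>2 + (cmod z2)\<^sup>2 = 1}"
  by (simp add: S3_def)

lemma S3_eq_sphere: "S3 = top_of_set (sphere 0 1)"
  unfolding S3_def
  by (rule arg_cong [where f = top_of_set]) (auto simp: norm_Pair)

lemma continuous_map_proj3: "continuous_map S3 RP3 proj3"
  unfolding RP3_def by (rule quotient_imp_continuous_map [OF quotient_map_quotient_topology])

section \<open>Degree\<close>

text \<open>An orientation of a closed \<open>n\<close>-manifold \<open>X\<close> with infinite cyclic \<open>H\<^sub>n(X)\<close> is given by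
  a generator \<open>a\<close> of \<open>H\<^sub>n(X)\<close>.  A map \<open>f : X \<rightarrow> Y\<close> has degree \<open>d\<close> if \<open>f\<^sub>*(a) = d b\<close>; the
  library writes homology groups multiplicatively.\<close>

definition fundamental_class :: "nat \<Rightarrow> 'a topology \<Rightarrow> 'a chain set \<Rightarrow> bool" where
  "fundamental_class n X a \<longleftrightarrow>
     a \<in> carrier (homology_group (int n) X) \<and>
     subgroup_generated (homology_group (int n) X) {a} = homology_group (int n) X"

definition has_degree ::
    "nat \<Rightarrow> 'a topology \<Rightarrow> 'a chain set \<Rightarrow> 'b topology \<Rightarrow> 'b chain set \<Rightarrow> ('a \<Rightarrow> 'b) \<Rightarrow> int \<Rightarrow> bool" where
  "has_degree n X a Y b f d \<longleftrightarrow>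
     continuous_map X Y f \<and>
     hom_induced (int n) X {} Y {} f a = b [^]\<^bsub>homology_group (int n) Y\<^esub> d"

section \<open>The maps\<close>

text \<open>\<open>\<phi>\<close> is an identification of \<open>CP1\<close> with \<open>S2\<close>, and \<open>\<theta>\<close> one of \<open>RP3/RP2\<close> with \<open>S3\<close>.\<close>

definition hopf :: "((complex \<times> complex) set \<Rightarrow> real ^ 3) \<Rightarrow> complex \<times> complex \<Rightarrow> real ^ 3" where
  "hopf \<phi> z = \<phi> (circle_orbit z)"

definition q3 :: "((complex \<times> complex) set set \<Rightarrow> complex \<times> complex)
    \<Rightarrow> (complex \<times> complex) set \<Rightarrow> complex \<times> complex" where
  "q3 \<theta> = \<theta> \<circ> collapse_map RP2"

text \<open>A point of \<open>RP3\<close> is a set \<open>{z, - z}\<close>, so its image under \<open>hprime\<close> or \<open>power_map'\<close> is given by the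
  union of the orbits, respectively by the image set; see \<open>hprime_proj3\<close> and \<open>power_map'_proj3\<close>.\<close>

definition hprime :: "((complex \<times> complex) set \<Rightarrow> real ^ 3) \<Rightarrow> (complex \<times> complex) set \<Rightarrow> real ^ 3" where
  "hprime \<phi> A = \<phi> (\<Union>z\<in>A. circle_orbit z)"

definition cnj_power :: "complex \<Rightarrow> int \<Rightarrow> complex" where
  "cnj_power z k = (if k \<ge> 0 then z ^ nat k else cnj z ^ nat (- k))"

definition power_map :: "int \<Rightarrow> complex \<times> complex \<Rightarrow> complex \<times> complex" where
  "power_map k z = (let w = (cnj_power (fst z) k, snd z) in w /\<^sub>R norm w)"

definition power_map' :: "int \<Rightarrow> (complex \<times> complex) set \<Rightarrow> (complex \<times> complex) set" where
  "power_map' k A = power_map k ` A"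

text \<open>\<open>d m\<close> is a self-map of \<open>S3\<close> of degree \<open>m\<close>, so that \<open>hopf \<phi> \<circ> d m\<close> is the map \<open>m h\<close>; the
  point \<open>c\<close> is the value of the constant map of index \<open>0\<close>.\<close>

definition h'_seq ::
    "((complex \<times> complex) set \<Rightarrow> real ^ 3) \<Rightarrow> ((complex \<times> complex) set set \<Rightarrow> complex \<times> complex)
     \<Rightarrow> (int \<Rightarrow> complex \<times> complex \<Rightarrow> complex \<times> complex) \<Rightarrow> real ^ 3
     \<Rightarrow> int \<Rightarrow> (complex \<times> complex) set \<Rightarrow> real ^ 3" where
  "h'_seq \<phi> \<theta> d c n =
     (if n = 0 then (\<lambda>_. c)
      else if even n then (hopf \<phi> \<circ> d (n div 2)) \<circ> q3 \<theta>
      else hprime \<phi> \<circ> power_map' n)"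

lemma circle_orbit_minus: "circle_orbit (- z) = circle_orbit z"
proof -
  have "circle_orbit (- w) \<subseteq> circle_orbit w" for w
  proof
    fix x assume "x \<in> circle_orbit (- w)"
    then obtain u where "cmod u = 1" "x = (u * fst (- w), u * snd (- w))"
      by (auto simp: circle_orbit_def)
    then have "cmod (- u) = 1 \<and> x = (- u * fst w, - u * snd w)"
      by simp
    then show "x \<in> circle_orbit w"
      unfolding circle_orbit_def by blast
  qed
  from this [of z] this [of "- z"] show ?thesis
    by simp
qed

lemma hprime_proj3: "hprime \<phi> (proj3 z) = \<phi> (circle_orbit z)"
  by (simp add: hprime_def proj3_def circle_orbit_minus)

lemma power_map_minus: "odd k \<Longrightarrow> power_map k (- z) = - power_map k z"
  by (simp add: power_map_def cnj_power_def Let_def even_nat_iff norm_Pair uminus_prod_def)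

lemma power_map'_proj3: "odd k \<Longrightarrow> power_map' k (proj3 z) = proj3 (power_map k z)"
  by (simp add: power_map'_def proj3_def power_map_minus)

end

(* Identify C^2 with the quaternions and let x^k be the power maps of S^3.  A self-map of S^3 is
  homotopic to a nonvanishing polynomial map restricted to S^3; by Sard's theorem the polynomial may
  be assumed to have finitely many zeros in the ball, all nondegenerate, and cancelling the zeros one
  after another by quaternionic factors (x - a)^k shows that the map is homotopic to some x^k.
  Additivity of homology for maps with disjoint supports gives deg x^k = k, so the powers are
  pairwise non-homotopic.

  A map f on RP^3 with values in S^2 is an even map on S^3.  It lifts through the Hopf fibration, and
  a logarithm of the phase between G(-x) and G(x) makes the lift G either even or odd.  An even map G
  sends the equator Re x = 0 into a proper subset of S^3 (after an approximation), which can be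
  contracted in the target; then G factors through x |-> x^2, because squaring collapses exactly the
  equator and identifies antipodes.  Hence G is evenly homotopic to x^(2k), and an odd G, being the
  product of an even map with the identity, is oddly homotopic to x^(2k+1).  Comparing degrees
  identifies these with the lifts of the maps h'_n, and homotopy lifting shows that h composed with
  x^n determines n. *)

theory Submission
  imports Defs
begin

section \<open>Quaternions\<close>

text \<open>The obstacle is parity. A homotopy on RP^3 amounts to a homotopy on S^3 that is even at
  every time, so knowing the degree of a lift is not enough: a free homotopy between two even maps
  need not pass through even maps. The normal forms are therefore reached by homotopies that respect
  parity at each time, and only then does degree fix the exponent. Quaternions are chosen because
  three things become multiplications: the circle action of the Hopf fibration (from the left by
  complex numbers), the antipodal map (by -1), and, together with conjugation, every reflection.
  Pointwise multiplication of maps takes the place of addition in pi_3, so free homotopies can be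
  used throughout. Most homotopies are built in the space of nonzero quaternions, where segments and
  products are at hand, and are pushed onto S^3 by normalising at the end. Polynomials produce some
  exponent for each map but cannot tell different exponents apart; that is the task of
  homology.\<close>

type_synonym quat = "complex \<times> complex"

definition qone :: quat where "qone = (1, 0)"

text \<open>The pair (a, b) stands for a + b j with j c = cnj c j. In this convention left
  multiplication by \<open>(c, 0)\<close> scales both coordinates, which is exactly the circle
  action of the Hopf fibration.\<close>

definition qmul :: "quat \<Rightarrow> quat \<Rightarrow> quat" (infixl "*\<^sub>q" 70) where
  "x *\<^sub>q y = (fst x * fst y - snd x * cnj (snd y), fst x * snd y + snd x * cnj (fst y))"

definition qcnj :: "quat \<Rightarrow> quat" where "qcnj x = (cnj (fst x), - snd x)"

text \<open>The default \<open>qinv 0 = 0\<close> makes the norm formula and the vanishing criterion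
  hold for all arguments.\<close>

definition qinv :: "quat \<Rightarrow> quat" where "qinv x = qcnj x /\<^sub>R (norm x)\<^sup>2"

lemma fst_qmul [simp]: "fst (x *\<^sub>q y) = fst x * fst y - snd x * cnj (snd y)"
  and snd_qmul [simp]: "snd (x *\<^sub>q y) = fst x * snd y + snd x * cnj (fst y)"
  by (simp_all add: qmul_def)

lemma fst_qone [simp]: "fst qone = 1" and snd_qone [simp]: "snd qone = 0"
  by (simp_all add: qone_def)

lemma fst_qcnj [simp]: "fst (qcnj x) = cnj (fst x)" and snd_qcnj [simp]: "snd (qcnj x) = - snd x"
  by (simp_all add: qcnj_def)

lemma qmul_assoc: "(x *\<^sub>q y) *\<^sub>q z = x *\<^sub>q (y *\<^sub>q z)"
  by (simp add: prod_eq_iff algebra_simps)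

lemma qone_qmul [simp]: "qone *\<^sub>q x = x" and qmul_qone [simp]: "x *\<^sub>q qone = x"
  by (simp_all add: prod_eq_iff)

lemma norm_quat_sq: "(norm x)\<^sup>2 = (cmod (fst x))\<^sup>2 + (cmod (snd x))\<^sup>2" for x :: quat
  by (simp add: norm_prod_def)

lemma norm_qone [simp]: "norm qone = 1"
  by (simp add: qone_def norm_Pair)

lemma norm_qcnj [simp]: "norm (qcnj x) = norm x"
  by (simp add: qcnj_def norm_prod_def)

lemma norm_qmul: "norm (x *\<^sub>q y) = norm x * norm y"
proof -
  have "(norm (x *\<^sub>q y))\<^sup>2 = (norm x * norm y)\<^sup>2"
    unfolding power_mult_distrib norm_quat_sq cmod_power2
    by (simp add: power2_eq_square algebra_simps)
  then show ?thesis
    by (simp add: power2_eq_iff_nonneg)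
qed

lemma qmul_qcnj: "x *\<^sub>q qcnj x = (norm x)\<^sup>2 *\<^sub>R qone"
  and qcnj_qmul: "qcnj x *\<^sub>q x = (norm x)\<^sup>2 *\<^sub>R qone"
  unfolding norm_quat_sq
  by (simp_all add: prod_eq_iff complex_norm_square scaleR_conv_of_real mult.commute del: of_real_power)

lemma bounded_bilinear_qmul: "bounded_bilinear qmul"
proof
  show "\<exists>K. \<forall>a b. norm (a *\<^sub>q b) \<le> norm a * norm b * K"
    by (rule exI [of _ 1]) (simp add: norm_qmul)
qed (simp_all add: prod_eq_iff algebra_simps)

interpretation qmul: bounded_bilinear qmul
  by (rule bounded_bilinear_qmul)

lemma qinv_right: "x \<noteq> 0 \<Longrightarrow> x *\<^sub>q qinv x = qone"
  and qinv_left: "x \<noteq> 0 \<Longrightarrow> qinv x *\<^sub>q x = qone"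
  by (simp_all add: qinv_def qmul.scaleR_right qmul.scaleR_left qmul_qcnj qcnj_qmul)

lemma norm_qinv: "norm (qinv x) = inverse (norm x)"
  by (cases "x = 0") (simp_all add: qinv_def power2_eq_square field_simps)

lemma qmul_eq_0_iff [simp]: "x *\<^sub>q y = 0 \<longleftrightarrow> x = 0 \<or> y = 0"
  by (metis mult_eq_0_iff norm_eq_zero norm_qmul)

lemma qinv_eq_0_iff [simp]: "qinv x = 0 \<longleftrightarrow> x = 0"
  by (metis inverse_nonzero_iff_nonzero norm_eq_zero norm_qinv)

lemma qcnj_eq_0_iff [simp]: "qcnj x = 0 \<longleftrightarrow> x = 0"
  by (metis norm_eq_zero norm_qcnj)

lemma qone_neq_0 [simp]: "qone \<noteq> 0"
  by (simp add: qone_def prod_eq_iff)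

lemma qinv_minus: "qinv (- x) = - qinv x"
  by (simp add: qinv_def prod_eq_iff)

lemma bounded_linear_qcnj: "bounded_linear qcnj"
  by (rule bounded_linear_intro [where K = 1])
    (simp_all add: prod_eq_iff)

lemma continuous_on_qmul [continuous_intros]:
  "continuous_on S f \<Longrightarrow> continuous_on S g \<Longrightarrow> continuous_on S (\<lambda>x. f x *\<^sub>q g x)"
  by (rule qmul.continuous_on)

lemma continuous_on_qcnj [continuous_intros]:
  "continuous_on S f \<Longrightarrow> continuous_on S (\<lambda>x. qcnj (f x))"
  by (rule bounded_linear.continuous_on [OF bounded_linear_qcnj])

lemma continuous_on_qinv [continuous_intros]:
  "continuous_on S f \<Longrightarrow> (\<And>x. x \<in> S \<Longrightarrow> f x \<noteq> 0) \<Longrightarrow> continuous_on S (\<lambda>x. qinv (f x))"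
  unfolding qinv_def by (intro continuous_intros) auto

fun qpown :: "quat \<Rightarrow> nat \<Rightarrow> quat" where
  "qpown x 0 = qone"
| "qpown x (Suc n) = qpown x n *\<^sub>q x"

text \<open>Powers of one quaternion commute with each other, so the usual laws of exponents hold
  for \<open>x \<noteq> 0\<close> although multiplication is not commutative.\<close>

definition qpow :: "int \<Rightarrow> quat \<Rightarrow> quat" where
  "qpow k x = (if k \<ge> 0 then qpown x (nat k) else qpown (qinv x) (nat (- k)))"

lemma qpow_0 [simp]: "qpow 0 x = qone"
  by (simp add: qpow_def)

lemma qpow_succ: assumes "x \<noteq> 0" shows "qpow (k + 1) x = qpow k x *\<^sub>q x"
proof (cases "k \<ge> 0")
  case True
  then show ?thesis
    by (simp add: qpow_def nat_add_distrib)
next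
  case False
  then have "nat (- k) = Suc (nat (- (k + 1)))"
    by simp
  then show ?thesis
    using False assms
    by (auto simp: qpow_def qmul_assoc qinv_left)
qed

lemma qpow_pred: assumes "x \<noteq> 0" shows "qpow (k - 1) x = qpow k x *\<^sub>q qinv x"
  using qpow_succ [OF assms, of "k - 1"] assms by (simp add: qmul_assoc qinv_right)

lemma qpow_1 [simp]: "qpow 1 x = x"
  by (simp add: qpow_def)

lemma qpow_m1: "qpow (- 1) x = qinv x"
  by (simp add: qpow_def)

lemma qpow_eq_0_iff: "x \<noteq> 0 \<Longrightarrow> qpow k x \<noteq> 0"
  by (induction k rule: int_induct [of _ 0]) (auto simp: qpow_succ qpow_pred)

lemma norm_qpow: "norm x = 1 \<Longrightarrow> norm (qpow k x) = 1"
proof (induction k rule: int_induct [of _ 0])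
  case (step1 i)
  then have "x \<noteq> 0" by auto
  with step1 show ?case by (auto simp: qpow_succ norm_qmul)
next
  case (step2 i)
  then have "x \<noteq> 0" by auto
  with step2 show ?case by (auto simp: qpow_pred norm_qmul norm_qinv)
qed simp

lemma qpow_add: "x \<noteq> 0 \<Longrightarrow> qpow (k + l) x = qpow k x *\<^sub>q qpow l x"
proof (induction l rule: int_induct [of _ 0])
  case (step1 l)
  then show ?case
    using qpow_succ [of x "k + l"] qpow_succ [of x l] by (simp add: add.assoc qmul_assoc)
next
  case (step2 l)
  then show ?case
    using qpow_pred [of x "k + l"] qpow_pred [of x l] by (simp add: add_diff_eq qmul_assoc)
qed simp

lemma qpow_minus_int: assumes "x \<noteq> 0" shows "qpow (- k) x = qinv (qpow k x)"
proof -
  have "qpow k x *\<^sub>q qpow (- k) x = qone"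
    using qpow_add [OF assms, of k "- k"] by simp
  then have "qinv (qpow k x) *\<^sub>q (qpow k x *\<^sub>q qpow (- k) x) = qinv (qpow k x)"
    by simp
  then show ?thesis
    using qpow_eq_0_iff [OF assms] by (simp add: qinv_left flip: qmul_assoc)
qed

lemma qpow_mult: "x \<noteq> 0 \<Longrightarrow> qpow (k * l) x = qpow l (qpow k x)"
proof (induction l rule: int_induct [of _ 0])
  case (step1 l)
  then show ?case
    by (simp add: distrib_left qpow_add qpow_succ qpow_eq_0_iff)
next
  case (step2 l)
  then show ?case
    using qpow_add [of x "k * l" "- k"] by (simp add: right_diff_distrib qpow_pred qpow_eq_0_iff qpow_minus_int)
qed simp

lemma continuous_on_qpow [continuous_intros]:
  assumes f: "continuous_on S f" "\<And>x. x \<in> S \<Longrightarrow> f x \<noteq> 0"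
  shows "continuous_on S (\<lambda>x. qpow k (f x))"
proof (induction k rule: int_induct [of _ 0])
  case (step1 i)
  have "continuous_on S (\<lambda>x. qpow i (f x) *\<^sub>q f x)"
    by (intro continuous_intros step1 f)
  then show ?case
    by (rule continuous_on_eq) (simp add: qpow_succ f)
next
  case (step2 i)
  have "continuous_on S (\<lambda>x. qpow i (f x) *\<^sub>q qinv (f x))"
    by (intro continuous_intros step2 f)
  then show ?case
    by (rule continuous_on_eq) (simp add: qpow_pred f)
qed simp

section \<open>Counting zeros\<close>

lemma homotopic_with_canonE:
  assumes "homotopic_with_canon P X Y f g"
  obtains h where "continuous_on ({0..1::real} \<times> X) h" "\<And>t x. t \<in> {0..1} \<Longrightarrow> x \<in> X \<Longrightarrow> h (t, x) \<in> Y"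
    "\<And>x. h (0, x) = f x" "\<And>x. h (1, x) = g x" "\<And>t. t \<in> {0..1} \<Longrightarrow> P (\<lambda>x. h (t, x))"
proof -
  obtain h where h: "continuous_map (prod_topology (top_of_set {0..1::real}) (top_of_set X)) (top_of_set Y) h \<and>
       (\<forall>x. h(0, x) = f x) \<and> (\<forall>x. h(1, x) = g x) \<and> (\<forall>t \<in> {0..1}. P(\<lambda>x. h(t,x)))"
    using assms unfolding homotopic_with_def by (rule exE)
  show ?thesis
    by (rule that [of h]) (use h in \<open>simp_all add: Pi_iff\<close>)
qed

text \<open>Three separate properties allow an even homotopy times an odd one to be recognised as
  odd, as in \<open>odd_sphere_map_homotopic_qpow\<close>.\<close>

lemma homotopic_with_qmul:
  assumes f: "homotopic_with_canon P X A f f'" and g: "homotopic_with_canon Q X B g g'"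
    and C: "\<And>a b. a \<in> A \<Longrightarrow> b \<in> B \<Longrightarrow> a *\<^sub>q b \<in> C"
    and R: "\<And>f g. P f \<Longrightarrow> Q g \<Longrightarrow> R (\<lambda>x. f x *\<^sub>q g x)"
  shows "homotopic_with_canon R X C (\<lambda>x. f x *\<^sub>q g x) (\<lambda>x. f' x *\<^sub>q g' x)"
proof -
  obtain h where h: "continuous_on ({0..1::real} \<times> X) h" "\<And>t x. t \<in> {0..1} \<Longrightarrow> x \<in> X \<Longrightarrow> h (t, x) \<in> A"
    "\<And>x. h (0, x) = f x" "\<And>x. h (1, x) = f' x" "\<And>t. t \<in> {0..1} \<Longrightarrow> P (\<lambda>x. h (t, x))"
    using homotopic_with_canonE [OF f] by metis
  obtain k where k: "continuous_on ({0..1::real} \<times> X) k" "\<And>t x. t \<in> {0..1} \<Longrightarrow> x \<in> X \<Longrightarrow> k (t, x) \<in> B"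
    "\<And>x. k (0, x) = g x" "\<And>x. k (1, x) = g' x" "\<And>t. t \<in> {0..1} \<Longrightarrow> Q (\<lambda>x. k (t, x))"
    using homotopic_with_canonE [OF g] by metis
  show ?thesis
    unfolding homotopic_with_def
    using h k
    by (intro exI [of _ "\<lambda>z. h z *\<^sub>q k z"]) (auto intro!: continuous_intros C R simp: Pi_iff)
qed

abbreviation nz_homotopic :: "'a::topological_space set \<Rightarrow> ('a \<Rightarrow> quat) \<Rightarrow> ('a \<Rightarrow> quat) \<Rightarrow> bool" where
  "nz_homotopic X \<equiv> homotopic_with_canon (\<lambda>_. True) X (- {0})"

lemma nz_homotopic_qmul:
  "nz_homotopic X f f' \<Longrightarrow> nz_homotopic X g g' \<Longrightarrow> nz_homotopic X (\<lambda>x. f x *\<^sub>q g x) (\<lambda>x. f' x *\<^sub>q g' x)"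
  by (rule homotopic_with_qmul) auto

lemma path_connected_nz: "path_connected (- {0 :: quat})"
  by (rule path_connected_punctured_universe) simp

lemma nz_homotopic_refl:
  "continuous_on X f \<Longrightarrow> (\<And>x. x \<in> X \<Longrightarrow> f x \<noteq> 0) \<Longrightarrow> nz_homotopic X f f"
  by auto

lemma nz_homotopic_from_contractible:
  fixes X :: "'a::real_normed_vector set"
  assumes "contractible X" "continuous_on X f" "\<And>x. x \<in> X \<Longrightarrow> f x \<noteq> 0" "c \<noteq> 0"
  shows "nz_homotopic X f (\<lambda>_. c)"
  by (rule homotopic_from_contractible) (use assms path_connected_nz in auto)

text \<open>Rouche's argument: the segment from \<open>f x\<close> to \<open>g x\<close> stays in a
  ball about \<open>g x\<close> that is too small to reach 0.\<close>

lemma nz_homotopic_near: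
  assumes "continuous_on X f" "continuous_on X g" and near: "\<And>x. x \<in> X \<Longrightarrow> norm (f x - g x) < norm (g x)"
  shows "nz_homotopic X f g"
proof (rule homotopic_with_linear)
  fix x assume x: "x \<in> X"
  have "y \<noteq> 0" if y: "y \<in> closed_segment (f x) (g x)" for y
  proof -
    have "norm (y - g x) \<le> norm (f x - g x)"
      using segment_bound(2) [OF y] by (simp add: norm_minus_commute)
    then show ?thesis
      using near [OF x] by auto
  qed
  then show "closed_segment (f x) (g x) \<subseteq> - {0}"
    by blast
qed (use assms in auto)

lemma continuous_on_qpow_shift: "a \<notin> X \<Longrightarrow> continuous_on X (\<lambda>x. qpow k (x - a))"
  by (intro continuous_intros) auto

lemma nz_homotopic_compose_right:
  assumes "nz_homotopic Y f g" "continuous_on X h" "\<And>x. x \<in> X \<Longrightarrow> h x \<in> Y"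
  shows "nz_homotopic X (\<lambda>x. f (h x)) (\<lambda>x. g (h x))"
  using homotopic_with_compose_continuous_right [of "\<lambda>_. True" h Y "-{0}" f g X] assms
  by (auto simp: o_def)

lemma nz_homotopic_qpow_compose:
  assumes "nz_homotopic X f g"
  shows "nz_homotopic X (\<lambda>x. qpow k (f x)) (\<lambda>x. qpow k (g x))"
proof -
  have "continuous_on (-{0}) (qpow k)"
    by (intro continuous_intros) auto
  then show ?thesis
    using homotopic_with_compose_continuous_left [of "\<lambda>_. True" "qpow k" X "-{0}" f g "-{0}"] assms
    by (auto simp: o_def qpow_eq_0_iff)
qed

lemma nz_homotopic_qpow_shift:
  assumes "norm a < 1"
  shows "nz_homotopic (sphere 0 1) (\<lambda>x. qpow k (x - a)) (qpow k)"
proof -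
  have "nz_homotopic (sphere 0 1) (\<lambda>x. x - a) (\<lambda>x. x)"
    by (rule nz_homotopic_near) (use assms in \<open>auto intro!: continuous_intros\<close>)
  then show ?thesis
    by (rule nz_homotopic_qpow_compose)
qed

text \<open>The integer k plays the role of the local degree at a. Since the homotopy has values in
  the nonzero quaternions, the condition also says that F has no zero near a other than possibly a
  itself.\<close>

definition local_class :: "(quat \<Rightarrow> quat) \<Rightarrow> quat \<Rightarrow> int \<Rightarrow> bool" where
  "local_class F a k \<longleftrightarrow> (\<exists>r>0. nz_homotopic (cball a r - {a}) F (\<lambda>x. qpow k (x - a)))"

lemma local_classD:
  assumes F: "local_class F a k" and U: "open U" "a \<in> U"
  obtains r where "r > 0" "cball a r \<subseteq> U" "nz_homotopic (cball a r - {a}) F (\<lambda>x. qpow k (x - a))"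
proof -
  obtain r where r: "r > 0" "nz_homotopic (cball a r - {a}) F (\<lambda>x. qpow k (x - a))"
    using F by (auto simp: local_class_def)
  obtain s where s: "s > 0" "cball a s \<subseteq> U"
    using U open_contains_cball by blast
  show ?thesis
  proof
    show "min r s > 0" "cball a (min r s) \<subseteq> U"
      using r s by auto
    show "nz_homotopic (cball a (min r s) - {a}) F (\<lambda>x. qpow k (x - a))"
      by (rule homotopic_with_subset_left [OF r(2)]) auto
  qed
qed

text \<open>Division removes a zero: multiplied by (x - a)^(-k), the map becomes null-homotopic on a
  small sphere about a and can be redefined inside without a zero. Multiplying back on the unit
  sphere, where (x - a)^k deforms to x^k because a lies inside, adds k to the exponent.\<close>

theorem nz_homotopic_qpow_sum:
  assumes "finite Z" "Z \<subseteq> ball 0 1"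
    and "continuous_on (cball 0 1 - Z) F" "\<And>x. x \<in> cball 0 1 - Z \<Longrightarrow> F x \<noteq> 0"
    and "\<And>a. a \<in> Z \<Longrightarrow> local_class F a (\<kappa> a)"
  shows "nz_homotopic (sphere 0 1) F (qpow (\<Sum>a\<in>Z. \<kappa> a))"
  using assms
proof (induction Z arbitrary: F rule: finite_induct)
  case empty
  have "nz_homotopic (cball 0 1) F (\<lambda>_. qone)"
    by (rule nz_homotopic_from_contractible) (use empty in \<open>auto intro: convex_imp_contractible\<close>)
  then have "nz_homotopic (sphere 0 1) F (\<lambda>_. qone)"
    by (rule homotopic_with_subset_left) auto
  then show ?case
    by (rule homotopic_with_eq) auto
next
  case (insert a Z)
  have oa: "open (ball 0 1 - Z)" "a \<in> ball 0 1 - Z"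
    using insert.hyps insert.prems by (auto intro!: open_Diff finite_imp_closed)
  obtain r where r: "r > 0" "cball a r \<subseteq> ball 0 1 - Z"
    and hom: "nz_homotopic (cball a r - {a}) F (\<lambda>x. qpow (\<kappa> a) (x - a))"
    by (rule local_classD [OF _ oa]) (use insert.prems in blast)
  define F1 where "F1 x = F x *\<^sub>q qpow (- \<kappa> a) (x - a)" for x
  have "nz_homotopic (sphere a r) F1 (\<lambda>x. qpow (\<kappa> a) (x - a) *\<^sub>q qpow (- \<kappa> a) (x - a))"
    unfolding F1_def
  proof (intro nz_homotopic_qmul nz_homotopic_refl continuous_on_qpow_shift)
    show "nz_homotopic (sphere a r) F (\<lambda>x. qpow (\<kappa> a) (x - a))"
      by (rule homotopic_with_subset_left [OF hom]) (use r in auto)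
  qed (use r in \<open>auto simp: qpow_eq_0_iff\<close>)
  then have "nz_homotopic (sphere a r) F1 (\<lambda>x. qone)"
  proof (rule homotopic_with_eq)
    fix x assume "x \<in> topspace (top_of_set (sphere a r))"
    then have "x - a \<noteq> 0"
      using r by auto
    then show "qone = qpow (\<kappa> a) (x - a) *\<^sub>q qpow (- \<kappa> a) (x - a)"
      using qpow_add [of "x - a" "\<kappa> a" "- \<kappa> a"] by simp
  qed auto
  \<comment> \<open>A null-homotopic map on the sphere extends over the ball with values in the same
    space; replacing F1 by g inside the ball gives F2, which is defined and nonzero at a.\<close>
  then obtain g where g: "continuous_on (cball a r) g" "g ` cball a r \<subseteq> - {0}" "\<And>x. x \<in> sphere a r \<Longrightarrow> g x = F1 x"
    using nullhomotopic_from_sphere_extension [of a r "-{0}" F1] by blast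
  define F2 where "F2 x = (if x \<in> cball a r then g x else F1 x)" for x
  have contF1: "continuous_on (cball 0 1 - insert a Z) F1"
    unfolding F1_def by (intro continuous_intros insert.prems) auto
  have F1nz: "F1 x \<noteq> 0" if "x \<in> cball 0 1 - insert a Z" for x
    using insert.prems(3) [OF that] that by (auto simp: F1_def qpow_eq_0_iff)
  have eq: "cball a r \<union> (cball 0 1 - Z - ball a r) = cball 0 1 - Z"
    using r by (auto simp: subset_eq)
  have "continuous_on (cball a r \<union> (cball 0 1 - Z - ball a r)) F2"
    unfolding F2_def
  proof (rule continuous_on_cases_local)
    show "closedin (top_of_set (cball a r \<union> (cball 0 1 - Z - ball a r))) (cball a r)"
      by (rule closed_subset) auto
    show "closedin (top_of_set (cball a r \<union> (cball 0 1 - Z - ball a r))) (cball 0 1 - Z - ball a r)"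
      unfolding eq closedin_closed by (rule exI [of _ "- ball a r"]) auto
    show "continuous_on (cball 0 1 - Z - ball a r) F1"
      by (rule continuous_on_subset [OF contF1]) (use r in auto)
  qed (use g in \<open>auto simp: not_le dist_norm\<close>)
  then have contF2: "continuous_on (cball 0 1 - Z) F2"
    by (simp add: eq)
  have F2nz: "F2 x \<noteq> 0" if "x \<in> cball 0 1 - Z" for x
  proof (cases "x \<in> cball a r")
    case True
    then show ?thesis using g by (auto simp: F2_def)
  next
    case False
    then have "x \<noteq> a" using r by auto
    with False show ?thesis using that F1nz [of x] by (simp add: F2_def)
  qed
  have "nz_homotopic (sphere 0 1) F2 (qpow (\<Sum>a\<in>Z. \<kappa> a))"
  proof (rule insert.IH [OF _ contF2 F2nz])
    show "local_class F2 b (\<kappa> b)" if b: "b \<in> Z" for b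
    proof -
      have U: "open (- cball a r)" "b \<in> - cball a r"
        using r b by auto
      obtain s where s: "s > 0" "cball b s \<subseteq> - cball a r"
        and homb: "nz_homotopic (cball b s - {b}) F (\<lambda>x. qpow (\<kappa> b) (x - b))"
        by (rule local_classD [OF _ U]) (use insert.prems b in blast)
      have a: "a \<notin> cball b s"
        using s r by auto
      \<comment> \<open>On a ball about b that misses a the new factor is defined everywhere and
        hence null-homotopic, so it does not change the exponent at b.\<close>
      have "nz_homotopic (cball b s) (\<lambda>x. qpow (- \<kappa> a) (x - a)) (\<lambda>_. qone)"
        by (rule nz_homotopic_from_contractible)
          (use a in \<open>auto intro!: convex_imp_contractible continuous_on_qpow_shift qpow_eq_0_iff\<close>)
      then have "nz_homotopic (cball b s - {b}) (\<lambda>x. qpow (- \<kappa> a) (x - a)) (\<lambda>_. qone)"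
        by (rule homotopic_with_subset_left) auto
      from nz_homotopic_qmul [OF homb this]
      have "nz_homotopic (cball b s - {b}) F2 (\<lambda>x. qpow (\<kappa> b) (x - b))"
        by (rule homotopic_with_eq) (use s in \<open>auto simp: F2_def F1_def subset_eq\<close>)
      then show ?thesis
        using s(1) by (auto simp: local_class_def)
    qed
  qed (use insert.prems in auto)
  then have "nz_homotopic (sphere 0 1) (\<lambda>x. F2 x *\<^sub>q qpow (\<kappa> a) (x - a)) (\<lambda>x. qpow (\<Sum>a\<in>Z. \<kappa> a) x *\<^sub>q qpow (\<kappa> a) x)"
    by (intro nz_homotopic_qmul nz_homotopic_qpow_shift) (use insert.prems in auto)
  then show ?case
  proof (rule homotopic_with_eq)
    fix x :: quat assume "x \<in> topspace (top_of_set (sphere 0 1))"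
    then have x: "norm x = 1" by simp
    then have ne: "x - a \<noteq> 0"
      using insert.prems(1) by auto
    have "x \<notin> cball a r"
      using x r by auto
    then have "F2 x = F1 x"
      by (simp add: F2_def)
    then show "F x = F2 x *\<^sub>q qpow (\<kappa> a) (x - a)"
      using qpow_add [OF ne, of "- \<kappa> a" "\<kappa> a"] by (simp add: F1_def qmul_assoc)
    have "x \<noteq> 0" using x by auto
    then show "qpow (sum \<kappa> (insert a Z)) x = qpow (sum \<kappa> Z) x *\<^sub>q qpow (\<kappa> a) x"
      using insert.hyps qpow_add [of x "sum \<kappa> Z" "\<kappa> a"] by (simp add: add.commute)
  qed auto
qed

section \<open>Linear isomorphisms\<close>

lemma nz_homotopic_consts:
  assumes "a \<noteq> 0" "b \<noteq> 0"
  shows "nz_homotopic X (\<lambda>_. a) (\<lambda>_. b)"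
proof -
  have "path_component (-{0 :: quat}) a b"
    using path_connected_nz assms unfolding path_connected_component by blast
  then show ?thesis
    by (simp add: homotopic_constant_maps)
qed

lemma nz_homotopic_scale:
  assumes "continuous_on X f" "continuous_on X s" "\<And>x. x \<in> X \<Longrightarrow> f x \<noteq> 0" "\<And>x. x \<in> X \<Longrightarrow> s x > 0"
  shows "nz_homotopic X f (\<lambda>x. s x *\<^sub>R f x)"
proof (rule homotopic_with_linear)
  fix x assume x: "x \<in> X"
  have "y \<noteq> 0" if "y \<in> closed_segment (f x) (s x *\<^sub>R f x)" for y
  proof -
    obtain t where t: "0 \<le> t" "t \<le> 1" "y = (1 - t) *\<^sub>R f x + t *\<^sub>R (s x *\<^sub>R f x)"
      using \<open>y \<in> _\<close> unfolding closed_segment_def by blast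
    have "1 - t + t * s x > 0"
      using t assms(4) [OF x] by (cases "t = 1") (auto intro: add_pos_nonneg)
    moreover have "y = (1 - t + t * s x) *\<^sub>R f x"
      using t by (simp add: scaleR_left_distrib)
    ultimately show ?thesis
      using assms(3) [OF x] by (metis less_irrefl scaleR_eq_0_iff)
  qed
  then show "closed_segment (f x) (s x *\<^sub>R f x) \<subseteq> - {0}"
    by blast
qed (use assms in \<open>auto intro!: continuous_intros\<close>)

lemma nz_homotopic_qcnj_qpow: "nz_homotopic (-{0}) qcnj (qpow (- 1))"
proof -
  have "nz_homotopic (-{0}) qcnj (\<lambda>x. inverse ((norm x)\<^sup>2) *\<^sub>R qcnj x)"
    by (rule nz_homotopic_scale) (auto intro!: continuous_intros)
  then show ?thesis
    by (rule homotopic_with_eq) (auto simp: qpow_m1 qinv_def)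
qed

text \<open>Polarising \<open>x *\<^sub>q qcnj x\<close> gives twice the inner product as the sum of
  \<open>x *\<^sub>q qcnj u\<close> and \<open>u *\<^sub>q qcnj x\<close>; multiplying by the unit
  vector u from the right isolates x.\<close>

lemma reflection_eq_qmul:
  assumes "norm u = 1"
  shows "x - (2 * (x \<bullet> u)) *\<^sub>R u = (- u) *\<^sub>q qcnj x *\<^sub>q u"
proof -
  have "x *\<^sub>q qcnj u + u *\<^sub>q qcnj x = (2 * (x \<bullet> u)) *\<^sub>R qone"
    by (simp add: prod_eq_iff complex_eq_iff inner_prod_def inner_complex_def algebra_simps)
  then have "(x *\<^sub>q qcnj u + u *\<^sub>q qcnj x) *\<^sub>q u = (2 * (x \<bullet> u)) *\<^sub>R u"
    by (simp add: qmul.scaleR_left)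
  then show ?thesis
    using assms by (simp add: qmul.add_left qmul_assoc qcnj_qmul qmul.minus_left algebra_simps)
qed

text \<open>The constant factors -u and u can be moved to 1 within the nonzero quaternions. What
  remains is conjugation, a positive multiple of the inverse.\<close>

lemma nz_homotopic_reflection:
  assumes "norm u = 1"
  shows "nz_homotopic (-{0}) (\<lambda>x. x - (2 * (x \<bullet> u)) *\<^sub>R u) (qpow (- 1))"
proof -
  have "u \<noteq> 0" using assms by auto
  then have "nz_homotopic (-{0}) (\<lambda>x. (- u) *\<^sub>q qcnj x *\<^sub>q u) (\<lambda>x. qone *\<^sub>q qpow (- 1) x *\<^sub>q qone)"
    by (intro nz_homotopic_qmul nz_homotopic_consts nz_homotopic_qcnj_qpow) auto
  then show ?thesis
    by (simp add: reflection_eq_qmul [OF assms])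
qed

definition qpow_class :: "(quat \<Rightarrow> quat) \<Rightarrow> bool" where
  "qpow_class A \<longleftrightarrow> (\<exists>k. nz_homotopic (-{0}) A (qpow k))"

lemma qpow_class_homotopic: "nz_homotopic (-{0}) A B \<Longrightarrow> qpow_class B \<Longrightarrow> qpow_class A"
  unfolding qpow_class_def using homotopic_with_trans by blast

lemma qpow_class_compose:
  assumes "qpow_class A" "qpow_class B"
  shows "qpow_class (\<lambda>x. A (B x))"
proof -
  obtain k l where A: "nz_homotopic (-{0}) A (qpow k)" and B: "nz_homotopic (-{0}) B (qpow l)"
    using assms by (auto simp: qpow_class_def)
  have "nz_homotopic (-{0}) (\<lambda>x. A (B x)) (\<lambda>x. qpow k (B x))"
    by (rule nz_homotopic_compose_right [OF A])
      (use homotopic_with_imp_continuous [OF B] homotopic_with_imp_subset1 [OF B] in auto)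
  moreover have "nz_homotopic (-{0}) (\<lambda>x. qpow k (B x)) (\<lambda>x. qpow k (qpow l x))"
    by (rule nz_homotopic_qpow_compose [OF B])
  ultimately have "nz_homotopic (-{0}) (\<lambda>x. A (B x)) (\<lambda>x. qpow k (qpow l x))"
    by (rule homotopic_with_trans)
  then have "nz_homotopic (-{0}) (\<lambda>x. A (B x)) (qpow (l * k))"
    by (rule homotopic_with_eq) (auto simp: qpow_mult)
  then show ?thesis
    by (auto simp: qpow_class_def)
qed

lemma nz_homotopic_linear:
  assumes "linear A" "linear B" and seg: "\<And>t x. 0 \<le> t \<Longrightarrow> t \<le> 1 \<Longrightarrow> x \<noteq> 0 \<Longrightarrow> (1 - t) *\<^sub>R A x + t *\<^sub>R B x \<noteq> 0"
  shows "nz_homotopic (-{0 :: quat}) A B"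
proof (rule homotopic_with_linear)
  show "continuous_on (- {0}) A" "continuous_on (- {0}) B"
    using assms by (simp_all add: linear_continuous_on linear_linear)
qed (use seg in \<open>auto simp: closed_segment_def\<close>)

text \<open>Invertible linear maps are products of elementary ones, and each elementary one is a
  reflection or can be deformed, without becoming singular, to the identity or a product of
  reflections. The induction over elementary maps lives on \<open>real ^ 4\<close>, hence the
  transport by the isometries f and g.\<close>

lemma qpow_class_linear:
  fixes A :: "quat \<Rightarrow> quat"
  assumes "linear A" "inj A"
  shows "qpow_class A"
proof -
  have dim: "DIM(quat) = DIM(real ^ 4)"
    by simp
  obtain f :: "quat \<Rightarrow> real ^ 4" and g where lf: "linear f" and lg: "linear g"
    and nf: "\<And>x. norm (f x) = norm x" and ng: "\<And>y. norm (g y) = norm y"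
    and gf: "\<And>x. g (f x) = x" and fg: "\<And>y. f (g y) = y"
    by (rule isomorphisms_UNIV_UNIV [OF dim]) (rule that)
  have f0: "f x = 0 \<longleftrightarrow> x = 0" for x
    by (metis nf norm_eq_zero)
  have g0: "g y = 0 \<longleftrightarrow> y = 0" for y
    by (metis ng norm_eq_zero)
  have inner_f: "f x \<bullet> f y = x \<bullet> y" for x y
    by (simp add: dot_norm nf flip: linear_add [OF lf])
  have axis_nth: "axis m (1::real) $ j = (if j = m then 1 else 0)" for m j :: 4
    by (simp add: axis_def)
  \<comment> \<open>The premise \<open>inj B\<close> makes P vacuous for singular maps, such as
    those with a zero row. For a composite, injectivity passes to both factors because the
    dimensions are finite and equal.\<close>
  define P where "P B \<longleftrightarrow> linear B \<and> (inj B \<longrightarrow> qpow_class (\<lambda>x. g (B (f x))))" for B :: "real ^ 4 \<Rightarrow> real ^ 4"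
  have lin: "linear (\<lambda>x. g (B (f x)))" if "linear B" for B
    using linear_compose [OF linear_compose [OF lf that] lg] by (simp add: o_def)
  have P_homotopic: "P B" if B: "linear B" and C: "linear C" "P C"
    and seg: "\<And>t x. 0 \<le> t \<Longrightarrow> t \<le> 1 \<Longrightarrow> inj B \<Longrightarrow> inj C \<and> ((1 - t) *\<^sub>R B x + t *\<^sub>R C x = 0 \<longrightarrow> x = 0)" for B C
    unfolding P_def
  proof (intro conjI impI B)
    assume inj: "inj B"
    have "nz_homotopic (-{0}) (\<lambda>x. g (B (f x))) (\<lambda>x. g (C (f x)))"
    proof (rule nz_homotopic_linear [OF lin [OF B] lin [OF C(1)]])
      fix t :: real and x :: quat
      assume t: "0 \<le> t" "t \<le> 1" and x: "x \<noteq> 0"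
      have "(1 - t) *\<^sub>R g (B (f x)) + t *\<^sub>R g (C (f x)) = g ((1 - t) *\<^sub>R B (f x) + t *\<^sub>R C (f x))"
        by (simp add: linear_add [OF lg] linear_scale [OF lg])
      then show "(1 - t) *\<^sub>R g (B (f x)) + t *\<^sub>R g (C (f x)) \<noteq> 0"
        using seg [OF t inj, of "f x"] x by (auto simp: f0 g0)
    qed
    then show "qpow_class (\<lambda>x. g (B (f x)))"
      by (rule qpow_class_homotopic) (use C seg [of 0] inj in \<open>auto simp: P_def\<close>)
  qed
  have qpow_class_id: "qpow_class (\<lambda>x. x)"
  proof -
    have "nz_homotopic (-{0}) (\<lambda>x::quat. x) (qpow 1)"
      by (rule homotopic_with_equal) (auto intro!: continuous_intros)
    then show ?thesis
      unfolding qpow_class_def by blast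
  qed
  have P_id: "P (\<lambda>x. x)"
    by (simp add: P_def gf linear_id [unfolded id_def] qpow_class_id)
  have P_comp: "P (B \<circ> C)" if "P B" "P C" for B C
  proof -
    have "inj C" "inj B" if "inj (B \<circ> C)"
    proof -
      show "inj C"
        using that inj_on_imageI2 by blast
      then have "surj C"
        using \<open>P C\<close> linear_injective_imp_surjective by (auto simp: P_def)
      then show "inj B"
        using that by (metis (no_types, lifting) comp_apply injD injI surjD)
    qed
    then show ?thesis
      using that qpow_class_compose [of "\<lambda>x. g (B (f x))" "\<lambda>x. g (C (f x))"]
      unfolding P_def by (simp add: fg linear_compose)
  qed
  have P_reflection: "P (\<lambda>x. x - (2 * (x \<bullet> w)) *\<^sub>R w)" if w: "norm w = 1" for w
  proof -
    have "g (f x - (2 * (f x \<bullet> w)) *\<^sub>R w) = x - (2 * (x \<bullet> g w)) *\<^sub>R g w" for x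
      using inner_f [of x "g w"] by (simp add: linear_diff [OF lg] linear_scale [OF lg] gf fg)
    moreover have "linear (\<lambda>x. x - (2 * (x \<bullet> w)) *\<^sub>R w)"
      by (rule linearI) (auto simp: algebra_simps inner_add_left)
    ultimately show ?thesis
      using nz_homotopic_reflection [of "g w"] w by (auto simp: P_def ng qpow_class_def)
  qed
  have lin_diag: "linear (\<lambda>x::real^4. \<chi> i. c i * x $ i)" for c
    by (rule linearI) (auto simp: vec_eq_iff algebra_simps)
  \<comment> \<open>Each change of sign is the reflection in a coordinate hyperplane.\<close>
  have P_sign: "P (\<lambda>x. \<chi> i. (if i \<in> S then - 1 else 1) * x $ i)" if "finite S" for S :: "4 set"
    using that
  proof (induction S)
    case empty
    have "(\<lambda>x::real^4. \<chi> i. (if i \<in> {} then - 1 else 1) * x $ i) = (\<lambda>x. x)"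
      by (auto simp: vec_eq_iff)
    then show ?case
      by (simp only: P_id)
  next
    case (insert m S)
    have "(\<lambda>x. x - (2 * (x \<bullet> axis m 1)) *\<^sub>R axis m 1) \<circ> (\<lambda>x. \<chi> i. (if i \<in> S then - 1 else 1) * x $ i)
      = (\<lambda>x::real^4. \<chi> i. (if i \<in> insert m S then - 1 else 1) * x $ i)"
      using insert.hyps by (auto simp: fun_eq_iff vec_eq_iff inner_axis axis_nth)
    then show ?case
      using P_comp [OF P_reflection [of "axis m 1"] insert.IH] by (simp add: norm_axis_1)
  qed
  have "P (f \<circ> A \<circ> g)"
  proof (rule induct_linear_elementary [where P = P])
    show "linear (f \<circ> A \<circ> g)"
      by (intro linear_compose lf lg assms)
  next
    fix B :: "real^4 \<Rightarrow> real^4" and i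
    assume B: "linear B" "\<And>x. B x $ i = 0"
    have "\<not> inj B"
    proof
      assume "inj B"
      then have "surj B"
        using linear_injective_imp_surjective B by blast
      then obtain x where "B x = axis i 1"
        by (metis surj_def)
      then show False
        using B(2) [of x] by (simp add: axis_def)
    qed
    then show "P B"
      using B by (simp add: P_def)
  next
    fix c :: "4 \<Rightarrow> real"
    let ?C = "\<lambda>x::real^4. \<chi> i. (if i \<in> {i. c i < 0} then - 1 else 1) * x $ i"
    \<comment> \<open>Every diagonal entry moves linearly to its own sign and so never meets
      0.\<close>
    show "P (\<lambda>x. \<chi> i. c i * x $ i)"
    proof (rule P_homotopic [OF lin_diag lin_diag P_sign [of "{i. c i < 0}"]])
      fix t :: real and x :: "real^4"
      assume t: "0 \<le> t" "t \<le> 1" and inj: "inj (\<lambda>x. \<chi> i. c i * x $ i)"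
      have c: "c i \<noteq> 0" for i
      proof
        assume "c i = 0"
        then have "(\<chi> j. c j * axis i 1 $ j) = (\<chi> j. c j * (0 :: real^4) $ j)"
          by (auto simp: vec_eq_iff axis_def)
        then show False
          using injD [OF inj] by (metis axis_eq_0_iff zero_neq_one)
      qed
      have "x $ i = 0" if "(1 - t) * (c i * x $ i) + t * ((if c i < 0 then - 1 else 1) * x $ i) = 0" for i
      proof -
        have "((1 - t) * c i + t * (if c i < 0 then - 1 else 1)) * x $ i = 0"
          using that by (simp add: algebra_simps)
        moreover have "(1 - t) * c i + t * (if c i < 0 then - 1 else 1) \<noteq> 0"
        proof (cases "c i < 0")
          case True
          then have "(1 - t) * c i + t * (- 1) < 0"
            using t mult_nonneg_nonpos [of "1 - t" "c i"] by (cases "t = 0") auto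
          with True show ?thesis by simp
        next
          case False
          then have "c i > 0" using c [of i] by simp
          then have "(1 - t) * c i + t * 1 > 0"
            using t by (cases "t = 0") (simp_all add: add_nonneg_pos)
          with False show ?thesis by simp
        qed
        ultimately show ?thesis
          by (metis mult_eq_0_iff)
      qed
      note zero = this
      have "inj ?C"
      proof (rule injI)
        fix x y assume eq: "?C x = ?C y"
        have "x $ i = y $ i" for i
        proof -
          have "(if i \<in> {i. c i < 0} then - 1 else 1) * x $ i = (if i \<in> {i. c i < 0} then - 1 else 1) * y $ i"
            using arg_cong [OF eq, of "\<lambda>z. z $ i"] by (simp only: vec_lambda_beta)
          then show ?thesis
            by (cases "i \<in> {i. c i < 0}") simp_all
        qed
        then show "x = y"
          by (simp add: vec_eq_iff)
      qed
      moreover have "x = 0" if eq: "(1 - t) *\<^sub>R (\<chi> i. c i * x $ i) + t *\<^sub>R ?C x = 0"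
      proof -
        have "x $ i = 0" for i
          using arg_cong [OF eq, of "\<lambda>z. z $ i"] by (intro zero) simp
        then show ?thesis
          by (simp add: vec_eq_iff)
      qed
      ultimately show "inj ?C \<and> ((1 - t) *\<^sub>R (\<chi> i. c i * x $ i) + t *\<^sub>R ?C x = 0 \<longrightarrow> x = 0)"
        by blast
    qed auto
  next
    fix m n :: 4
    assume mn: "m \<noteq> n"
    \<comment> \<open>Reflection along the difference of two basis vectors exchanges the two
      coordinates; the factor only normalises w.\<close>
    define w :: "real^4" where "w = (1 / sqrt 2) *\<^sub>R (axis m 1 - axis n 1)"
    have "(norm w)\<^sup>2 = 1"
      using mn unfolding power2_norm_eq_inner by (simp add: w_def inner_diff inner_axis axis_nth)
    then have "norm w = 1"
      by (simp add: power2_eq_1_iff) (metis norm_ge_zero not_one_le_zero neg_0_le_iff_le)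
    moreover have "x - (2 * (x \<bullet> w)) *\<^sub>R w = (\<chi> i. x $ Transposition.transpose m n i)" for x
    proof -
      have "2 * (x \<bullet> w) * (1 / sqrt 2) = x $ m - x $ n"
        by (simp add: w_def inner_diff_right inner_axis)
      then have "(2 * (x \<bullet> w)) *\<^sub>R w = (x $ m - x $ n) *\<^sub>R (axis m 1 - axis n 1)"
        by (simp add: w_def)
      then show ?thesis
        using mn by (simp add: vec_eq_iff axis_nth Transposition.transpose_def)
    qed
    ultimately show "P (\<lambda>x. \<chi> i. x $ Transposition.transpose m n i)"
      using P_reflection [of w] by simp
    \<comment> \<open>At time t the shear adds (1 - t) times coordinate n to coordinate m, which is
      injective for every t.\<close>
    show "P (\<lambda>x. \<chi> i. if i = m then x $ m + x $ n else x $ i)"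
    proof (rule P_homotopic [OF _ _ P_id])
      show "linear (\<lambda>x::real^4. \<chi> i. if i = m then x $ m + x $ n else x $ i)"
        by (rule linearI) (auto simp: vec_eq_iff algebra_simps)
      show "linear (\<lambda>x::real^4. x)"
        by (simp add: linear_id [unfolded id_def])
      show "inj (\<lambda>x::real^4. x) \<and> ((1 - t) *\<^sub>R (\<chi> i. if i = m then x $ m + x $ n else x $ i) + t *\<^sub>R x = 0 \<longrightarrow> x = 0)"
        for t :: real and x :: "real^4"
      proof (intro conjI impI)
        assume eq: "(1 - t) *\<^sub>R (\<chi> i. if i = m then x $ m + x $ n else x $ i) + t *\<^sub>R x = 0"
        have e: "(1 - t) * (if i = m then x $ m + x $ n else x $ i) + t * x $ i = 0" for i
          using eq unfolding vec_eq_iff by simp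
        have ne: "x $ i = 0" if "i \<noteq> m" for i
          using e [of i] that by (simp add: algebra_simps)
        have "x $ m = 0"
          using e [of m] ne [of n] mn by (simp add: algebra_simps)
        then show "x = 0"
          using ne by (metis vec_eq_iff zero_index)
      qed auto
    qed
  qed (rule P_comp)
  moreover have "inj (f \<circ> A \<circ> g)"
    using assms by (metis fg gf inj_compose inj_on_inverseI)
  ultimately show ?thesis
    by (simp add: P_def gf)
qed

section \<open>Self-maps of the 3-sphere\<close>

text \<open>Near a the error of the linear approximation is at most half of the lower bound
  \<open>B * norm (x - a)\<close> for the linear part, so \<open>nz_homotopic_near\<close> applies.
  The radius is d / 2 because the estimate holds only at distances strictly below d, while the ball
  is closed.\<close>

lemma local_class_derivative:
  assumes der: "(F has_derivative A) (at a)" and F: "F a = 0" "continuous_on UNIV F" and A: "inj A"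
    and k: "nz_homotopic (-{0}) A (qpow k)"
  shows "local_class F a k"
proof -
  have lin: "linear A"
    using der has_derivative_linear by blast
  obtain B where B: "B > 0" "\<And>x. B * norm x \<le> norm (A x)"
    using linear_inj_bounded_below_pos [OF lin A] by blast
  obtain d where d: "d > 0" "\<And>y. norm (y - a) < d \<Longrightarrow> norm (F y - F a - A (y - a)) \<le> B / 2 * norm (y - a)"
    using der B(1) unfolding has_derivative_at_alt by (meson half_gt_zero)
  have near: "nz_homotopic (cball a (d / 2) - {a}) F (\<lambda>x. A (x - a))"
  proof (rule nz_homotopic_near)
    show "continuous_on (cball a (d / 2) - {a}) F"
      using F continuous_on_subset by blast
    show "continuous_on (cball a (d / 2) - {a}) (\<lambda>x. A (x - a))"
      by (rule linear_continuous_on_compose [OF _ lin]) (intro continuous_intros)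
    fix x assume x: "x \<in> cball a (d / 2) - {a}"
    then have "norm (x - a) \<le> d / 2" "norm (x - a) > 0"
      by (auto simp: dist_norm norm_minus_commute)
    then have "norm (F x - A (x - a)) \<le> B / 2 * norm (x - a)"
      using d(2) [of x] d(1) F by simp
    also have "\<dots> < B * norm (x - a)"
      using B \<open>norm (x - a) > 0\<close> by simp
    also have "\<dots> \<le> norm (A (x - a))"
      by (rule B)
    finally show "norm (F x - A (x - a)) < norm (A (x - a))" .
  qed
  have "nz_homotopic (cball a (d / 2) - {a}) (\<lambda>x. A (x - a)) (\<lambda>x. qpow k (x - a))"
    by (rule nz_homotopic_compose_right [OF k]) (auto intro!: continuous_intros)
  with near have "nz_homotopic (cball a (d / 2) - {a}) F (\<lambda>x. qpow k (x - a))"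
    by (rule homotopic_with_trans)
  then show ?thesis
    unfolding local_class_def using d(1) half_gt_zero by blast
qed

lemma local_class_imp_isolated:
  assumes "local_class F a k"
  shows "\<not> a islimpt {x. F x = 0}"
proof -
  obtain r where r: "r > 0" "nz_homotopic (cball a r - {a}) F (\<lambda>x. qpow k (x - a))"
    using assms unfolding local_class_def by blast
  have "F x \<noteq> 0" if "x \<noteq> a" "dist x a < r" for x
    using homotopic_with_imp_subset1 [OF r(2)] that by (auto simp: dist_commute)
  then show ?thesis
    using r(1) unfolding islimpt_approachable by blast
qed

text \<open>The version of Sard's theorem used here speaks of ranks of matrices on
  \<open>real ^ 4\<close>; linear isomorphisms carry both the critical points and negligibility
  across.\<close>

lemma negligible_critical_values:
  fixes F :: "quat \<Rightarrow> quat"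
  assumes der: "\<And>x. (F has_derivative F' x) (at x)"
  shows "negligible (F ` {x. \<not> inj (F' x)})"
proof -
  have dim: "DIM(quat) = DIM(real ^ 4)"
    by simp
  obtain f :: "quat \<Rightarrow> real ^ 4" and g where lf: "linear f" and lg: "linear g"
    and gf: "\<And>x. g (f x) = x" and fg: "\<And>y. f (g y) = y"
    by (rule isomorphisms_UNIV_UNIV [OF dim]) (rule that)
  define S where "S = f ` {x. \<not> inj (F' x)}"
  have der': "((\<lambda>y. f (F (g y))) has_derivative (\<lambda>y. f (F' (g x) (g y)))) (at x within S)" for x
    using has_derivative_compose [OF linear_imp_has_derivative [OF lg] has_derivative_compose [OF der linear_imp_has_derivative [OF lf]]]
    by (rule has_derivative_at_withinI)
  have "negligible ((\<lambda>y. f (F (g y))) ` S)"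
  proof (rule baby_Sard [OF order_refl der'])
    fix x assume "x \<in> S"
    then have ninj: "\<not> inj (F' (g x))"
      by (auto simp: S_def gf)
    have lin: "linear (\<lambda>y. f (F' (g x) (g y)))"
      using der' has_derivative_linear by blast
    have "\<not> inj (\<lambda>y. f (F' (g x) (g y)))"
    proof
      assume inj: "inj (\<lambda>y. f (F' (g x) (g y)))"
      have "inj (F' (g x))"
      proof (rule injI)
        fix a b assume "F' (g x) a = F' (g x) b"
        then have "f a = f b"
          using injD [OF inj, of "f a" "f b"] by (simp add: gf)
        then show "a = b"
          by (metis gf)
      qed
      with ninj show False by blast
    qed
    then show "rank (matrix (\<lambda>y. f (F' (g x) (g y)))) < CARD(4)"
      by (subst less_rank_noninjective) (subst matrix_vector_mul(2) [OF lin])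
  qed
  then have "negligible (g ` (\<lambda>y. f (F (g y))) ` S)"
  proof (rule negligible_differentiable_image_negligible [rotated])
    show "g differentiable_on (\<lambda>y. f (F (g y))) ` S"
      by (rule linear_imp_differentiable_on [OF lg])
  qed simp
  moreover have "g ` (\<lambda>y. f (F (g y))) ` S = F ` {x. \<not> inj (F' x)}"
    by (simp add: S_def image_image gf)
  ultimately show ?thesis
    by simp
qed

lemma homotopic_sphere_of_nz:
  fixes f g :: "'a::topological_space \<Rightarrow> quat"
  assumes hom: "homotopic_with_canon P X (- {0}) f g"
    and fg: "\<And>x. x \<in> X \<Longrightarrow> norm (f x) = 1" "\<And>x. x \<in> X \<Longrightarrow> norm (g x) = 1"
    and P: "\<And>h. P h \<Longrightarrow> Q (\<lambda>x. h x /\<^sub>R norm (h x))"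
    and Q: "\<And>h k. (\<And>x. x \<in> X \<Longrightarrow> h x = k x) \<Longrightarrow> Q h \<longleftrightarrow> Q k"
  shows "homotopic_with_canon Q X (sphere 0 1) f g"
proof -
  have "homotopic_with_canon Q X (sphere 0 1) ((\<lambda>y. y /\<^sub>R norm y) \<circ> f) ((\<lambda>y. y /\<^sub>R norm y) \<circ> g)"
  proof (rule homotopic_with_compose_continuous_map_left [OF hom])
    show "continuous_map (top_of_set (- {0})) (top_of_set (sphere 0 1)) (\<lambda>y::quat. y /\<^sub>R norm y)"
      by (auto intro!: continuous_intros)
    show "Q ((\<lambda>y. y /\<^sub>R norm y) \<circ> h)" if "P h" for h
      using P [OF that] by (simp only: o_def)
  qed
  then show ?thesis
  proof (rule homotopic_with_eq)
    show "Q h \<longleftrightarrow> Q k" if "\<And>x. x \<in> topspace (top_of_set X) \<Longrightarrow> h x = k x" for h k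
      by (rule Q) (use that in simp)
  qed (simp_all add: fg)
qed

theorem sphere_map_homotopic_qpow:
  fixes f :: "quat \<Rightarrow> quat"
  assumes f: "continuous_on (sphere 0 1) f" "\<And>x. norm x = 1 \<Longrightarrow> norm (f x) = 1"
  obtains k where "homotopic_with_canon (\<lambda>_. True) (sphere 0 1) (sphere 0 1) f (qpow k)"
proof -
  \<comment> \<open>A quarter for the approximation and another quarter for the regular value y stay
    below \<open>norm (f x) = 1\<close> together. Hence F is homotopic to f on the sphere and all
    its zeros in the closed ball are interior.\<close>
  obtain p where p: "polynomial_function p" "\<And>x. x \<in> sphere 0 1 \<Longrightarrow> norm (f x - p x) < 1/4"
    using Stone_Weierstrass_polynomial_function [OF compact_sphere f(1), of "1/4"] by auto
  have "\<exists>D. (p has_derivative D) (at x)" for x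
    using differentiable_at_polynomial_function [OF p(1)] by (simp add: differentiable_def)
  then have "\<exists>p'. \<forall>x. (p has_derivative p' x) (at x)"
    by (intro choice allI)
  then obtain p' where p': "\<And>x. (p has_derivative p' x) (at x)"
    by blast
  have "\<not> negligible (ball (0::quat) (1/4))"
    by (rule open_not_negligible) auto
  then have "\<not> ball (0::quat) (1/4) \<subseteq> p ` {x. \<not> inj (p' x)}"
    using negligible_subset negligible_critical_values [of p p'] p' by blast
  then obtain y where y: "norm y < 1/4" "y \<notin> p ` {x. \<not> inj (p' x)}"
    by (metis dist_0_norm mem_ball subsetI)
  define F where "F x = p x - y" for x
  have contF: "continuous_on UNIV F"
    unfolding F_def using continuous_on_polymonial_function [OF p(1)] by (intro continuous_intros)
  have nearF: "norm (F x - f x) < norm (f x)" if "x \<in> sphere 0 1" for x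
  proof -
    have "norm (F x - f x) \<le> norm (f x - p x) + norm y"
      using norm_triangle_ineq4 [of "p x - f x" y] by (simp add: F_def norm_minus_commute algebra_simps)
    then show ?thesis
      using p(2) [OF that] y(1) f(2) [of x] that by simp
  qed
  define Z where "Z = {x \<in> cball 0 1. F x = 0}"
  have "\<exists>k. local_class F a k" if "a \<in> Z" for a
  proof -
    have "(F has_derivative p' a) (at a)"
      unfolding F_def using has_derivative_diff [OF p' has_derivative_const] by simp
    moreover have "inj (p' a)"
      using y(2) that by (auto simp: Z_def F_def)
    moreover have "F a = 0"
      using that by (simp add: Z_def)
    moreover obtain k where "nz_homotopic (-{0}) (p' a) (qpow k)"
      using qpow_class_linear [of "p' a"] calculation has_derivative_linear unfolding qpow_class_def by blast
    ultimately show ?thesis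
      using local_class_derivative [OF _ _ contF] by blast
  qed
  then have "\<exists>\<kappa>. \<forall>a\<in>Z. local_class F a (\<kappa> a)"
    by (intro bchoice ballI)
  then obtain \<kappa> where \<kappa>: "\<And>a. a \<in> Z \<Longrightarrow> local_class F a (\<kappa> a)"
    by blast
  have "closed (cball 0 1 \<inter> F -` {0})"
    by (rule continuous_closed_preimage) (use contF in \<open>auto intro: continuous_on_subset\<close>)
  then have "compact (cball 0 1 \<inter> (cball 0 1 \<inter> F -` {0}))"
    by (rule compact_Int_closed [OF compact_cball])
  moreover have "cball 0 1 \<inter> (cball 0 1 \<inter> F -` {0}) = Z"
    unfolding Z_def by blast
  ultimately have "compact Z"
    by simp
  \<comment> \<open>A nondegenerate zero is isolated, and an infinite subset of a compact set would
    have a limit point in it.\<close>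
  moreover have "\<not> a islimpt Z" if "a \<in> Z" for a
    using local_class_imp_isolated [OF \<kappa> [OF that]] islimpt_subset [of a Z "{x. F x = 0}"] unfolding Z_def by blast
  ultimately have "finite Z"
    using finite_not_islimpt_in_compact [of Z Z] by simp
  have "Z \<subseteq> ball 0 1"
  proof
    fix x assume "x \<in> Z"
    then show "x \<in> ball 0 1"
      using nearF [of x] by (cases "norm x = 1") (auto simp: Z_def)
  qed
  have "nz_homotopic (sphere 0 1) F (qpow (\<Sum>a\<in>Z. \<kappa> a))"
    by (rule nz_homotopic_qpow_sum [OF \<open>finite Z\<close> \<open>Z \<subseteq> ball 0 1\<close> _ _ \<kappa>])
      (use contF in \<open>auto simp: Z_def intro: continuous_on_subset\<close>)
  moreover have "nz_homotopic (sphere 0 1) F f"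
    by (rule nz_homotopic_near [OF continuous_on_subset [OF contF] f(1) nearF]) auto
  ultimately have "nz_homotopic (sphere 0 1) f (qpow (\<Sum>a\<in>Z. \<kappa> a))"
    using homotopic_with_symD homotopic_with_trans by blast
  then have "homotopic_with_canon (\<lambda>_. True) (sphere 0 1) (sphere 0 1) f (qpow (\<Sum>a\<in>Z. \<kappa> a))"
    by (rule homotopic_sphere_of_nz) (use f norm_qpow in auto)
  then show ?thesis
    by (rule that)
qed

section \<open>The power maps\<close>

lemma nz_homotopic_diag:
  assumes "c \<noteq> 0"
  shows "nz_homotopic (-{0 :: quat}) (\<lambda>x. (c * fst x, snd x)) (qpow 1)"
proof -
  have "path_connected (-{0 :: complex})"
    by (rule path_connected_punctured_universe) simp
  then have "path_component (-{0}) c 1"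
    using assms unfolding path_connected_component by (metis ComplI singletonD zero_neq_one)
  then obtain \<gamma> where \<gamma>: "path \<gamma>" "path_image \<gamma> \<subseteq> - {0}" "pathstart \<gamma> = c" "pathfinish \<gamma> = 1"
    unfolding path_component_def by blast
  have ne: "\<gamma> t \<noteq> 0" if "t \<in> {0..1}" for t
    using \<gamma>(2) that by (auto simp: path_image_def)
  have cont: "continuous_on ({0..1} \<times> X) (\<lambda>z. \<gamma> (fst z))" for X :: "quat set"
    by (rule continuous_on_compose2 [OF \<gamma>(1) [unfolded path_def]]) (auto intro!: continuous_intros)
  show ?thesis
    unfolding homotopic_with_def
  proof (intro exI [of _ "\<lambda>z::real \<times> quat. (\<gamma> (fst z) * fst (snd z), snd (snd z))"] conjI allI ballI)
    show "continuous_map (prod_topology (top_of_set {0..1}) (top_of_set (- {0}))) (top_of_set (- {0}))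
        (\<lambda>z::real \<times> quat. (\<gamma> (fst z) * fst (snd z), snd (snd z)))"
    proof -
      have "continuous_on ({0..1} \<times> - {0}) (\<lambda>z::real \<times> quat. (\<gamma> (fst z) * fst (snd z), snd (snd z)))"
        by (intro continuous_intros cont)
      then show ?thesis
        using ne by (auto simp: prod_eq_iff)
    qed
  qed (use \<gamma>(3,4) in \<open>auto simp: pathstart_def pathfinish_def\<close>)
qed

text \<open>Subtracting a small constant splits the degenerate zero of (z1^n, z2) at the origin into
  n simple ones. Their derivatives scale the first coordinate by a nonzero complex number, which can
  be moved to 1, so each zero contributes exactly 1.\<close>

lemma power_map_homotopic_qpow_nat:
  assumes n: "n > 0"
  shows "nz_homotopic (sphere 0 1) (power_map (int n)) (qpow (int n))"
proof -
  \<comment> \<open>This value puts all n roots on the circle of radius 1/2. Being smaller than 1 in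
    modulus, it also keeps the segment to the unperturbed map away from 0 on the sphere.\<close>
  define \<epsilon> :: complex where "\<epsilon> = (1 / 2) ^ n"
  define F :: "quat \<Rightarrow> quat" where "F x = (fst x ^ n - \<epsilon>, snd x)" for x
  define R where "R = {w. w ^ n = \<epsilon>}"
  define Z where "Z = (\<lambda>w. (w, 0 :: complex)) ` R"
  have \<epsilon>: "\<epsilon> \<noteq> 0" "cmod \<epsilon> < 1"
    using n by (auto simp: \<epsilon>_def norm_power norm_divide power_less_one_iff)
  have R: "cmod w = 1 / 2" if "w \<in> R" for w
  proof -
    have "cmod w ^ n = cmod (w ^ n)"
      by (simp add: norm_power)
    also have "w ^ n = \<epsilon>"
      using that by (simp add: R_def)
    also have "cmod \<epsilon> = (1 / 2) ^ n"
      by (simp add: \<epsilon>_def norm_power norm_divide)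
    finally have "cmod w ^ n = (1 / 2) ^ n" .
    then show ?thesis
      using n power_eq_imp_eq_base by fastforce
  qed
  have cardR: "card R = n"
    using card_nth_roots [OF \<epsilon>(1) n] by (simp add: R_def)
  then have finZ: "finite Z" and cardZ: "card Z = n"
    using n card_gt_0_iff [of R] by (auto simp: Z_def card_image inj_on_def)
  have zeros: "F x = 0 \<longleftrightarrow> x \<in> Z" for x
    by (cases x) (auto simp: F_def Z_def R_def zero_prod_def)
  have contF: "continuous_on S F" for S
    unfolding F_def by (intro continuous_intros)
  have "local_class F a 1" if a: "a \<in> Z" for a
  proof -
    obtain w where w: "a = (w, 0 :: complex)" "w \<in> R"
      using a unfolding Z_def by blast
    define c where "c = of_nat n * w ^ (n - 1)"
    have "w \<noteq> 0"
      using R [OF w(2)] by auto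
    then have c: "c \<noteq> 0"
      using n by (simp add: c_def)
    have "(F has_derivative (\<lambda>h. (c * fst h, snd h))) (at a)"
      unfolding F_def
      by (auto intro!: derivative_eq_intros simp: c_def w)
    moreover have "inj (\<lambda>h::quat. (c * fst h, snd h))"
      by (rule injI) (use c in \<open>simp add: prod_eq_iff\<close>)
    ultimately show ?thesis
      using local_class_derivative [OF _ _ contF _ nz_homotopic_diag [OF c]] zeros that by blast
  qed
  moreover have "Z \<subseteq> ball 0 1"
  proof
    fix a assume "a \<in> Z"
    then obtain w where "a = (w, 0)" "w \<in> R"
      unfolding Z_def by blast
    then show "a \<in> ball 0 1"
      using R [of w] by (simp add: norm_Pair)
  qed
  ultimately have "nz_homotopic (sphere 0 1) F (qpow (\<Sum>a\<in>Z. 1))"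
    by (intro nz_homotopic_qpow_sum finZ contF) (use zeros in auto)
  then have "nz_homotopic (sphere 0 1) F (qpow (int n))"
    by (simp add: cardZ)
  moreover have "nz_homotopic (sphere 0 1) (\<lambda>x. (fst x ^ n, snd x)) F"
  proof (rule homotopic_with_linear)
    fix x :: quat assume x: "x \<in> sphere 0 1"
    have "y \<noteq> 0" if y: "y \<in> closed_segment (fst x ^ n, snd x) (F x)" for y
    proof
      assume "y = 0"
      then obtain t where t: "0 \<le> t" "t \<le> 1" "(0 :: quat) = (1 - t) *\<^sub>R (fst x ^ n, snd x) + t *\<^sub>R F x"
        using y unfolding closed_segment_def by blast
      have "snd x = 0"
        using arg_cong [OF t(3), of snd] by (simp add: F_def scaleR_left_diff_distrib)
      have eq: "fst x ^ n = of_real t * \<epsilon>"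
        using arg_cong [OF t(3), of fst]
        by (simp add: F_def scaleR_conv_of_real algebra_simps)
      from \<open>snd x = 0\<close> have "cmod (fst x) = 1"
        using x by (simp add: norm_prod_def)
      then have "1 = t * cmod \<epsilon>"
        using arg_cong [OF eq, of cmod] t(1) by (simp add: norm_power norm_mult)
      moreover have "t * cmod \<epsilon> < 1"
        using t \<epsilon>(2) mult_left_le_one_le [of "cmod \<epsilon>" t] by simp
      ultimately show False by simp
    qed
    then show "closed_segment (fst x ^ n, snd x) (F x) \<subseteq> - {0}"
      by blast
  qed (auto intro!: continuous_intros contF)
  moreover have "nz_homotopic (sphere 0 1) (\<lambda>x. (fst x ^ n, snd x)) (\<lambda>x. inverse (norm (fst x ^ n, snd x)) *\<^sub>R (fst x ^ n, snd x))"
  proof (rule nz_homotopic_scale)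
    show ne: "(fst x ^ n, snd x) \<noteq> 0" if "x \<in> sphere 0 1" for x :: quat
      using that n by (auto simp: prod_eq_iff norm_prod_def)
    then show "continuous_on (sphere 0 1) (\<lambda>x::quat. inverse (norm (fst x ^ n, snd x)))"
      by (intro continuous_intros) simp_all
    show "0 < inverse (norm (fst x ^ n, snd x))" if "x \<in> sphere 0 1" for x :: quat
      using ne [OF that] by (simp only: inverse_positive_iff_positive zero_less_norm_iff not_False_eq_True)
  qed (auto intro!: continuous_intros)
  ultimately have "nz_homotopic (sphere 0 1) (\<lambda>x. inverse (norm (fst x ^ n, snd x)) *\<^sub>R (fst x ^ n, snd x)) (qpow (int n))"
    using homotopic_with_symD homotopic_with_trans by blast
  then show ?thesis
    by (rule homotopic_with_eq) (auto simp: power_map_def cnj_power_def Let_def)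
qed

theorem power_map_homotopic_qpow:
  assumes k: "k \<noteq> 0"
  shows "homotopic_with_canon (\<lambda>_. True) (sphere 0 1) (sphere 0 1) (power_map k) (qpow k)"
proof -
  have "nz_homotopic (sphere 0 1) (power_map k) (qpow k)"
  proof (cases "k > 0")
    case True
    then show ?thesis
      using power_map_homotopic_qpow_nat [of "nat k"] by simp
  next
    case False
    \<comment> \<open>Conjugation of the first coordinate is the reflection along (i, 0), hence of
      exponent -1, and it turns the positive power map into the negative one.\<close>
    define c :: "quat \<Rightarrow> quat" where "c x = (cnj (fst x), snd x)" for x
    have nc: "norm (c x) = norm x" for x
      by (simp add: c_def norm_prod_def)
    have contc: "continuous_on S c" for S
      unfolding c_def by (intro continuous_intros)
    have "x - (2 * (x \<bullet> (\<i>, 0))) *\<^sub>R (\<i>, 0) = c x" for x :: quat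
      by (simp add: c_def prod_eq_iff inner_prod_def inner_complex_def complex_eq_iff)
    then have "nz_homotopic (-{0}) c (qpow (- 1))"
      using nz_homotopic_reflection [of "(\<i>, 0)"] by (simp add: norm_Pair)
    then have "nz_homotopic (sphere 0 1) c (qpow (- 1))"
      by (rule homotopic_with_subset_left) auto
    then have "nz_homotopic (sphere 0 1) (\<lambda>x. qpow (- k) (c x)) (\<lambda>x. qpow (- k) (qpow (- 1) x))"
      by (rule nz_homotopic_qpow_compose)
    moreover have "nz_homotopic (sphere 0 1) (\<lambda>x. power_map (- k) (c x)) (\<lambda>x. qpow (- k) (c x))"
      using power_map_homotopic_qpow_nat [of "nat (- k)"] False k
      by (intro nz_homotopic_compose_right [OF _ contc]) (auto simp: nc)
    ultimately have "nz_homotopic (sphere 0 1) (\<lambda>x. power_map (- k) (c x)) (\<lambda>x. qpow (- k) (qpow (- 1) x))"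
      using homotopic_with_trans by blast
    then show ?thesis
    proof (rule homotopic_with_eq)
      fix x :: quat assume "x \<in> topspace (top_of_set (sphere 0 1))"
      then have "x \<noteq> 0" by auto
      then show "qpow k x = qpow (- k) (qpow (- 1) x)"
        using qpow_mult [of x "- 1" "- k"] by simp
      show "power_map k x = power_map (- k) (c x)"
        using False k by (simp add: power_map_def cnj_power_def c_def)
    qed auto
  qed
  moreover have "norm (power_map k x) = 1" if "norm x = 1" for x
  proof -
    have "(cnj_power (fst x) k, snd x) \<noteq> 0"
      using that k by (auto simp: prod_eq_iff norm_prod_def cnj_power_def split: if_splits)
    then show ?thesis
      unfolding power_map_def Let_def by (simp only: norm_scaleR abs_inverse abs_norm_cancel norm_eq_zero left_inverse not_False_eq_True)
  qed
  ultimately show ?thesis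
    by (intro homotopic_sphere_of_nz [where P = "\<lambda>_. True" and Q = "\<lambda>_. True"]) (auto simp: norm_qpow)
qed

section \<open>Degree\<close>

lemma homologous_rel_set_add:
  assumes "singular_relcycle p X S c" "singular_relcycle p X S d"
  shows "homologous_rel_set p X S (c + d) =
    homologous_rel_set p X S c \<otimes>\<^bsub>relative_homology_group (int p) X S\<^esub> homologous_rel_set p X S d"
proof -
  have "(\<lambda>a. homologous_rel_set p X S a) \<in> hom (relcycle_group p X S) (relative_homology_group (int p) X S)"
    using normal.r_coset_hom_Mod [OF normal_subgroup_singular_relboundary_relcycle, of p X S]
    unfolding nontrivial_relative_homology_group right_coset_singular_relboundary by simp
  then show ?thesis
    using assms by (simp add: hom_def)
qed

text \<open>Only chains inside \<open>U\<close> or \<open>V\<close> matter, and on each of them one of \<open>f\<close> and \<open>g\<close> contributes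
  a chain in a point.\<close>

proposition hom_induced_disjoint_supports:
  assumes p: "p \<ge> 1" and UV: "openin X U" "openin X V" "topspace X \<subseteq> U \<union> V"
    and cont: "continuous_map X Y f" "continuous_map X Y g" "continuous_map X Y h"
    and y: "y \<in> topspace Y"
    and U: "\<And>x. x \<in> U \<Longrightarrow> g x = y \<and> h x = f x" and V: "\<And>x. x \<in> V \<Longrightarrow> f x = y \<and> h x = g x"
    and \<alpha>: "\<alpha> \<in> carrier (homology_group (int p) X)"
  shows "hom_induced (int p) X {} Y {} h \<alpha> =
    hom_induced (int p) X {} Y {} f \<alpha> \<otimes>\<^bsub>homology_group (int p) Y\<^esub> hom_induced (int p) X {} Y {} g \<alpha>"
proof -
  obtain c0 where c0: "singular_relcycle p X {} c0" "\<alpha> = homologous_rel_set p X {} c0"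
    using \<alpha> by (auto simp: carrier_relative_homology_group)
  have "\<And>W. W \<in> {U, V} \<Longrightarrow> openin X W" "topspace X \<subseteq> \<Union>{U, V}"
    using UV by auto
  then obtain c where c: "singular_relcycle p X {} c" "homologous_rel p X {} c0 c"
    and small: "\<And>s. s \<in> Poly_Mapping.keys c \<Longrightarrow> \<exists>W \<in> {U, V}. s \<in> (standard_simplex p) \<rightarrow> W"
    using small_homologous_rel_relcycle_exists [OF _ _ c0(1)] by metis
  have \<alpha>c: "\<alpha> = homologous_rel_set p X {} c"
    using c0 c by (simp add: homologous_rel_set_eq)
  have "Poly_Mapping.keys c \<subseteq> singular_simplex_set p X"
    using c(1) by (simp add: singular_cycle singular_chain_def)
  then have "Poly_Mapping.keys c \<subseteq> singular_simplex_set p (subtopology X U) \<union> singular_simplex_set p (subtopology X V)"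
    using small by (fastforce simp: singular_simplex_subtopology)
  then obtain d e where d: "singular_chain p (subtopology X U) d" and e: "singular_chain p (subtopology X V) e"
    and de: "d + e = c"
    unfolding singular_chain_def by (rule frag_split)
  have eq: "chain_map p h d = chain_map p f d" "chain_map p h e = chain_map p g e"
    using chain_map_eq [OF d, of h f] chain_map_eq [OF e, of h g] U V by simp_all
  have const: "continuous_map (subtopology X U) (subtopology Y {y}) g"
      "continuous_map (subtopology X V) (subtopology Y {y}) f"
    unfolding continuous_map_in_subtopology using cont(1,2) U V
    by (simp_all add: continuous_map_from_subtopology Pi_iff)
  define b where "b = chain_map p g d + chain_map p f e"
  have b: "chain_map p f c + chain_map p g c = chain_map p h c + b"
    by (simp add: b_def eq chain_map_add flip: de)
  have cycles: "singular_relcycle p Y {} (chain_map p f c)" "singular_relcycle p Y {} (chain_map p g c)"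
      "singular_relcycle p Y {} (chain_map p h c)"
    using cont c(1) by (auto intro!: singular_relcycle_chain_map)
  then have "singular_relcycle p Y {} (chain_map p f c + chain_map p g c - chain_map p h c)"
    by (intro singular_relcycle_add singular_relcycle_diff)
  \<comment> \<open>The two summands of b need not be cycles separately; their sum is one because it
    is a difference of images of the cycle c. In degree p at least 1 a cycle in a one-point space
    bounds.\<close>
  then have "chain_boundary p b = 0"
    by (simp add: b singular_cycle)
  moreover have "singular_chain p (subtopology Y {y}) b"
    unfolding b_def by (intro singular_chain_add singular_chain_chain_map [OF d] singular_chain_chain_map [OF e] const)
  ultimately have "singular_relcycle p (subtopology Y {y}) {} b"
    by (simp add: singular_cycle)
  then have "singular_relboundary p (subtopology Y {y}) {} b"
    using singular_boundary_eq_cycle_singleton [of "subtopology Y {y}" y p b] y p by simp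
  then have "singular_relboundary p (subtopology Y (topspace Y)) {} b"
    by (rule singular_boundary_mono [rotated]) (use y in simp)
  then have "singular_relboundary p Y {} b"
    by simp
  then have "homologous_rel p Y {} (chain_map p f c + chain_map p g c) (chain_map p h c)"
    by (simp add: homologous_rel_def b)
  then have "homologous_rel_set p Y {} (chain_map p h c) = homologous_rel_set p Y {} (chain_map p f c + chain_map p g c)"
    unfolding homologous_rel_set_eq by (simp only: homologous_rel_sym)
  also have "\<dots> = homologous_rel_set p Y {} (chain_map p f c) \<otimes>\<^bsub>homology_group (int p) Y\<^esub>
      homologous_rel_set p Y {} (chain_map p g c)"
    by (rule homologous_rel_set_add) (rule cycles)+
  finally show ?thesis
    unfolding \<alpha>c by (simp only: hom_induced_chain_map_gen cont c(1) Int_empty_right Pi_empty UNIV_I)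
qed

text \<open>The open hemisphere of negative real part is stretched over the sphere minus 1, fixing
  -1, and the other hemisphere collapses to 1. The two cases agree on the common boundary, where the
  square is -1.\<close>

definition fold_map :: "quat \<Rightarrow> quat" where
  "fold_map q = (if Re (fst q) \<le> 0 then - (q *\<^sub>q q) else qone)"

lemma norm_fold_map: "norm q = 1 \<Longrightarrow> norm (fold_map q) = 1"
  by (simp add: fold_map_def norm_qmul)

lemma qmul_self_imaginary:
  assumes "norm q = 1" "Re (fst q) = 0"
  shows "q *\<^sub>q q = - qone"
proof -
  have "q = - qcnj q"
    using assms by (simp add: prod_eq_iff complex_eq_iff)
  then have "q *\<^sub>q q = - (q *\<^sub>q qcnj q)"
    by (metis qmul.minus_right)
  then show ?thesis
    using assms by (simp add: qmul_qcnj)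
qed

lemma continuous_on_fold_map: "continuous_on (sphere 0 1) fold_map"
proof -
  have "continuous_on (sphere 0 1) (\<lambda>q. if Re (fst q) \<le> 0 then - (q *\<^sub>q q) else qone)"
    by (rule continuous_on_cases_le)
      (auto intro!: continuous_intros simp: qmul_self_imaginary)
  then show ?thesis
    by (simp add: fold_map_def [abs_def])
qed

lemma zero_notin_closed_segment:
  fixes a b :: "'a::real_normed_vector"
  assumes "norm a = 1" "norm b = 1" "a \<noteq> - b"
  shows "0 \<notin> closed_segment a b"
proof
  assume "0 \<in> closed_segment a b"
  then obtain u where u: "0 \<le> u" "u \<le> 1" "0 = (1 - u) *\<^sub>R a + u *\<^sub>R b"
    unfolding closed_segment_def by blast
  then have eq: "(1 - u) *\<^sub>R a = - (u *\<^sub>R b)"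
    by (simp add: eq_neg_iff_add_eq_0)
  have u': "1 - u = u"
    using arg_cong [OF eq, of norm] u assms by simp
  then have "u \<noteq> 0"
    by auto
  moreover have "u *\<^sub>R a = u *\<^sub>R (- b)"
    using eq by (simp only: u' scaleR_minus_right)
  ultimately have "a = - b"
    by (simp add: scaleR_cancel_left del: scaleR_minus_right)
  then show False
    using assms(3) by simp
qed

lemma homotopic_sphere_nonantipodal:
  fixes f g :: "'a::topological_space \<Rightarrow> quat"
  assumes "continuous_on X f" "continuous_on X g"
    and "\<And>x. x \<in> X \<Longrightarrow> norm (f x) = 1" "\<And>x. x \<in> X \<Longrightarrow> norm (g x) = 1" "\<And>x. x \<in> X \<Longrightarrow> f x \<noteq> - g x"
  shows "homotopic_with_canon (\<lambda>_. True) X (sphere 0 1) f g"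
proof (rule homotopic_sphere_of_nz [where P = "\<lambda>_. True"])
  show "nz_homotopic X f g"
  proof (rule homotopic_with_linear)
    fix x assume "x \<in> X"
    then have "0 \<notin> closed_segment (f x) (g x)"
      using assms by (intro zero_notin_closed_segment) auto
    then show "closed_segment (f x) (g x) \<subseteq> - {0}"
      by blast
  qed (use assms in auto)
qed (use assms in auto)

text \<open>The fold of q is never -q: on one hemisphere this would force q = 1, on the other q =
  -1, and each of these points lies in the opposite hemisphere.\<close>

lemma fold_map_homotopic_id: "homotopic_with_canon (\<lambda>_. True) (sphere 0 1) (sphere 0 1) fold_map id"
proof (rule homotopic_sphere_nonantipodal)
  fix q :: quat assume "q \<in> sphere 0 1"
  then have q: "norm q = 1" "q \<noteq> 0" by auto
  show "fold_map q \<noteq> - id q"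
  proof
    assume eq: "fold_map q = - id q"
    show False
    proof (cases "Re (fst q) \<le> 0")
      case True
      then have "q *\<^sub>q q = q"
        using eq by (simp add: fold_map_def)
      then have "q *\<^sub>q q *\<^sub>q qinv q = q *\<^sub>q qinv q"
        by simp
      then have "q = qone"
        using q by (simp add: qmul_assoc qinv_right)
      with True show False by simp
    next
      case False
      then have "q = - qone"
        using eq by (simp add: fold_map_def) (metis minus_minus)
      with False show False by simp
    qed
  qed
qed (auto simp: continuous_on_fold_map norm_fold_map intro: continuous_on_id)

lemma Re_fst_fold_map:
  assumes "norm q = 1" "Re (fst q) \<le> 0"
  shows "Re (fst (fold_map q)) = 1 - 2 * (Re (fst q))\<^sup>2"
proof -
  have "(cmod (fst q))\<^sup>2 + (cmod (snd q))\<^sup>2 = 1"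
    using assms by (simp flip: norm_quat_sq)
  then show ?thesis
    using assms unfolding cmod_power2 by (simp add: fold_map_def power2_eq_square algebra_simps)
qed

text \<open>One fold is constant on a closed hemisphere only, and two opposite open hemispheres do
  not cover the equator. The second fold enlarges the region: by \<open>Re_fst_fold_map\<close>,
  points with real part between -1/2 and 0 are first sent to positive real part. The open sets on
  which this map and its antipodal companion are constant then overlap.\<close>

lemma fold_map_twice_const:
  assumes "norm q = 1" "Re (fst q) > - (1/2)"
  shows "fold_map (fold_map q) = qone"
proof -
  have "Re (fst (fold_map q)) > 0"
  proof (cases "Re (fst q) \<le> 0")
    case True
    then have "(Re (fst q))\<^sup>2 \<le> (1/2)\<^sup>2"
      using assms by (simp add: abs_le_square_iff [symmetric])
    then show ?thesis
      using True assms by (simp add: Re_fst_fold_map power2_eq_square)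
  qed (simp add: fold_map_def)
  then show ?thesis
    by (simp add: fold_map_def [of "fold_map q"])
qed

abbreviation sphere_homotopic :: "(quat \<Rightarrow> quat) \<Rightarrow> (quat \<Rightarrow> quat) \<Rightarrow> bool" where
  "sphere_homotopic \<equiv> homotopic_with_canon (\<lambda>_. True) (sphere 0 1) (sphere 0 1)"

lemma sphere_homotopic_compose:
  "sphere_homotopic f f' \<Longrightarrow> sphere_homotopic g g' \<Longrightarrow> sphere_homotopic (\<lambda>x. f (g x)) (\<lambda>x. f' (g' x))"
  using homotopic_compose [of "top_of_set (sphere 0 1)" "top_of_set (sphere 0 1)" g g' "top_of_set (sphere 0 1)" f f']
  by (simp add: o_def)

lemma sphere_homotopic_qmul:
  "sphere_homotopic f f' \<Longrightarrow> sphere_homotopic g g' \<Longrightarrow> sphere_homotopic (\<lambda>x. f x *\<^sub>q g x) (\<lambda>x. f' x *\<^sub>q g' x)"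
  by (rule homotopic_with_qmul) (auto simp: norm_qmul)

text \<open>The antipodal map is multiplication by -1, and -1 can be joined to 1 within the nonzero
  quaternions.\<close>

lemma sphere_homotopic_minus: "sphere_homotopic uminus id"
proof -
  have "nz_homotopic (sphere 0 1) (\<lambda>x. (- qone) *\<^sub>q x) (\<lambda>x. qone *\<^sub>q x)"
    by (intro nz_homotopic_qmul nz_homotopic_consts nz_homotopic_refl) (auto intro!: continuous_intros)
  then have "nz_homotopic (sphere 0 1) uminus id"
    by (rule homotopic_with_eq) (auto simp: qmul.minus_left)
  then show ?thesis
    by (rule homotopic_sphere_of_nz) auto
qed

lemma sphere_homotopic_imp_maps:
  assumes "sphere_homotopic f g"
  shows "continuous_on (sphere 0 1) f" "\<And>x. norm x = 1 \<Longrightarrow> norm (f x) = 1"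
    "continuous_on (sphere 0 1) g" "\<And>x. norm x = 1 \<Longrightarrow> norm (g x) = 1"
  using homotopic_with_imp_continuous [OF assms] homotopic_with_imp_funspace1 [OF assms]
    homotopic_with_imp_funspace2 [OF assms]
  by (auto simp: Pi_iff)

lemma sphere_homotopic_qpow_refl: "sphere_homotopic (qpow k) (qpow k)"
  by (auto intro!: continuous_intros simp: norm_qpow)

text \<open>In x^(k+1) = x^k x the two factors are deformed to have disjoint supports: the first is
  evaluated at the double fold of x, the second becomes the double fold of -x. Then
  \<open>hom_induced_disjoint_supports\<close> adds their contributions.\<close>

lemma hom_induced_qpow_succ:
  assumes \<alpha>: "\<alpha> \<in> carrier (homology_group 3 S3)"
  shows "hom_induced 3 S3 {} S3 {} (qpow (k + 1)) \<alpha> =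
    hom_induced 3 S3 {} S3 {} (qpow k) \<alpha> \<otimes>\<^bsub>homology_group 3 S3\<^esub> \<alpha>"
proof -
  let ?E = "\<lambda>x. fold_map (fold_map x)"
  have E: "sphere_homotopic ?E id"
    using sphere_homotopic_compose [OF fold_map_homotopic_id fold_map_homotopic_id] by (simp add: id_def)
  have E': "sphere_homotopic (\<lambda>x. ?E (- x)) id"
    using sphere_homotopic_compose [OF E sphere_homotopic_minus] by (simp add: id_def)
  define f where "f = (\<lambda>x. qpow k (?E x))"
  define g where "g = (\<lambda>x. ?E (- x))"
  define h where "h = (\<lambda>x. f x *\<^sub>q g x)"
  have f: "sphere_homotopic f (qpow k)"
    using sphere_homotopic_compose [OF sphere_homotopic_qpow_refl E] by (simp add: f_def id_def)
  have g: "sphere_homotopic g id"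
    unfolding g_def by (rule E')
  have h: "sphere_homotopic h (qpow (k + 1))"
    using sphere_homotopic_qmul [OF f g] unfolding h_def
    by (rule homotopic_with_eq) (auto intro: qpow_succ)
  have ind: "hom_induced 3 S3 {} S3 {} u = hom_induced 3 S3 {} S3 {} v" if "sphere_homotopic u v" for u v
    unfolding S3_eq_sphere by (rule homology_homotopy_empty [OF that])
  have "hom_induced (int 3) S3 {} S3 {} h \<alpha> = hom_induced (int 3) S3 {} S3 {} f \<alpha>
      \<otimes>\<^bsub>homology_group (int 3) S3\<^esub> hom_induced (int 3) S3 {} S3 {} g \<alpha>"
  proof (rule hom_induced_disjoint_supports)
    show "openin S3 (sphere 0 1 \<inter> (\<lambda>q. Re (fst q)) -` {..<1/2})"
      "openin S3 (sphere 0 1 \<inter> (\<lambda>q. Re (fst q)) -` {-(1/2)<..})"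
      unfolding S3_eq_sphere
      by (rule continuous_openin_preimage_gen; intro continuous_intros; simp)+
    show "continuous_map S3 S3 f" "continuous_map S3 S3 g" "continuous_map S3 S3 h"
      using f g h unfolding S3_eq_sphere by (blast dest: homotopic_with_imp_continuous_maps)+
    show "qone \<in> topspace S3"
      by (simp add: S3_eq_sphere)
    show "g x = qone \<and> h x = f x" if "x \<in> sphere 0 1 \<inter> (\<lambda>q. Re (fst q)) -` {..<1/2}" for x
      using that by (simp add: g_def h_def fold_map_twice_const)
    show "f x = qone \<and> h x = g x" if "x \<in> sphere 0 1 \<inter> (\<lambda>q. Re (fst q)) -` {-(1/2)<..}" for x
    proof -
      have "qpow k qone = qone"
        by (induction k rule: int_induct [of _ 0]) (auto simp: qpow_succ qpow_pred qinv_def qcnj_def prod_eq_iff)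
      then show ?thesis
        using that by (simp add: f_def h_def fold_map_twice_const)
    qed
  qed (use \<alpha> in \<open>auto simp: S3_eq_sphere\<close>)
  then show ?thesis
    using hom_induced_id [OF \<alpha>] by (simp add: ind [OF f] ind [OF g] ind [OF h])
qed

section \<open>Degrees of the power maps\<close>

lemma S3_homeomorphic_nsphere: "S3 homeomorphic_space nsphere 3"
proof -
  define f :: "quat \<Rightarrow> nat \<Rightarrow> real" where
    "f x i = (if i = 0 then Re (fst x) else if i = 1 then Im (fst x) else if i = 2 then Re (snd x)
      else if i = 3 then Im (snd x) else 0)" for x i
  define g :: "(nat \<Rightarrow> real) \<Rightarrow> quat" where "g v = (Complex (v 0) (v 1), Complex (v 2) (v 3))" for v
  have norm_sum: "(\<Sum>i\<le>3. v i ^ 2) = (norm (g v))\<^sup>2" for v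
    unfolding norm_quat_sq cmod_power2 by (simp add: g_def numeral_3_eq_3 numeral_2_eq_2)
  have gf: "g (f x) = x" for x
    by (simp add: f_def g_def prod_eq_iff complex_eq_iff)
  have fg: "f (g v) = v" if "\<forall>i>3. v i = 0" for v
  proof
    fix i :: nat
    consider "i = 0" | "i = 1" | "i = 2" | "i = 3" | "i > 3"
      by linarith
    then show "f (g v) i = v i"
      by cases (use that in \<open>auto simp: f_def g_def\<close>)
  qed
  have "homeomorphic_maps S3 (nsphere 3) f g"
    unfolding homeomorphic_maps_def
  proof (intro conjI ballI)
    have "continuous_on (sphere 0 1) (\<lambda>x. f x i)" for i
      by (cases "i = 0"; cases "i = 1"; cases "i = 2"; cases "i = 3") (auto simp: f_def intro!: continuous_intros)
    then have "continuous_map (top_of_set (sphere 0 1)) (powertop_real UNIV) f"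
      unfolding continuous_map_componentwise_UNIV by simp
    moreover have "f x \<in> {v. (\<Sum>i\<le>3. (v i)\<^sup>2) = 1 \<and> (\<forall>i>3. v i = 0)}" if "x \<in> sphere 0 1" for x
      using that unfolding norm_sum by (simp add: gf) (simp add: f_def)
    ultimately show "continuous_map S3 (nsphere 3) f"
      unfolding nsphere S3_eq_sphere by (intro continuous_map_into_subtopology) auto
    have proj: "continuous_map (nsphere 3) euclideanreal (\<lambda>v. v i)" for i
      unfolding nsphere by (intro continuous_map_from_subtopology continuous_map_product_projection) simp
    have cplx: "continuous_map (nsphere 3) euclidean (\<lambda>v. Complex (v i) (v j))" for i j
    proof -
      have "continuous_map (nsphere 3) euclidean (\<lambda>v. complex_of_real (v i))"
        "continuous_map (nsphere 3) euclidean (\<lambda>v. \<i> * complex_of_real (v j))"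
        using continuous_map_compose [OF proj, of euclidean complex_of_real]
          continuous_map_compose [OF proj, of euclidean "\<lambda>t. \<i> * complex_of_real t"]
        by (simp_all add: o_def continuous_intros)
      then show ?thesis
        unfolding Complex_eq by (rule continuous_map_add)
    qed
    have "continuous_map (nsphere 3) (prod_topology euclidean euclidean) g"
      unfolding g_def by (intro continuous_map_pairedI cplx)
    then have "continuous_map (nsphere 3) euclidean g"
      by (simp only: prod_topology_euclidean)
    moreover have "g v \<in> sphere 0 1" if "v \<in> topspace (nsphere 3)" for v
    proof -
      have "(norm (g v))\<^sup>2 = 1"
        using that unfolding nsphere norm_sum by simp
      then show ?thesis
        by (simp add: power2_eq_1_iff) (metis norm_ge_zero not_one_le_zero neg_0_le_iff_le)
    qed
    ultimately show "continuous_map (nsphere 3) S3 g"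
      unfolding S3_eq_sphere by (intro continuous_map_into_subtopology) auto
    show "f (g v) = v" if "v \<in> topspace (nsphere 3)" for v
      using that unfolding nsphere by (intro fg) simp
  qed (rule gf)
  then show ?thesis
    unfolding homeomorphic_space_def by blast
qed

text \<open>The group is infinite cyclic, so its generator has infinite order: an isomorphism onto
  the integers cannot send a generator to 0, since its image would then be trivial.\<close>

lemma fundamental_class_pow_inj:
  assumes \<omega>: "fundamental_class 3 S3 \<omega>"
    and eq: "\<omega> [^]\<^bsub>homology_group 3 S3\<^esub> (k::int) = \<omega> [^]\<^bsub>homology_group 3 S3\<^esub> l"
  shows "k = l"
proof -
  let ?H = "homology_group 3 S3"
  have "?H \<cong> homology_group 3 (nsphere 3)"
    by (rule homeomorphic_space_imp_isomorphic_homology_groups [OF S3_homeomorphic_nsphere])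
  moreover have "homology_group 3 (nsphere 3) \<cong> integer_group"
    using reduced_homology_group_nsphere(1) [of 3] un_reduced_homology_group [of 3 "nsphere 3"] by simp
  ultimately have "?H \<cong> integer_group"
    by (rule iso_trans)
  then obtain \<psi> where \<psi>: "\<psi> \<in> iso ?H integer_group"
    unfolding is_iso_def by blast
  interpret H: group ?H
    by simp
  interpret \<psi>: group_hom ?H integer_group \<psi>
    using \<psi> by (simp add: group_hom_def group_hom_axioms_def iso_def)
  have \<omega>c: "\<omega> \<in> carrier ?H" and gen: "subgroup_generated ?H {\<omega>} = ?H"
    using \<omega> by (auto simp: fundamental_class_def)
  have pow: "\<psi> (\<omega> [^]\<^bsub>?H\<^esub> (m::int)) = m * \<psi> \<omega>" for m
    using \<psi>.hom_int_pow [OF \<omega>c, of m] by simp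
  have "\<psi> \<omega> \<noteq> 0"
  proof
    assume 0: "\<psi> \<omega> = 0"
    have "carrier ?H = range (\<lambda>n::int. \<omega> [^]\<^bsub>?H\<^esub> n)"
      using H.carrier_subgroup_generated_by_singleton [OF \<omega>c] gen by simp
    then have "\<psi> ` carrier ?H \<subseteq> {0}"
      using pow 0 by auto
    moreover have "\<psi> ` carrier ?H = UNIV"
      using \<psi> by (simp add: iso_def bij_betw_def)
    ultimately show False
      by (metis UNIV_I singletonD subsetD zero_neq_one)
  qed
  then show ?thesis
    using arg_cong [OF eq, of \<psi>] by (simp add: pow)
qed

theorem hom_induced_qpow:
  assumes \<omega>: "fundamental_class 3 S3 \<omega>"
  shows "hom_induced 3 S3 {} S3 {} (qpow k) \<omega> = \<omega> [^]\<^bsub>homology_group 3 S3\<^esub> k"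
proof -
  let ?H = "homology_group 3 S3"
  interpret H: group ?H
    by simp
  have \<omega>c: "\<omega> \<in> carrier ?H"
    using \<omega> by (auto simp: fundamental_class_def)
  have carr: "hom_induced 3 S3 {} S3 {} f \<omega> \<in> carrier ?H" for f
    by (rule hom_induced_carrier)
  show ?thesis
  proof (induction k rule: int_induct [of _ 0])
    case base
    \<comment> \<open>The exponent 0 is obtained from the successor rule: x^1 is the identity, so
      the contribution of x^0 must be the neutral element.\<close>
    have "\<omega> = hom_induced 3 S3 {} S3 {} (qpow 1) \<omega>"
      by (rule hom_induced_id_gen [OF _ _ \<omega>c, symmetric])
        (use sphere_homotopic_qpow_refl [of 1] in \<open>simp_all add: S3_eq_sphere\<close>)
    then have "hom_induced 3 S3 {} S3 {} (qpow 0) \<omega> \<otimes>\<^bsub>?H\<^esub> \<omega> = \<omega>"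
      using hom_induced_qpow_succ [OF \<omega>c, of 0] by (simp del: qpow_0)
    then show ?case
      using H.r_cancel_one [OF \<omega>c carr] by (simp del: qpow_0)
  next
    case (step1 k)
    then show ?case
      using hom_induced_qpow_succ [OF \<omega>c, of k] H.int_pow_mult [OF \<omega>c, of k 1] by (simp add: \<omega>c)
  next
    case (step2 k)
    have "hom_induced 3 S3 {} S3 {} (qpow (k - 1)) \<omega> \<otimes>\<^bsub>?H\<^esub> \<omega> = \<omega> [^]\<^bsub>?H\<^esub> (k - 1) \<otimes>\<^bsub>?H\<^esub> \<omega>"
      using hom_induced_qpow_succ [OF \<omega>c, of "k - 1"] H.int_pow_mult [OF \<omega>c, of "k - 1" 1] step2.IH by (simp add: \<omega>c)
    then show ?case
      using \<omega>c carr by (simp add: H.right_cancel)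
  qed
qed

text \<open>Some exponent k is known to exist; homotopic maps agree in homology, and comparing
  powers of the generator gives k = m.\<close>

theorem homotopic_qpow_of_degree:
  assumes \<omega>: "fundamental_class 3 S3 \<omega>" and f: "has_degree 3 S3 \<omega> S3 \<omega> f m"
  shows "sphere_homotopic f (qpow m)"
proof -
  have cont: "continuous_on (sphere 0 1) f" "\<And>x. norm x = 1 \<Longrightarrow> norm (f x) = 1"
    and deg: "hom_induced 3 S3 {} S3 {} f \<omega> = \<omega> [^]\<^bsub>homology_group 3 S3\<^esub> m"
    using f by (auto simp: has_degree_def S3_eq_sphere Pi_iff)
  obtain k where k: "sphere_homotopic f (qpow k)"
    using sphere_map_homotopic_qpow [OF cont] by blast
  have "hom_induced 3 S3 {} S3 {} f = hom_induced 3 S3 {} S3 {} (qpow k)"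
    unfolding S3_eq_sphere by (rule homology_homotopy_empty [OF k])
  then have "k = m"
    using deg hom_induced_qpow [OF \<omega>, of k] fundamental_class_pow_inj [OF \<omega>] by simp
  with k show ?thesis by simp
qed

theorem sphere_homotopic_qpow_imp_eq:
  assumes \<omega>: "fundamental_class 3 S3 \<omega>" and "sphere_homotopic (qpow k) (qpow l)"
  shows "k = l"
proof -
  have "hom_induced 3 S3 {} S3 {} (qpow k) = hom_induced 3 S3 {} S3 {} (qpow l)"
    unfolding S3_eq_sphere by (rule homology_homotopy_empty [OF assms(2)])
  then show ?thesis
    using hom_induced_qpow [OF \<omega>] fundamental_class_pow_inj [OF \<omega>] by metis
qed

section \<open>The Hopf map\<close>

text \<open>The Hopf map in coordinates: it takes S^3 to the unit 2-sphere of C x R. The concrete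
  base makes an explicit formula for projections onto the fibre lines possible.\<close>

definition hopf_model :: "quat \<Rightarrow> complex \<times> real" where
  "hopf_model z = (2 * fst z * cnj (snd z), (cmod (fst z))\<^sup>2 - (cmod (snd z))\<^sup>2)"

text \<open>The matrix is (1 + y . sigma) / 2 with the Pauli matrices sigma. For y in the image of
  S^3 under \<open>hopf_model\<close> it is the orthogonal projection onto the complex line over y;
  the formula makes sense, and is affine in y, for every y.\<close>

definition hopf_proj :: "complex \<times> real \<Rightarrow> quat \<Rightarrow> quat" where
  "hopf_proj y v =
     ((1 + of_real (snd y)) / 2 * fst v + fst y / 2 * snd v,
      cnj (fst y) / 2 * fst v + (1 - of_real (snd y)) / 2 * snd v)"

definition herm :: "quat \<Rightarrow> quat \<Rightarrow> complex" where
  "herm v z = fst v * cnj (fst z) + snd v * cnj (snd z)"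

lemma complex_qmul: "(c, 0) *\<^sub>q z = (c * fst z, c * snd z)"
  by (simp add: qmul_def)

lemma norm_complex_qmul: "norm ((c, 0) *\<^sub>q z) = cmod c * norm z"
  by (simp add: norm_qmul norm_Pair)

lemma hopf_proj_hopf_model:
  assumes "norm z = 1"
  shows "hopf_proj (hopf_model z) v = (herm v z, 0) *\<^sub>q z"
proof -
  have "(cmod (fst z))\<^sup>2 + (cmod (snd z))\<^sup>2 = 1"
    using assms by (simp flip: norm_quat_sq)
  then have "of_real ((cmod (fst z))\<^sup>2) + of_real ((cmod (snd z))\<^sup>2) = (1 :: complex)"
    by (metis of_real_1 of_real_add)
  then have s: "fst z * cnj (fst z) + snd z * cnj (snd z) = 1"
    by (simp only: complex_norm_square)
  have 1: "(1 + of_real (snd (hopf_model z))) / 2 = fst z * cnj (fst z)"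
    and 2: "(1 - of_real (snd (hopf_model z))) / 2 = snd z * cnj (snd z)"
    using s by (simp_all add: hopf_model_def of_real_diff complex_norm_square field_simps del: of_real_power)
  show ?thesis
    unfolding hopf_proj_def complex_qmul 1 2
    by (simp add: hopf_model_def herm_def algebra_simps)
qed

lemma hopf_model_complex_qmul:
  assumes "cmod c = 1"
  shows "hopf_model ((c, 0) *\<^sub>q z) = hopf_model z"
proof -
  have "c * cnj c = 1"
    using assms by (simp add: complex_norm_square [symmetric])
  then have "c * fst z * (cnj c * cnj (snd z)) = fst z * cnj (snd z)"
    by (metis mult.assoc mult.left_commute mult_1)
  then show ?thesis
    using assms by (simp add: hopf_model_def complex_qmul norm_mult power_mult_distrib)
qed

lemma hopf_model_minus: "hopf_model (- z) = hopf_model z"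
  by (simp add: hopf_model_def)

lemma herm_self: "norm z = 1 \<Longrightarrow> herm z z = 1"
  unfolding herm_def complex_norm_square [symmetric]
  by (metis norm_quat_sq of_real_1 of_real_add one_power2)

text \<open>A unit vector x is fixed by the projection onto its own line, and over a common base
  point that line is also the line of z.\<close>

lemma hopf_model_eqD:
  assumes "norm x = 1" "norm z = 1" "hopf_model x = hopf_model z"
  shows "x = (herm x z, 0) *\<^sub>q z" "cmod (herm x z) = 1"
proof -
  have "x = hopf_proj (hopf_model x) x"
    using assms(1) by (simp add: hopf_proj_hopf_model herm_self complex_qmul)
  also have "\<dots> = (herm x z, 0) *\<^sub>q z"
    using assms by (simp add: hopf_proj_hopf_model)
  finally show x: "x = (herm x z, 0) *\<^sub>q z" .
  show "cmod (herm x z) = 1"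
    using arg_cong [OF x, of norm] assms by (simp add: norm_complex_qmul)
qed

lemma continuous_on_hopf_proj [continuous_intros]:
  "continuous_on S f \<Longrightarrow> continuous_on S g \<Longrightarrow> continuous_on S (\<lambda>x. hopf_proj (f x) (g x))"
  unfolding hopf_proj_def by (intro continuous_intros) auto

lemma continuous_on_herm [continuous_intros]:
  "continuous_on S f \<Longrightarrow> continuous_on S g \<Longrightarrow> continuous_on S (\<lambda>x. herm (f x) (g x))"
  unfolding herm_def by (intro continuous_intros)

lemma continuous_on_hopf_model [continuous_intros]:
  "continuous_on S f \<Longrightarrow> continuous_on S (\<lambda>x. hopf_model (f x))"
  unfolding hopf_model_def by (intro continuous_intros)

lemma norm_hopf_proj_diff:
  assumes "norm v = 1"
  shows "norm (hopf_proj y v - hopf_proj y' v) \<le> 2 * norm (y - y')"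
proof -
  have v: "cmod (fst v) \<le> 1" "cmod (snd v) \<le> 1"
    using norm_fst_le [of "fst v" "snd v"] norm_snd_le [of "snd v" "fst v"] assms by simp_all
  have y: "cmod (fst (y - y')) \<le> norm (y - y')" "\<bar>snd (y - y')\<bar> \<le> norm (y - y')"
    using norm_fst_le [of "fst (y - y')" "snd (y - y')"] norm_snd_le [of "snd (y - y')" "fst (y - y')"]
    unfolding prod.collapse real_norm_def by blast+
  have bound: "cmod (a / 2 * b + c / 2 * d) \<le> norm (y - y')"
    if "cmod a \<le> norm (y - y')" "cmod c \<le> norm (y - y')" "cmod b \<le> 1" "cmod d \<le> 1" for a b c d
  proof -
    have "cmod (a / 2 * b) \<le> norm (y - y') / 2 * 1" "cmod (c / 2 * d) \<le> norm (y - y') / 2 * 1"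
      unfolding norm_mult using that by (intro mult_mono; simp add: norm_divide)+
    then show ?thesis
      using norm_triangle_ineq [of "a / 2 * b" "c / 2 * d"] by simp
  qed
  define a where "a = complex_of_real (snd (y - y'))"
  define b where "b = fst (y - y')"
  have ab: "cmod a \<le> norm (y - y')" "cmod b \<le> norm (y - y')"
    by (simp_all only: a_def b_def norm_of_real y)
  have "hopf_proj y v - hopf_proj y' v = (a / 2 * fst v + b / 2 * snd v, cnj b / 2 * fst v + (- a) / 2 * snd v)"
    by (simp add: hopf_proj_def a_def b_def prod_eq_iff field_simps)
  also have "norm \<dots> \<le> cmod (a / 2 * fst v + b / 2 * snd v) + cmod (cnj b / 2 * fst v + (- a) / 2 * snd v)"
    by (rule norm_Pair_le)
  also have "\<dots> \<le> norm (y - y') + norm (y - y')"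
    by (intro add_mono bound) (use v ab in simp_all)
  finally show ?thesis by simp
qed

text \<open>With the Lipschitz constant 2 of \<open>norm_hopf_proj_diff\<close>, a distance below
  1/2 in the base means that the projection moves the unit vector v by less than 1.\<close>

lemma hopf_proj_neq_0:
  assumes "norm v = 1" "norm (y - hopf_model v) < 1/2"
  shows "hopf_proj y v \<noteq> 0"
proof
  assume "hopf_proj y v = 0"
  moreover have "hopf_proj (hopf_model v) v = v"
    using assms by (simp add: hopf_proj_hopf_model herm_self complex_qmul)
  ultimately show False
    using norm_hopf_proj_diff [OF assms(1), of y "hopf_model v"] assms by simp
qed

lemma hopf_model_normalize_proj:
  assumes "y \<in> hopf_model ` sphere 0 1" "hopf_proj y v \<noteq> 0"
  shows "hopf_model (hopf_proj y v /\<^sub>R norm (hopf_proj y v)) = y"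
proof -
  obtain z where z: "y = hopf_model z" "norm z = 1"
    using assms(1) by auto
  have eq: "hopf_proj y v = (herm v z, 0) *\<^sub>q z"
    using z by (simp add: hopf_proj_hopf_model)
  then have "herm v z \<noteq> 0"
    using assms(2) by (auto simp: complex_qmul prod_eq_iff)
  have "hopf_proj y v /\<^sub>R norm (hopf_proj y v) = (herm v z /\<^sub>R cmod (herm v z), 0) *\<^sub>q z"
    unfolding eq norm_complex_qmul using z by (simp add: complex_qmul)
  also have "hopf_model \<dots> = hopf_model z"
    by (rule hopf_model_complex_qmul) (use \<open>herm v z \<noteq> 0\<close> in simp)
  finally show ?thesis
    using z by simp
qed

text \<open>The connection: over a short time interval the lift is moved to the next fibre by orthogonal
  projection onto the corresponding complex line.\<close>

theorem hopf_homotopy_lifting: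
  fixes H :: "real \<times> 'a::metric_space \<Rightarrow> complex \<times> real"
  assumes X: "compact X" and H: "continuous_on ({0..1} \<times> X) H"
    and Him: "\<And>t x. t \<in> {0..1} \<Longrightarrow> x \<in> X \<Longrightarrow> H (t, x) \<in> hopf_model ` sphere 0 1"
    and g: "continuous_on X g" "\<And>x. x \<in> X \<Longrightarrow> norm (g x) = 1" "\<And>x. x \<in> X \<Longrightarrow> hopf_model (g x) = H (0, x)"
  obtains G where "continuous_on ({0..1} \<times> X) G"
    "\<And>t x. t \<in> {0..1} \<Longrightarrow> x \<in> X \<Longrightarrow> norm (G (t, x)) = 1 \<and> hopf_model (G (t, x)) = H (t, x)"
    "\<And>x. x \<in> X \<Longrightarrow> G (0, x) = g x"
proof -
  have "uniformly_continuous_on ({0..1} \<times> X) H"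
    by (intro compact_uniformly_continuous H compact_Times X) simp
  \<comment> \<open>The bound 1/2 is the one \<open>hopf_proj_neq_0\<close> demands; time slices of
    length 1/N below \<delta> stay within it, uniformly in x.\<close>
  then obtain \<delta> where \<delta>: "\<delta> > 0"
    "\<And>p q. p \<in> {0..1} \<times> X \<Longrightarrow> q \<in> {0..1} \<times> X \<Longrightarrow> dist q p < \<delta> \<Longrightarrow> dist (H q) (H p) < 1/2"
    unfolding uniformly_continuous_on_def by (metis half_gt_zero zero_less_one)
  obtain N :: nat where N: "N > 0" "1 / real N < \<delta>"
    using nat_approx_posE [OF \<delta>(1)] by (metis zero_less_Suc)
  have "\<exists>G. continuous_on ({0..real n / N} \<times> X) G \<and>
      (\<forall>t\<in>{0..real n / N}. \<forall>x\<in>X. norm (G (t, x)) = 1 \<and> hopf_model (G (t, x)) = H (t, x)) \<and>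
      (\<forall>x\<in>X. G (0, x) = g x)" if "n \<le> N" for n
    using that
  proof (induction n)
    case 0
    have "continuous_on ({0..real 0 / N} \<times> X) (\<lambda>p. g (snd p))"
      by (rule continuous_on_compose2 [OF g(1)]) (auto intro!: continuous_intros)
    then show ?case
      using g by (intro exI [of _ "\<lambda>p. g (snd p)"]) auto
  next
    case (Suc n)
    then obtain G where G: "continuous_on ({0..real n / N} \<times> X) G"
      "\<And>t x. t \<in> {0..real n / N} \<Longrightarrow> x \<in> X \<Longrightarrow> norm (G (t, x)) = 1 \<and> hopf_model (G (t, x)) = H (t, x)"
      "\<And>x. x \<in> X \<Longrightarrow> G (0, x) = g x"
      by (meson Suc_leD)
    define T where "T = real n / N"
    have T: "0 \<le> T" "T \<le> real (Suc n) / N" "real (Suc n) / N \<le> 1" "real (Suc n) / N - T < \<delta>"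
      using N Suc.prems by (simp_all add: T_def divide_right_mono flip: diff_divide_distrib)
    define v where "v p = hopf_proj (H p) (G (T, snd p))" for p
    define G' where "G' p = (if fst p \<le> T then G p else v p /\<^sub>R norm (v p))" for p
    have vnz: "v (t, x) \<noteq> 0" if t: "t \<in> {T..real (Suc n) / N}" and x: "x \<in> X" for t x
    proof -
      have "dist (H (t, x)) (H (T, x)) < 1/2"
        by (rule \<delta>(2)) (use T t x in \<open>auto simp: dist_Pair_Pair dist_real_def\<close>)
      then show ?thesis
        unfolding v_def using G(2) [of T x] T x by (intro hopf_proj_neq_0) (auto simp: T_def dist_norm)
    qed
    have sub1: "{p \<in> {0..real (Suc n) / N} \<times> X. fst p \<le> T} \<subseteq> {0..real n / N} \<times> X"
      by (auto simp: T_def)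
    have contv: "continuous_on {p \<in> {0..real (Suc n) / N} \<times> X. T \<le> fst p} v"
      unfolding v_def
    proof (intro continuous_intros)
      show "continuous_on {p \<in> {0..real (Suc n) / N} \<times> X. T \<le> fst p} H"
        by (rule continuous_on_subset [OF H]) (use T in auto)
      show "continuous_on {p \<in> {0..real (Suc n) / N} \<times> X. T \<le> fst p} (\<lambda>p. G (T, snd p))"
        by (rule continuous_on_compose2 [OF G(1)]) (use T in \<open>auto intro!: continuous_intros simp: T_def\<close>)
    qed
    \<comment> \<open>Projection fixes a vector that already lies over the right base point, so the
      old and the new piece agree on the seam.\<close>
    have at_T: "v (T, x) /\<^sub>R norm (v (T, x)) = G (T, x)" if "x \<in> X" for x
    proof -
      have "norm (G (T, x)) = 1" "hopf_model (G (T, x)) = H (T, x)"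
        using G(2) [of T x] that T by (auto simp: T_def)
      then have "v (T, x) = G (T, x)"
        unfolding v_def by (metis complex_qmul herm_self hopf_proj_hopf_model mult_1 prod.collapse snd_conv)
      then show ?thesis
        using \<open>norm (G (T, x)) = 1\<close> by simp
    qed
    have "continuous_on ({0..real (Suc n) / N} \<times> X) G'"
      unfolding G'_def
    proof (rule continuous_on_cases_le)
      show "continuous_on {p \<in> {0..real (Suc n) / N} \<times> X. fst p \<le> T} G"
        by (rule continuous_on_subset [OF G(1) sub1])
      show "continuous_on {p \<in> {0..real (Suc n) / N} \<times> X. T \<le> fst p} (\<lambda>p. v p /\<^sub>R norm (v p))"
        by (intro continuous_intros contv) (use vnz in auto)
      show "G p = v p /\<^sub>R norm (v p)" if "p \<in> {0..real (Suc n) / N} \<times> X" "fst p = T" for p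
        using at_T [of "snd p"] that by (cases p) auto
    qed (intro continuous_intros)
    moreover have "norm (G' (t, x)) = 1 \<and> hopf_model (G' (t, x)) = H (t, x)"
      if t: "t \<in> {0..real (Suc n) / N}" and x: "x \<in> X" for t x
    proof (cases "t \<le> T")
      case True
      then show ?thesis
        using G(2) [of t x] t x by (simp add: G'_def T_def)
    next
      case False
      then have nz: "v (t, x) \<noteq> 0"
        using vnz t x by simp
      moreover have "H (t, x) \<in> hopf_model ` sphere 0 1"
        using Him t x T by auto
      ultimately show ?thesis
        using hopf_model_normalize_proj [of "H (t, x)" "G (T, x)"] False by (simp add: G'_def v_def)
    qed
    moreover have "G' (0, x) = g x" if "x \<in> X" for x
      using G(3) that T by (simp add: G'_def)
    ultimately show ?case
      by blast
  qed
  from this [of N] show ?thesis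
    using that N by auto
qed

abbreviation hopf_base :: "(complex \<times> real) set" where
  "hopf_base \<equiv> hopf_model ` sphere 0 1"

lemma hopf_lift_homotopic:
  fixes F0 F1 :: "'a::metric_space \<Rightarrow> complex \<times> real"
  assumes X: "compact X" and hom: "homotopic_with_canon (\<lambda>_. True) X hopf_base F0 F1"
    and g: "continuous_on X g" "\<And>x. x \<in> X \<Longrightarrow> norm (g x) = 1" "\<And>x. x \<in> X \<Longrightarrow> hopf_model (g x) = F0 x"
  obtains g1 where "homotopic_with_canon (\<lambda>_. True) X (sphere 0 1) g g1"
    "\<And>x. x \<in> X \<Longrightarrow> hopf_model (g1 x) = F1 x"
proof -
  obtain H where H: "continuous_on ({0..1::real} \<times> X) H"
    "\<And>t x. t \<in> {0..1} \<Longrightarrow> x \<in> X \<Longrightarrow> H (t, x) \<in> hopf_base"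
    "\<And>x. H (0, x) = F0 x" "\<And>x. H (1, x) = F1 x"
    using homotopic_with_canonE [OF hom] by metis
  obtain G where G: "continuous_on ({0..1} \<times> X) G"
    "\<And>t x. t \<in> {0..1} \<Longrightarrow> x \<in> X \<Longrightarrow> norm (G (t, x)) = 1 \<and> hopf_model (G (t, x)) = H (t, x)"
    "\<And>x. x \<in> X \<Longrightarrow> G (0, x) = g x"
    by (rule hopf_homotopy_lifting [OF X H(1,2) g(1,2)]) (use g(3) H(3) in auto)
  have "homotopic_with_canon (\<lambda>_. True) X (sphere 0 1) g (\<lambda>x. G (1, x))"
    by (subst homotopic_with) (use G in \<open>auto intro!: exI [of _ G]\<close>)
  then show ?thesis
    by (rule that) (use G(2) [of 1] H(4) in auto)
qed

section \<open>Phases and lifts over the whole sphere\<close>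

lemma continuous_phase:
  fixes \<mu> :: "'a::real_normed_vector \<Rightarrow> complex"
  assumes S: "simply_connected S" "locally path_connected S"
    and "continuous_on S \<mu>" and norm: "\<And>x. x \<in> S \<Longrightarrow> cmod (\<mu> x) = 1"
  obtains \<theta> where "continuous_on S \<theta>" "\<And>x. x \<in> S \<Longrightarrow> \<mu> x = cis (\<theta> x)"
proof -
  have "\<mu> x \<noteq> 0" if "x \<in> S" for x
    using norm [OF that] by auto
  then obtain g where g: "continuous_on S g" "\<And>x. x \<in> S \<Longrightarrow> \<mu> x = exp (g x)"
    using continuous_logarithm_on_simply_connected [OF assms(3) S] by blast
  show ?thesis
  proof (rule that)
    show "continuous_on S (\<lambda>x. Im (g x))"
      by (intro continuous_intros g)
    show "\<mu> x = cis (Im (g x))" if "x \<in> S" for x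
    proof -
      have "Re (g x) = 0"
        using norm [OF that] g(2) [OF that] by simp
      then show ?thesis
        by (simp add: g(2) [OF that] exp_eq_polar)
    qed
  qed
qed

text \<open>The unit sphere of a space of dimension at least 3 is simply connected. The lemma serves
  both S^3 and the 2-sphere in \<open>real \<times> complex\<close> that parametrises the
  equator.\<close>

lemma continuous_phase_sphere:
  fixes \<mu> :: "'a::euclidean_space \<Rightarrow> complex"
  assumes "3 \<le> DIM('a)" "continuous_on (sphere 0 1) \<mu>" "\<And>x. x \<in> sphere 0 1 \<Longrightarrow> cmod (\<mu> x) = 1"
  obtains \<theta> where "continuous_on (sphere 0 1) \<theta>" "\<And>x. x \<in> sphere 0 1 \<Longrightarrow> \<mu> x = cis (\<theta> x)"
  using continuous_phase [OF simply_connected_sphere [OF assms(1)] locally_path_connected_sphere assms(2,3)] by blast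

lemma continuous_on_sphere_minus:
  fixes f :: "'a::real_normed_vector \<Rightarrow> 'b::topological_space"
  assumes "continuous_on (sphere 0 1) f"
  shows "continuous_on (sphere 0 1) (\<lambda>x. f (- x))"
  by (rule continuous_on_compose2 [OF assms]) (auto intro!: continuous_intros)

lemma continuous_on_cis_qmul [continuous_intros]:
  "continuous_on S f \<Longrightarrow> continuous_on S g \<Longrightarrow> continuous_on S (\<lambda>x. (cis (f x), 0) *\<^sub>q g x)"
  unfolding cis_conv_exp by (intro continuous_intros)

lemma norm_cis_qmul: "norm ((cis t, 0) *\<^sub>q z) = norm z"
  by (simp add: norm_complex_qmul)

lemma hemisphere_contracts:
  assumes u: "norm u = 1"
  shows "homotopic_with_canon (\<lambda>_. True) {x \<in> sphere 0 1. x \<bullet> u \<ge> 0} {x \<in> sphere 0 1. x \<bullet> u \<ge> 0} id (\<lambda>_. u :: quat)"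
proof -
  let ?D = "{x \<in> sphere 0 1. x \<bullet> u \<ge> 0}"
  let ?K = "{x. x \<bullet> u \<ge> 0 \<and> x \<noteq> 0}"
  have "homotopic_with_canon (\<lambda>_. True) ?D ?K id (\<lambda>_. u)"
  proof (rule homotopic_with_linear)
    fix x assume x: "x \<in> ?D"
    have "y \<in> ?K" if y: "y \<in> closed_segment (id x) u" for y
    proof -
      obtain t where t: "0 \<le> t" "t \<le> 1" "y = (1 - t) *\<^sub>R x + t *\<^sub>R u"
        using y unfolding closed_segment_def id_def by blast
      have yu: "y \<bullet> u = (1 - t) * (x \<bullet> u) + t"
        using t(3) u by (simp add: inner_add_left dot_square_norm)
      show ?thesis
      proof (cases "t = 0")
        case True
        then show ?thesis using t x by auto
      next
        case False
        then have "y \<bullet> u > 0"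
          using t x unfolding yu by (auto intro: add_nonneg_pos)
        then show ?thesis by auto
      qed
    qed
    then show "closed_segment (id x) u \<subseteq> ?K"
      by blast
  qed (auto intro: continuous_on_id)
  then have "homotopic_with_canon (\<lambda>_. True) ?D ?D ((\<lambda>y. y /\<^sub>R norm y) \<circ> id) ((\<lambda>y. y /\<^sub>R norm y) \<circ> (\<lambda>_. u))"
    by (rule homotopic_with_compose_continuous_map_left) (auto intro!: continuous_intros)
  then show ?thesis
    by (rule homotopic_with_eq) (use u in auto)
qed

text \<open>Contracting the hemisphere makes F homotopic to a constant map. A constant lifts, and
  lifting the homotopy that starts there ends at a lift of F.\<close>

lemma hopf_lift_hemisphere:
  assumes F: "continuous_on (sphere 0 1) F" "\<And>x. norm x = 1 \<Longrightarrow> F x \<in> hopf_base" and u: "norm u = 1"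
  obtains G where "continuous_on {x \<in> sphere 0 1. x \<bullet> u \<ge> 0} G"
    "\<And>x::quat. norm x = 1 \<Longrightarrow> x \<bullet> u \<ge> 0 \<Longrightarrow> norm (G x) = 1 \<and> hopf_model (G x) = F x"
proof -
  let ?D = "{x \<in> sphere 0 1. x \<bullet> u \<ge> 0}"
  have "homotopic_with_canon (\<lambda>_. True) ?D hopf_base (F \<circ> id) (F \<circ> (\<lambda>_. u))"
    by (rule homotopic_with_compose_continuous_left [OF hemisphere_contracts [OF u]])
      (use F in \<open>auto intro: continuous_on_subset\<close>)
  then have hom: "homotopic_with_canon (\<lambda>_. True) ?D hopf_base (\<lambda>_. F u) F"
    by (simp add: o_def homotopic_with_sym)
  obtain z where z: "norm z = 1" "hopf_model z = F u"
    using F(2) [OF u] by auto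
  have "compact ?D"
  proof -
    have "?D = sphere 0 1 \<inter> {x. u \<bullet> x \<ge> 0}"
      by (auto simp: inner_commute)
    then show ?thesis
      using closed_halfspace_ge [of 0 u] by (simp add: compact_Int_closed)
  qed
  then obtain G where "homotopic_with_canon (\<lambda>_. True) ?D (sphere 0 1) (\<lambda>_. z) G"
    "\<And>x. x \<in> ?D \<Longrightarrow> hopf_model (G x) = F x"
    by (rule hopf_lift_homotopic [OF _ hom]) (use z in auto)
  then show ?thesis
    using homotopic_with_imp_continuous homotopic_with_imp_funspace2 by (intro that [of G]) fastforce+
qed

text \<open>Lifts A and B over two opposite hemispheres differ by a circle-valued phase on the
  equator. As the equator is a 2-sphere, the phase has a real logarithm, and B can be rotated until
  both fit together.\<close>

theorem hopf_lift_sphere: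
  assumes F: "continuous_on (sphere 0 1) F" "\<And>x::quat. norm x = 1 \<Longrightarrow> F x \<in> hopf_base"
  obtains G where "continuous_on (sphere 0 1) G" "\<And>x. norm x = 1 \<Longrightarrow> norm (G x) = 1"
    "\<And>x. norm x = 1 \<Longrightarrow> hopf_model (G x) = F x"
proof -
  obtain A where A: "continuous_on {x \<in> sphere 0 1. x \<bullet> qone \<ge> 0} A"
    "\<And>x. norm x = 1 \<Longrightarrow> x \<bullet> qone \<ge> 0 \<Longrightarrow> norm (A x) = 1 \<and> hopf_model (A x) = F x"
    using hopf_lift_hemisphere [OF F norm_qone] by blast
  have "norm (- qone) = 1"
    by simp
  then obtain B where B: "continuous_on {x \<in> sphere 0 1. x \<bullet> (- qone) \<ge> 0} B"
    "\<And>x. norm x = 1 \<Longrightarrow> x \<bullet> (- qone) \<ge> 0 \<Longrightarrow> norm (B x) = 1 \<and> hopf_model (B x) = F x"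
    using hopf_lift_hemisphere [OF F] by blast
  have Re: "x \<bullet> qone = Re (fst x)" for x
    by (simp add: inner_prod_def inner_complex_def)
  define E where "E = {x :: quat. norm x = 1 \<and> Re (fst x) = 0}"
  define m :: "real \<times> complex \<Rightarrow> quat" where "m y = (\<i> * of_real (fst y), snd y)" for y
  have m: "m y \<in> E" if "norm y = 1" for y
    using that by (simp add: m_def E_def norm_prod_def norm_mult)
  have contm: "continuous_on S m" for S
    unfolding m_def by (intro continuous_intros)
  define \<mu> where "\<mu> x = herm (A x) (B x)" for x
  have \<mu>: "A x = (\<mu> x, 0) *\<^sub>q B x" "cmod (\<mu> x) = 1" if "x \<in> E" for x
    using that A(2) [of x] B(2) [of x] hopf_model_eqD [of "A x" "B x"] by (simp_all add: E_def Re \<mu>_def)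
  have "continuous_on E A"
    by (rule continuous_on_subset [OF A(1)]) (auto simp: E_def Re)
  moreover have "continuous_on E B"
    by (rule continuous_on_subset [OF B(1)]) (auto simp: E_def Re)
  ultimately have "continuous_on E \<mu>"
    unfolding \<mu>_def by (intro continuous_intros)
  then have "continuous_on (sphere 0 1) (\<lambda>y. \<mu> (m y))"
    by (rule continuous_on_compose2 [OF _ contm]) (use m in auto)
  then obtain \<theta>0 where \<theta>0: "continuous_on (sphere 0 1) \<theta>0"
    "\<And>y. y \<in> sphere 0 1 \<Longrightarrow> \<mu> (m y) = cis (\<theta>0 y)"
    using continuous_phase_sphere [of "\<lambda>y. \<mu> (m y)"] \<mu>(2) m by (auto simp del: norm_eq_zero)
  define \<theta>1 where "\<theta>1 x = \<theta>0 (Im (fst x), snd x)" for x :: quat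
  have E: "norm (Im (fst x), snd x) = 1" "m (Im (fst x), snd x) = x" if "x \<in> E" for x
    using that by (auto simp: E_def m_def norm_prod_def prod_eq_iff complex_eq_iff cmod_def)
  have \<theta>1: "\<mu> x = cis (\<theta>1 x)" if "x \<in> E" for x
    using \<theta>0(2) [of "(Im (fst x), snd x)"] E [OF that] by (simp add: \<theta>1_def)
  have "continuous_on E \<theta>1"
    unfolding \<theta>1_def by (rule continuous_on_compose2 [OF \<theta>0(1)]) (use E in \<open>auto intro!: continuous_intros\<close>)
  moreover have "closed E"
  proof -
    have "E = sphere 0 1 \<inter> (\<lambda>x. Re (fst x)) -` {0}"
      by (auto simp: E_def)
    moreover have "closed \<dots>"
      by (rule continuous_closed_preimage) (auto intro!: continuous_intros)
    ultimately show ?thesis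
      by simp
  qed
  then have "closedin (top_of_set UNIV) E"
    by simp
  \<comment> \<open>It is the real logarithm that is extended, not the phase: Tietze's theorem
    applies to real values, and \<open>cis\<close> of the extension rotates B on its whole
    hemisphere.\<close>
  ultimately obtain \<theta> where \<theta>: "continuous_on UNIV \<theta>" "\<And>x. x \<in> E \<Longrightarrow> \<theta> x = \<theta>1 x"
    using Tietze_unbounded by metis
  define G where "G x = (if Re (fst x) \<le> 0 then (cis (\<theta> x), 0) *\<^sub>q B x else A x)" for x
  show ?thesis
  proof (rule that)
    show "continuous_on (sphere 0 1) G"
      unfolding G_def
    proof (rule continuous_on_cases_le)
      show "continuous_on {x \<in> sphere 0 1. Re (fst x) \<le> 0} (\<lambda>x. (cis (\<theta> x), 0) *\<^sub>q B x)"
        using B(1) by (intro continuous_intros continuous_on_subset [OF \<theta>(1)]) (auto simp: Re)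
      show "continuous_on {x \<in> sphere 0 1. 0 \<le> Re (fst x)} A"
        using A(1) by (simp add: Re)
      show "(cis (\<theta> x), 0) *\<^sub>q B x = A x" if "x \<in> sphere 0 1" "Re (fst x) = 0" for x
      proof -
        have "x \<in> E"
          using that by (simp add: E_def)
        then show ?thesis
          using \<mu>(1) \<theta>(2) \<theta>1 by simp
      qed
    qed (intro continuous_intros)
    show "norm (G x) = 1" "hopf_model (G x) = F x" if "norm x = 1" for x
      using A(2) [OF that] B(2) [OF that] by (simp_all add: G_def Re norm_cis_qmul hopf_model_complex_qmul)
  qed
qed

text \<open>The lifted homotopy leads from f to a map f1 over the same base map as g. These two
  differ by a phase with a real logarithm, which is scaled down to 0.\<close>

theorem hopf_homotopic_imp_homotopic:
  assumes f: "continuous_on (sphere 0 1) f" "\<And>x. norm x = 1 \<Longrightarrow> norm (f x) = 1"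
    and g: "continuous_on (sphere 0 1) g" "\<And>x. norm x = 1 \<Longrightarrow> norm (g x) = 1"
    and hom: "homotopic_with_canon (\<lambda>_. True) (sphere 0 1) hopf_base (\<lambda>x. hopf_model (f x)) (\<lambda>x. hopf_model (g x))"
  shows "sphere_homotopic f g"
proof -
  obtain f1 where f1: "sphere_homotopic f f1" "\<And>x. x \<in> sphere 0 1 \<Longrightarrow> hopf_model (f1 x) = hopf_model (g x)"
    by (rule hopf_lift_homotopic [OF compact_sphere hom f(1)]) (use f in auto)
  have f1': "continuous_on (sphere 0 1) f1" "\<And>x. norm x = 1 \<Longrightarrow> norm (f1 x) = 1"
    using sphere_homotopic_imp_maps [OF f1(1)] by auto
  define \<mu> where "\<mu> x = herm (f1 x) (g x)" for x
  have \<mu>: "f1 x = (\<mu> x, 0) *\<^sub>q g x" "cmod (\<mu> x) = 1" if "x \<in> sphere 0 1" for x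
    using that f1'(2) [of x] g(2) [of x] f1(2) hopf_model_eqD [of "f1 x" "g x"] by (simp_all add: \<mu>_def)
  have "continuous_on (sphere 0 1) \<mu>"
    unfolding \<mu>_def by (intro continuous_intros f1' g)
  then obtain \<theta> where \<theta>: "continuous_on (sphere 0 1) \<theta>" "\<And>x. x \<in> sphere 0 1 \<Longrightarrow> \<mu> x = cis (\<theta> x)"
    using continuous_phase_sphere [of \<mu>] \<mu>(2) by auto
  have "sphere_homotopic f1 g"
  proof (subst homotopic_with)
    have "continuous_on ({0..1} \<times> sphere 0 1) (\<lambda>p::real \<times> quat. \<theta> (snd p))"
      by (rule continuous_on_compose2 [OF \<theta>(1)]) (auto intro!: continuous_intros)
    moreover have "continuous_on ({0..1} \<times> sphere 0 1) (\<lambda>p::real \<times> quat. g (snd p))"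
      by (rule continuous_on_compose2 [OF g(1)]) (auto intro!: continuous_intros)
    ultimately have cont: "continuous_on ({0..1} \<times> sphere 0 1) (\<lambda>p. (cis ((1 - fst p) * \<theta> (snd p)), 0) *\<^sub>q g (snd p))"
      by (intro continuous_intros)
    have cis0: "(cis 0, 0) *\<^sub>q g x = g x" for x
      by (simp add: complex_qmul)
    show "\<exists>h. continuous_map (prod_topology (top_of_set {0..1::real}) (top_of_set (sphere 0 1))) (top_of_set (sphere 0 1)) h \<and>
        (\<forall>x\<in>topspace (top_of_set (sphere 0 1)). h (0, x) = f1 x) \<and>
        (\<forall>x\<in>topspace (top_of_set (sphere 0 1)). h (1, x) = g x) \<and> (\<forall>t\<in>{0..1}. True)"
      by (intro exI [of _ "\<lambda>p. (cis ((1 - fst p) * \<theta> (snd p)), 0) *\<^sub>q g (snd p)"])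
        (use cont cis0 g \<mu>(1) \<theta>(2) in \<open>simp add: norm_cis_qmul Pi_iff\<close>)
  qed simp
  with f1(1) show ?thesis
    by (rule homotopic_with_trans)
qed

theorem hopf_lift_even:
  assumes F: "continuous_on (sphere 0 1) F" "\<And>x::quat. norm x = 1 \<Longrightarrow> F x \<in> hopf_base"
    and even: "\<And>x. norm x = 1 \<Longrightarrow> F (- x) = F x"
  obtains G where "continuous_on (sphere 0 1) G" "\<And>x. norm x = 1 \<Longrightarrow> norm (G x) = 1"
    "\<And>x. norm x = 1 \<Longrightarrow> hopf_model (G x) = F x"
    "(\<forall>x\<in>sphere 0 1. G (- x) = G x) \<or> (\<forall>x\<in>sphere 0 1. G (- x) = - G x)"
proof -
  obtain G where G: "continuous_on (sphere 0 1) G" "\<And>x. norm x = 1 \<Longrightarrow> norm (G x) = 1"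
    "\<And>x. norm x = 1 \<Longrightarrow> hopf_model (G x) = F x"
    using hopf_lift_sphere [OF F] by blast
  have contGm: "continuous_on (sphere 0 1) (\<lambda>x. G (- x))"
    by (rule continuous_on_sphere_minus [OF G(1)])
  define \<mu> where "\<mu> x = herm (G (- x)) (G x)" for x
  have \<mu>: "G (- x) = (\<mu> x, 0) *\<^sub>q G x" "cmod (\<mu> x) = 1" if "norm x = 1" for x
    using that G(2,3) [of x] G(2,3) [of "- x"] even hopf_model_eqD [of "G (- x)" "G x"] by (simp_all add: \<mu>_def)
  have "continuous_on (sphere 0 1) \<mu>"
    unfolding \<mu>_def by (intro continuous_intros contGm G)
  then obtain \<theta> where \<theta>: "continuous_on (sphere 0 1) \<theta>" "\<And>x. x \<in> sphere 0 1 \<Longrightarrow> \<mu> x = cis (\<theta> x)"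
    using continuous_phase_sphere [of \<mu>] \<mu>(2) by auto
  have cont\<theta>m: "continuous_on (sphere 0 1) (\<lambda>x. \<theta> (- x))"
    by (rule continuous_on_sphere_minus [OF \<theta>(1)])
  \<comment> \<open>Passing from x to -x and back multiplies G x by the cis of s x, so s takes
    values in the multiples of 2 pi and is constant. The parity of the multiple n will decide
    between an even and an odd lift.\<close>
  define s where "s x = \<theta> x + \<theta> (- x)" for x
  have period: "\<exists>n::int. s x = 2 * pi * n" if x: "norm x = 1" for x
  proof -
    have "G x = (\<mu> (- x) * \<mu> x, 0) *\<^sub>q G x"
      using \<mu>(1) [of x] \<mu>(1) [of "- x"] x by (simp add: complex_qmul mult.assoc)
    then have "G x *\<^sub>q qinv (G x) = (\<mu> (- x) * \<mu> x, 0) *\<^sub>q (G x *\<^sub>q qinv (G x))"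
      by (metis qmul_assoc)
    moreover have "G x \<noteq> 0"
      using G(2) [OF x] by auto
    ultimately have "(\<mu> (- x) * \<mu> x, 0) = qone"
      by (simp only: qinv_right qmul_qone not_False_eq_True)
    then have "\<mu> (- x) * \<mu> x = 1"
      by (simp add: qone_def)
    then have "cis (s x) = 1"
      using \<theta>(2) [of x] \<theta>(2) [of "- x"] x by (simp add: s_def cis_mult add.commute)
    then have "cos (s x) = 1"
      by (simp add: complex_eq_iff)
    then show ?thesis
      using cos_one_2pi_int by (metis mult.commute mult.assoc)
  qed
  have "s constant_on sphere 0 1"
  proof (rule continuous_discrete_range_constant)
    show "connected (sphere (0::quat) 1)"
      by (rule connected_sphere) simp
    show "continuous_on (sphere 0 1) s"
      unfolding s_def by (intro continuous_intros \<theta> cont\<theta>m)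
    fix x :: quat assume x: "x \<in> sphere 0 1"
    show "\<exists>e>0. \<forall>y. y \<in> sphere 0 1 \<and> s y \<noteq> s x \<longrightarrow> e \<le> norm (s y - s x)"
    proof (intro exI [of _ "2 * pi"] conjI allI impI)
      fix y :: quat assume y: "y \<in> sphere 0 1 \<and> s y \<noteq> s x"
      obtain n k :: int where nk: "s x = 2 * pi * n" "s y = 2 * pi * k"
        using period x y by (metis mem_sphere_0)
      then have "1 \<le> \<bar>k - n\<bar>"
        using y by auto
      then have "2 * pi * 1 \<le> 2 * pi * \<bar>real_of_int (k - n)\<bar>"
        by (intro mult_left_mono) auto
      also have "\<dots> = norm (s y - s x)"
        by (simp add: nk abs_mult flip: right_diff_distrib)
      finally show "2 * pi \<le> norm (s y - s x)"
        by simp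
    qed simp
  qed
  then obtain c where c: "\<And>x. x \<in> sphere 0 1 \<Longrightarrow> s x = c"
    unfolding constant_on_def by blast
  obtain n :: int where n: "c = 2 * pi * n"
    using period [OF norm_qone] c [of qone] by auto
  \<comment> \<open>Rotating G by \<psi> changes its antipodal phase to
    \<open>\<psi> (- x) + \<theta> x - \<psi> x\<close>. Asking that this be half of s x, with
    \<psi> an odd function, gives this formula and its factor 1/4.\<close>
  define \<psi> where "\<psi> x = (\<theta> x - \<theta> (- x)) / 4" for x
  define G' where "G' x = (cis (\<psi> x), 0) *\<^sub>q G x" for x
  have G'm: "G' (- x) = (cis (pi * n), 0) *\<^sub>q G' x" if x: "norm x = 1" for x
  proof -
    have "\<psi> (- x) + \<theta> x = pi * n + \<psi> x"
      using c [of x] n x by (simp add: \<psi>_def s_def field_simps)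
    then have "cis (\<psi> (- x)) * cis (\<theta> x) = cis (pi * n) * cis (\<psi> x)"
      by (simp add: cis_mult)
    moreover have "G' (- x) = (cis (\<psi> (- x)) * cis (\<theta> x), 0) *\<^sub>q G x"
      using \<mu>(1) [OF x] \<theta>(2) [of x] x by (simp add: G'_def complex_qmul mult.assoc)
    ultimately show ?thesis
      by (simp add: G'_def complex_qmul mult.assoc)
  qed
  show ?thesis
  proof (rule that)
    show "continuous_on (sphere 0 1) G'"
      unfolding G'_def \<psi>_def by (intro continuous_intros G \<theta> cont\<theta>m) auto
    show "norm (G' x) = 1" "hopf_model (G' x) = F x" if "norm x = 1" for x
      using G(2,3) [OF that] by (simp_all add: G'_def norm_cis_qmul hopf_model_complex_qmul)
    have "cis (pi * n) = (if even n then 1 else - 1)"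
      by (simp add: complex_eq_iff cos_npi_int sin_npi_int)
    then show "(\<forall>x\<in>sphere 0 1. G' (- x) = G' x) \<or> (\<forall>x\<in>sphere 0 1. G' (- x) = - G' x)"
      using G'm by (cases "even n") (auto simp: complex_qmul prod_eq_iff)
  qed
qed

section \<open>Even and odd maps\<close>

text \<open>Restricting to the sphere makes the property depend only on values there, as is required
  for replacing maps by equal ones on the sphere in \<open>homotopic_with_eq\<close>.\<close>

definition even_on_sphere :: "(quat \<Rightarrow> 'b) \<Rightarrow> bool" where
  "even_on_sphere f \<longleftrightarrow> (\<forall>x\<in>sphere 0 1. f (- x) = f x)"

definition odd_on_sphere :: "(quat \<Rightarrow> quat) \<Rightarrow> bool" where
  "odd_on_sphere f \<longleftrightarrow> (\<forall>x\<in>sphere 0 1. f (- x) = - f x)"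

lemma even_on_sphere_cong:
  "(\<And>x. x \<in> sphere 0 1 \<Longrightarrow> h x = k x) \<Longrightarrow> even_on_sphere h \<longleftrightarrow> even_on_sphere k"
  unfolding even_on_sphere_def by (metis mem_sphere_0 norm_minus_cancel)

lemma odd_on_sphere_cong:
  "(\<And>x. x \<in> sphere 0 1 \<Longrightarrow> h x = k x) \<Longrightarrow> odd_on_sphere h \<longleftrightarrow> odd_on_sphere k"
  unfolding odd_on_sphere_def by (metis mem_sphere_0 norm_minus_cancel)

definition equator :: "quat set" where
  "equator = {x. norm x = 1 \<and> Re (fst x) = 0}"

lemma equator_subset: "equator \<subseteq> sphere 0 1"
  by (auto simp: equator_def)

lemma compact_equator: "compact equator"
proof -
  have eq: "equator = sphere 0 1 \<inter> (sphere 0 1 \<inter> (\<lambda>x. Re (fst x)) -` {0})"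
    by (auto simp: equator_def)
  show ?thesis
    unfolding eq
    by (intro compact_Int_closed compact_sphere continuous_closed_preimage continuous_intros) auto
qed

text \<open>The map \<Phi>, homogeneous of degree 1, sweeps out the cone over the image of the
  equator. Being differentiable away from 0 from dimension 3 into dimension 4, it has a negligible
  image, so some direction is missed. Differentiability matters: a merely continuous image of the
  equator could fill S^3.\<close>

lemma polynomial_image_equator_misses_direction:
  assumes q: "polynomial_function q" and nz: "\<And>x. x \<in> equator \<Longrightarrow> q x \<noteq> 0"
  obtains u :: quat where "norm u = 1" "\<And>x. x \<in> equator \<Longrightarrow> q x /\<^sub>R norm (q x) \<noteq> u"
proof -
  define m :: "real \<times> complex \<Rightarrow> quat" where "m y = (\<i> * of_real (fst y), snd y)" for y
  define \<Phi> where "\<Phi> y = norm y *\<^sub>R q (m (y /\<^sub>R norm y))" for y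
  have lin: "linear m"
    by (rule linearI) (auto simp: m_def algebra_simps scaleR_conv_of_real)
  have diff_m: "(\<lambda>y. m (f y)) differentiable (at y)" if "f differentiable (at y)" for f y
    using differentiable_compose [OF linear_imp_differentiable [OF lin] that] .
  have "\<Phi> differentiable_on - {0}"
    unfolding differentiable_on_def
  proof
    fix y :: "real \<times> complex" assume "y \<in> - {0}"
    then have y: "y \<noteq> 0" by simp
    have "norm differentiable (at y)"
      using has_derivative_norm [OF y] unfolding differentiable_def by blast
    moreover from this have "(\<lambda>y. y /\<^sub>R norm y) differentiable (at y)"
      using y by (intro derivative_intros) auto
    then have "(\<lambda>y. q (m (y /\<^sub>R norm y))) differentiable (at y)"
      by (intro differentiable_compose [OF differentiable_at_polynomial_function [OF q]] diff_m)
    ultimately have "\<Phi> differentiable (at y)"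
      unfolding \<Phi>_def by (intro derivative_intros y)
    then show "\<Phi> differentiable (at y within - {0})"
      by (rule differentiable_at_withinI)
  qed
  then have "negligible (\<Phi> ` (- {0}))"
    by (rule negligible_differentiable_image_lowdim [rotated]) simp
  moreover have "\<not> negligible (- {0 :: quat})"
    using qone_neq_0 by (intro open_not_negligible) blast+
  ultimately have "\<not> - {0} \<subseteq> \<Phi> ` (- {0})"
    using negligible_subset by blast
  then obtain w where w: "w \<noteq> 0" "w \<notin> \<Phi> ` (- {0})"
    by blast
  show ?thesis
  proof (rule that [of "w /\<^sub>R norm w"])
    show "norm (w /\<^sub>R norm w) = 1"
      using w by simp
    fix x assume x: "x \<in> equator"
    show "q x /\<^sub>R norm (q x) \<noteq> w /\<^sub>R norm w"
    proof
      assume eq: "q x /\<^sub>R norm (q x) = w /\<^sub>R norm w"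
      define y0 where "y0 = (Im (fst x), snd x)"
      have y0: "norm y0 = 1" "m y0 = x"
        using x by (auto simp: equator_def y0_def m_def norm_prod_def prod_eq_iff complex_eq_iff cmod_def)
      define s where "s = norm w / norm (q x)"
      have s: "s > 0"
        using w nz [OF x] by (simp add: s_def)
      have "\<Phi> (s *\<^sub>R y0) = s *\<^sub>R q x"
        using s y0 by (simp add: \<Phi>_def)
      also have "\<dots> = norm w *\<^sub>R (q x /\<^sub>R norm (q x))"
        by (simp add: s_def divide_inverse)
      also have "\<dots> = w"
        using w by (simp add: eq)
      finally have "\<Phi> (s *\<^sub>R y0) = w" .
      moreover have "s *\<^sub>R y0 \<noteq> 0"
        using s y0 by auto
      ultimately show False
        using w(2) by blast
    qed
  qed
qed

section \<open>The squaring map\<close>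

lemma qmul_self: "x *\<^sub>q x = (2 * Re (fst x)) *\<^sub>R x - (norm x)\<^sup>2 *\<^sub>R qone"
proof -
  have "x + qcnj x = (2 * Re (fst x)) *\<^sub>R qone"
    by (simp add: prod_eq_iff complex_eq_iff)
  then have "x *\<^sub>q x + x *\<^sub>q qcnj x = (2 * Re (fst x)) *\<^sub>R x"
    by (metis qmul.add_right qmul.scaleR_right qmul_qone)
  then show ?thesis
    by (simp add: qmul_qcnj eq_diff_eq)
qed

lemma qmul_self_eqD:
  assumes xy: "norm x = 1" "norm y = 1" "x *\<^sub>q x = y *\<^sub>q y"
  shows "x = y \<or> x = - y \<or> (x \<in> equator \<and> y \<in> equator)"
proof -
  have "2 *\<^sub>R (Re (fst x) *\<^sub>R x) = 2 *\<^sub>R (Re (fst y) *\<^sub>R y)"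
    using xy unfolding qmul_self by simp
  then have eq: "Re (fst x) *\<^sub>R x = Re (fst y) *\<^sub>R y"
    by (simp only: scaleR_cancel_left) simp
  have "\<bar>Re (fst x)\<bar> = \<bar>Re (fst y)\<bar>"
    using arg_cong [OF eq, of norm] xy(1,2) by (simp only: norm_scaleR mult_1_right)
  then have "Re (fst x) = Re (fst y) \<or> Re (fst x) = - Re (fst y)"
    by (simp add: abs_eq_iff)
  then show ?thesis
  proof (cases "Re (fst y) = 0")
    case True
    with \<open>\<bar>Re (fst x)\<bar> = _\<close> xy(1,2) show ?thesis
      by (simp add: equator_def)
  next
    case False
    assume "Re (fst x) = Re (fst y) \<or> Re (fst x) = - Re (fst y)"
    then show ?thesis
    proof
      assume "Re (fst x) = Re (fst y)"
      then have "x = y"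
        using eq False by (simp only: scaleR_cancel_left) simp
      then show ?thesis ..
    next
      assume "Re (fst x) = - Re (fst y)"
      then have "Re (fst y) *\<^sub>R (- x) = Re (fst y) *\<^sub>R y"
        using eq by simp
      then have "- x = y"
        using False by (simp only: scaleR_cancel_left) simp
      then show ?thesis by auto
    qed
  qed
qed

text \<open>A square root of y is the normalised bisector of 1 and y. At y = -1 there is no
  bisector, but any imaginary unit will do.\<close>

lemma qmul_self_surj:
  assumes y: "norm y = 1"
  obtains x where "norm x = 1" "x *\<^sub>q x = y"
proof (cases "y = - qone")
  case True
  have "norm ((\<i>, 0) :: quat) = 1" "(\<i>, 0) *\<^sub>q (\<i>, 0) = y"
    using True by (auto simp: norm_Pair prod_eq_iff)
  then show ?thesis
    by (rule that)
next
  case False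
  define s where "s = norm (y + qone)"
  have s: "s > 0"
    using False by (simp add: s_def add_eq_0_iff2)
  have "(cmod (fst y))\<^sup>2 + (cmod (snd y))\<^sup>2 = 1"
    using y by (simp flip: norm_quat_sq)
  then have s2: "s\<^sup>2 = 2 + 2 * Re (fst y)"
    unfolding s_def norm_quat_sq cmod_power2 by (simp add: power2_eq_square algebra_simps)
  have "(y + qone) *\<^sub>q (y + qone) = (2 + 2 * Re (fst y)) *\<^sub>R (y + qone) - (2 + 2 * Re (fst y)) *\<^sub>R qone"
    using s2 unfolding qmul_self [of "y + qone"] by (simp add: s_def add.commute)
  then have "(y + qone) *\<^sub>q (y + qone) = s\<^sup>2 *\<^sub>R y"
    unfolding s2 by (simp add: scaleR_add_right)
  then have "((y + qone) /\<^sub>R s) *\<^sub>q ((y + qone) /\<^sub>R s) = (inverse s * inverse s * s\<^sup>2) *\<^sub>R y"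
    by (simp add: qmul.scaleR_left qmul.scaleR_right)
  moreover have "inverse s * inverse s * s\<^sup>2 = 1"
    using s by (simp add: power2_eq_square field_simps)
  ultimately have "((y + qone) /\<^sub>R s) *\<^sub>q ((y + qone) /\<^sub>R s) = y"
    by (simp only: scaleR_one)
  moreover have "norm ((y + qone) /\<^sub>R s) = 1"
    using s by (simp add: s_def)
  ultimately show ?thesis
    using that by blast
qed

lemma quotient_map_qmul_self:
  "quotient_map (top_of_set (sphere 0 1)) (top_of_set (sphere 0 1)) (\<lambda>x. x *\<^sub>q x)"
proof -
  have im: "(\<lambda>x. x *\<^sub>q x) ` sphere 0 1 = sphere 0 1"
  proof
    show "sphere 0 1 \<subseteq> (\<lambda>x. x *\<^sub>q x) ` sphere 0 1"
    proof
      fix y :: quat assume "y \<in> sphere 0 1"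
      then obtain x where "norm x = 1" "x *\<^sub>q x = y"
        using qmul_self_surj [of y] by auto
      then show "y \<in> (\<lambda>x. x *\<^sub>q x) ` sphere 0 1"
        by force
    qed
  qed (auto simp: norm_qmul)
  have cont: "continuous_on (sphere 0 1) (\<lambda>x. x *\<^sub>q x)"
    by (intro continuous_intros)
  show ?thesis
  proof (rule continuous_imp_quotient_map)
    show "continuous_map (top_of_set (sphere 0 1)) (top_of_set (sphere 0 1)) (\<lambda>x. x *\<^sub>q x)"
      using cont by (simp add: norm_qmul)
    show "compact_space (top_of_set (sphere (0::quat) 1))"
      by (simp add: compact_space_subtopology)
    show "Hausdorff_space (top_of_set (sphere (0::quat) 1))"
      by (simp add: Hausdorff_space_subtopology)
  qed (simp add: im)
qed

text \<open>Since u is not in K, no point of K is antipodal to -u, and K contracts to -u inside the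
  sphere. Borsuk's homotopy extension, valid because the sphere is an ANR, extends the contraction
  to the whole sphere.\<close>

lemma homotopic_collapse:
  assumes K: "compact K" "K \<subseteq> sphere 0 1" and u: "norm u = 1" "u \<notin> K"
  obtains r where "sphere_homotopic id r" "\<And>x. x \<in> K \<Longrightarrow> r x = - u"
proof -
  have hom: "homotopic_with_canon (\<lambda>_. True) K (sphere 0 1) id (\<lambda>_. - u)"
    by (rule homotopic_sphere_nonantipodal) (use K u in \<open>auto intro: continuous_on_id\<close>)
  have clo: "closedin (top_of_set (sphere 0 1)) K"
    using K by (intro closed_subset compact_imp_closed)
  have anr: "ANR (sphere (0::quat) 1)"
    by (rule ANR_sphere)
  have "\<exists>r. sphere_homotopic id r \<and> (\<forall>x\<in>K. r x = - u)"
    by (rule Borsuk_homotopy_extension_homotopic [OF clo disjI2 [OF anr] _ _ hom])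
      (auto intro: continuous_on_id simp del: split_paired_All)
  then show ?thesis
    using that by blast
qed

section \<open>Normal forms of even and odd maps\<close>

lemma even_sphere_map_approx:
  fixes f :: "quat \<Rightarrow> quat"
  assumes f: "continuous_on (sphere 0 1) f" "\<And>x. norm x = 1 \<Longrightarrow> norm (f x) = 1" "even_on_sphere f"
  shows "\<exists>q. polynomial_function q \<and> (\<forall>x\<in>sphere 0 1. q x \<noteq> 0) \<and>
    homotopic_with_canon even_on_sphere (sphere 0 1) (sphere 0 1) f (\<lambda>x. q x /\<^sub>R norm (q x))"
proof -
  obtain p where p: "polynomial_function p" "\<And>x. x \<in> sphere 0 1 \<Longrightarrow> norm (f x - p x) < 1"
    using Stone_Weierstrass_polynomial_function [OF compact_sphere f(1), of 1] by auto
  \<comment> \<open>Averaging over the antipodes makes the polynomial even. Since f is even, the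
    error is averaged as well and stays below 1, and the segments from f to q consist of even
    maps.\<close>
  define q where "q x = (1/2) *\<^sub>R (p x + p (- x))" for x
  have "polynomial_function (\<lambda>x. - x :: quat)"
    by (intro polynomial_function_bounded_linear bounded_linear_minus bounded_linear_ident)
  then have "polynomial_function (\<lambda>x. p (- x))"
    using polynomial_function_compose [OF _ p(1)] by (simp add: o_def)
  then have q: "polynomial_function q"
    unfolding q_def using p(1)
    by (intro polynomial_function_cmul polynomial_function_add)
  have contq: "continuous_on S q" for S
    using continuous_on_polymonial_function [OF q] .
  have even_q: "q (- x) = q x" for x
    by (simp add: q_def add.commute)
  have near: "norm (f x - q x) < 1" if x: "x \<in> sphere 0 1" for x
  proof -
    have "f x - q x = (1/2) *\<^sub>R ((f x - p x) + (f (- x) - p (- x)))"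
      using f(3) x unfolding even_on_sphere_def q_def by (simp add: algebra_simps flip: scaleR_add_left)
    also have "norm \<dots> \<le> (1/2) * (norm (f x - p x) + norm (f (- x) - p (- x)))"
      using norm_triangle_ineq [of "f x - p x" "f (- x) - p (- x)"] by simp
    also have "\<dots> < 1"
      using p(2) [of x] p(2) [of "- x"] x by simp
    finally show ?thesis .
  qed
  have seg: "(1 - t) *\<^sub>R f x + t *\<^sub>R q x \<noteq> 0" if x: "x \<in> sphere 0 1" and t: "0 \<le> t" "t \<le> 1" for x t
  proof
    assume "(1 - t) *\<^sub>R f x + t *\<^sub>R q x = 0"
    then have "f x = t *\<^sub>R (f x - q x)"
      by (simp add: algebra_simps)
    then have "norm (f x) = norm (t *\<^sub>R (f x - q x))"
      by (rule arg_cong)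
    then have "1 = t * norm (f x - q x)"
      using f(2) [of x] x t(1) by (simp only: norm_scaleR abs_of_nonneg mem_sphere_0)
    also have "\<dots> \<le> 1 * norm (f x - q x)"
      using t by (intro mult_right_mono) auto
    finally show False
      using near [OF x] by simp
  qed
  have qnz: "q x \<noteq> 0" if "x \<in> sphere 0 1" for x
    using seg [OF that, of 1] by simp
  define h where "h z = (1 - fst z) *\<^sub>R f (snd z) + fst z *\<^sub>R q (snd z)" for z :: "real \<times> quat"
  have conth: "continuous_on ({0..1} \<times> sphere 0 1) h"
  proof -
    have "continuous_on ({0..1} \<times> sphere 0 1) (\<lambda>z::real \<times> quat. f (snd z))"
      by (rule continuous_on_compose2 [OF f(1)]) (auto intro!: continuous_intros)
    moreover have "continuous_on ({0..1} \<times> sphere 0 1) (\<lambda>z::real \<times> quat. q (snd z))"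
      by (rule continuous_on_compose2 [OF contq [of UNIV]]) (auto intro!: continuous_intros)
    ultimately show ?thesis
      unfolding h_def by (intro continuous_intros)
  qed
  have hnz: "h z \<noteq> 0" if "z \<in> {0..1} \<times> sphere 0 1" for z
    using seg that by (cases z) (auto simp: h_def)
  have "homotopic_with_canon even_on_sphere (sphere 0 1) (sphere 0 1) f (\<lambda>x. q x /\<^sub>R norm (q x))"
  proof (subst homotopic_with [OF even_on_sphere_cong])
    have "continuous_on ({0..1} \<times> sphere 0 1) (\<lambda>z. h z /\<^sub>R norm (h z))"
      using hnz by (intro continuous_intros conth) auto
    then have cont: "continuous_map (prod_topology (top_of_set {0..1}) (top_of_set (sphere 0 1))) (top_of_set (sphere 0 1)) (\<lambda>z. h z /\<^sub>R norm (h z))"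
      using hnz by (auto simp: Pi_iff)
    have even: "even_on_sphere (\<lambda>x. h (t, x) /\<^sub>R norm (h (t, x)))" for t
      using f(3) even_q by (simp add: even_on_sphere_def h_def)
    show "\<exists>h. continuous_map (prod_topology (top_of_set {0..1::real}) (top_of_set (sphere 0 1))) (top_of_set (sphere 0 1)) h \<and>
        (\<forall>x\<in>topspace (top_of_set (sphere 0 1)). h (0, x) = f x) \<and>
        (\<forall>x\<in>topspace (top_of_set (sphere 0 1)). h (1, x) = q x /\<^sub>R norm (q x)) \<and>
        (\<forall>t\<in>{0..1}. even_on_sphere (\<lambda>x. h (t, x)))"
      using cont even f(2) by (intro exI [of _ "\<lambda>z. h z /\<^sub>R norm (h z)"]) (simp add: h_def)
  qed auto
  then show ?thesis
    using q qnz by (intro exI [of _ q] conjI ballI)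
qed

text \<open>After the approximation, evenness at every time comes from the form of the homotopies:
  one deforms the target after the even map g, the other deforms f1 after the even squaring map.
  That squaring is a quotient map supplies the continuous factor f1.\<close>

theorem even_sphere_map_homotopic_qpow:
  fixes f :: "quat \<Rightarrow> quat"
  assumes f: "continuous_on (sphere 0 1) f" "\<And>x. norm x = 1 \<Longrightarrow> norm (f x) = 1" "even_on_sphere f"
  obtains k where "homotopic_with_canon even_on_sphere (sphere 0 1) (sphere 0 1) f (qpow (2 * k))"
proof -
  have "\<exists>q. polynomial_function q \<and> (\<forall>x\<in>sphere 0 1. q x \<noteq> 0) \<and>
    homotopic_with_canon even_on_sphere (sphere 0 1) (sphere 0 1) f (\<lambda>x. q x /\<^sub>R norm (q x))"
    using f by (rule even_sphere_map_approx)
  then obtain q where q: "polynomial_function q" "\<And>x. x \<in> sphere 0 1 \<Longrightarrow> q x \<noteq> 0"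
    and fq: "homotopic_with_canon even_on_sphere (sphere 0 1) (sphere 0 1) f (\<lambda>x. q x /\<^sub>R norm (q x))"
    by auto
  define g where "g x = q x /\<^sub>R norm (q x)" for x
  have g: "continuous_on (sphere 0 1) g" "\<And>x. x \<in> sphere 0 1 \<Longrightarrow> g x \<in> sphere 0 1" "even_on_sphere g"
    using homotopic_with_imp_continuous [OF fq] homotopic_with_imp_funspace2 [OF fq] homotopic_with_imp_property [OF fq]
    by (simp_all add: g_def [abs_def] Pi_iff)
  obtain u where u: "norm u = 1" "\<And>x. x \<in> equator \<Longrightarrow> g x \<noteq> u"
    using polynomial_image_equator_misses_direction [OF q(1)] q(2) equator_subset unfolding g_def by (metis subsetD)
  have "compact (g ` equator)"
    by (intro compact_continuous_image continuous_on_subset [OF g(1)] compact_equator equator_subset)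
  moreover have "g ` equator \<subseteq> sphere 0 1"
    using g(2) equator_subset by blast
  moreover have "u \<notin> g ` equator"
    using u(2) by blast
  ultimately obtain r where r: "sphere_homotopic id r" "\<And>x. x \<in> g ` equator \<Longrightarrow> r x = - u"
    using homotopic_collapse u(1) by metis
  define g' where "g' = r \<circ> g"
  have "homotopic_with_canon even_on_sphere (sphere 0 1) (sphere 0 1) (id \<circ> g) (r \<circ> g)"
    by (rule homotopic_with_compose_continuous_map_right [OF r(1)])
      (use g in \<open>simp_all add: even_on_sphere_def Pi_iff\<close>)
  then have gg': "homotopic_with_canon even_on_sphere (sphere 0 1) (sphere 0 1) g g'"
    by (simp add: g'_def)
  then have contg': "continuous_map (top_of_set (sphere 0 1)) (top_of_set (sphere 0 1)) g'" and even: "even_on_sphere g'"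
    using homotopic_with_imp_continuous_maps homotopic_with_imp_property by blast+
  have "g' x = g' y" if xy: "x \<in> topspace (top_of_set (sphere 0 1))" "y \<in> topspace (top_of_set (sphere 0 1))"
    "x *\<^sub>q x = y *\<^sub>q y" for x y
  proof -
    consider "x = y" | "x = - y" | "x \<in> equator" "y \<in> equator"
      using qmul_self_eqD [of x y] xy by auto
    then show ?thesis
    proof cases
      case 2
      then show ?thesis
        using even xy by (simp add: even_on_sphere_def)
    next
      case 3
      then show ?thesis
        using r(2) by (simp add: g'_def)
    qed simp
  qed
  then obtain f1 where f1: "continuous_map (top_of_set (sphere 0 1)) (top_of_set (sphere 0 1)) f1"
    "\<And>x. x \<in> topspace (top_of_set (sphere 0 1)) \<Longrightarrow> f1 (x *\<^sub>q x) = g' x"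
    using quotient_map_lift_exists [OF quotient_map_qmul_self contg'] by metis
  have "continuous_on (sphere 0 1) f1" "\<And>x. norm x = 1 \<Longrightarrow> norm (f1 x) = 1"
    using f1(1) by (simp_all add: Pi_iff)
  then obtain k where k: "sphere_homotopic f1 (qpow k)"
    by (rule sphere_map_homotopic_qpow)
  have "homotopic_with_canon even_on_sphere (sphere 0 1) (sphere 0 1) (f1 \<circ> (\<lambda>x. x *\<^sub>q x)) (qpow k \<circ> (\<lambda>x. x *\<^sub>q x))"
    by (rule homotopic_with_compose_continuous_map_right [OF k])
      (use quotient_imp_continuous_map [OF quotient_map_qmul_self] in \<open>simp_all add: even_on_sphere_def qmul.minus_left qmul.minus_right\<close>)
  then have "homotopic_with_canon even_on_sphere (sphere 0 1) (sphere 0 1) g' (qpow (2 * k))"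
  proof (rule homotopic_with_eq)
    fix x :: quat assume x: "x \<in> topspace (top_of_set (sphere 0 1))"
    then have "x \<noteq> 0" by auto
    then have "qpow 2 x = x *\<^sub>q x"
      using qpow_succ [of x 1] by simp
    then show "qpow (2 * k) x = (qpow k \<circ> (\<lambda>x. x *\<^sub>q x)) x"
      using qpow_mult [OF \<open>x \<noteq> 0\<close>, of 2 k] by simp
    show "g' x = (f1 \<circ> (\<lambda>x. x *\<^sub>q x)) x"
      using f1(2) [OF x] by simp
  next
    fix h k :: "quat \<Rightarrow> quat"
    assume "\<And>x. x \<in> topspace (top_of_set (sphere 0 1)) \<Longrightarrow> h x = k x"
    then show "even_on_sphere h = even_on_sphere k"
      by (intro even_on_sphere_cong) simp
  qed
  with fq gg' show ?thesis
    unfolding g_def [abs_def, symmetric] by (meson homotopic_with_trans that)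
qed

theorem odd_sphere_map_homotopic_qpow:
  fixes f :: "quat \<Rightarrow> quat"
  assumes f: "continuous_on (sphere 0 1) f" "\<And>x. norm x = 1 \<Longrightarrow> norm (f x) = 1" "odd_on_sphere f"
  obtains k where "homotopic_with_canon odd_on_sphere (sphere 0 1) (sphere 0 1) f (qpow (2 * k + 1))"
proof -
  define g where "g x = f x *\<^sub>q qinv x" for x
  have "continuous_on (sphere 0 1) g"
    unfolding g_def by (intro continuous_intros f) auto
  moreover have "norm (g x) = 1" if "norm x = 1" for x
    using f(2) [OF that] that by (simp add: g_def norm_qmul norm_qinv)
  moreover have "even_on_sphere g"
    using f(3) by (simp add: even_on_sphere_def odd_on_sphere_def g_def qinv_minus qmul.minus_left qmul.minus_right)
  ultimately obtain k where k: "homotopic_with_canon even_on_sphere (sphere 0 1) (sphere 0 1) g (qpow (2 * k))"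
    by (rule even_sphere_map_homotopic_qpow)
  have "homotopic_with_canon odd_on_sphere (sphere 0 1) (sphere 0 1) (\<lambda>x. x) (\<lambda>x. x)"
    by (simp add: odd_on_sphere_def continuous_on_id)
  then have "homotopic_with_canon odd_on_sphere (sphere 0 1) (sphere 0 1) (\<lambda>x. g x *\<^sub>q x) (\<lambda>x. qpow (2 * k) x *\<^sub>q x)"
    by (rule homotopic_with_qmul [OF k])
      (simp_all add: norm_qmul even_on_sphere_def odd_on_sphere_def qmul.minus_right)
  then have "homotopic_with_canon odd_on_sphere (sphere 0 1) (sphere 0 1) f (qpow (2 * k + 1))"
  proof (rule homotopic_with_eq)
    fix x :: quat assume "x \<in> topspace (top_of_set (sphere 0 1))"
    then have x: "x \<noteq> 0" by auto
    show "f x = g x *\<^sub>q x"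
      using x by (simp add: g_def qmul_assoc qinv_left)
    show "qpow (2 * k + 1) x = qpow (2 * k) x *\<^sub>q x"
      using x by (rule qpow_succ)
  next
    fix h k :: "quat \<Rightarrow> quat"
    assume "\<And>x. x \<in> topspace (top_of_set (sphere 0 1)) \<Longrightarrow> h x = k x"
    then show "odd_on_sphere h = odd_on_sphere k"
      by (intro odd_on_sphere_cong) simp
  qed
  then show ?thesis
    by (rule that)
qed

section \<open>Projective space\<close>

lemma circle_orbit_eq: "circle_orbit z = {(c, 0) *\<^sub>q z | c. cmod c = 1}"
  by (simp add: circle_orbit_def complex_qmul)

lemma hopf_model_circle_orbit: "w \<in> circle_orbit z \<Longrightarrow> hopf_model w = hopf_model z"
  by (auto simp: circle_orbit_eq hopf_model_complex_qmul)

lemma circle_orbit_eq_iff: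
  assumes "norm z = 1" "norm w = 1"
  shows "circle_orbit z = circle_orbit w \<longleftrightarrow> hopf_model z = hopf_model w"
proof
  have "z \<in> circle_orbit z"
    unfolding circle_orbit_eq by (rule CollectI) (rule exI [of _ 1], simp add: complex_qmul)
  then show "hopf_model z = hopf_model w" if "circle_orbit z = circle_orbit w"
    using that hopf_model_circle_orbit by blast
next
  have sub: "circle_orbit z \<subseteq> circle_orbit w"
    if "norm z = 1" "norm w = 1" "hopf_model z = hopf_model w" for z w
  proof
    fix x assume "x \<in> circle_orbit z"
    then obtain c where c: "cmod c = 1" "x = (c, 0) *\<^sub>q z"
      by (auto simp: circle_orbit_eq)
    have "x = (c * herm z w, 0) *\<^sub>q w"
      using arg_cong [OF hopf_model_eqD(1) [OF that], of "qmul (c, 0)"] c(2) by (simp add: complex_qmul mult.assoc)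
    moreover have "cmod (c * herm z w) = 1"
      using hopf_model_eqD(2) [OF that] c(1) by (simp add: norm_mult)
    ultimately show "x \<in> circle_orbit w"
      unfolding circle_orbit_eq by blast
  qed
  show "circle_orbit z = circle_orbit w" if "hopf_model z = hopf_model w"
    using sub [of z w] sub [of w z] assms that by simp
qed

lemma quotient_map_hopf_model: "quotient_map S3 (top_of_set hopf_base) hopf_model"
proof (rule continuous_imp_quotient_map)
  show "continuous_map S3 (top_of_set hopf_base) hopf_model"
    unfolding S3_eq_sphere by (auto intro!: continuous_intros)
  show "compact_space S3"
    unfolding S3_eq_sphere by (simp add: compact_space_subtopology)
  show "Hausdorff_space (top_of_set hopf_base)"
    by (simp add: Hausdorff_space_subtopology)
qed (simp add: S3_eq_sphere)

text \<open>Both spaces are quotients of S^3 by maps with the same fibres, so each projection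
  factors through the other.\<close>

lemma hopf_base_homeomorphic_CP1:
  obtains \<alpha> \<beta> where "continuous_map (top_of_set hopf_base) CP1 \<alpha>" "continuous_map CP1 (top_of_set hopf_base) \<beta>"
    "\<And>z. norm z = 1 \<Longrightarrow> \<alpha> (hopf_model z) = circle_orbit z" "\<And>z. norm z = 1 \<Longrightarrow> \<beta> (circle_orbit z) = hopf_model z"
proof -
  have qc: "quotient_map S3 CP1 circle_orbit"
    unfolding CP1_def by (rule quotient_map_quotient_topology)
  have top: "x \<in> topspace S3 \<longleftrightarrow> norm x = 1" for x
    by (simp add: S3_eq_sphere)
  have fib: "circle_orbit z = circle_orbit w \<longleftrightarrow> hopf_model z = hopf_model w"
    if "z \<in> topspace S3" "w \<in> topspace S3" for z w
    using that unfolding top by (rule circle_orbit_eq_iff)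
  obtain \<alpha> where \<alpha>: "continuous_map (top_of_set hopf_base) CP1 \<alpha>" "\<And>z. z \<in> topspace S3 \<Longrightarrow> \<alpha> (hopf_model z) = circle_orbit z"
    by (rule quotient_map_lift_exists [OF quotient_map_hopf_model quotient_imp_continuous_map [OF qc]],
        simp only: fib, rule that)
  obtain \<beta> where \<beta>: "continuous_map CP1 (top_of_set hopf_base) \<beta>" "\<And>z. z \<in> topspace S3 \<Longrightarrow> \<beta> (circle_orbit z) = hopf_model z"
    by (rule quotient_map_lift_exists [OF qc quotient_imp_continuous_map [OF quotient_map_hopf_model]],
        simp only: fib, rule that)
  show ?thesis
    by (rule that [of \<alpha> \<beta>]) (use \<alpha> \<beta> top in simp_all)
qed

text \<open>The arbitrary identification \<phi> is absorbed into \<psi>, so that on S^3 the Hopf map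
  becomes \<psi> after the concrete \<open>hopf_model\<close>.\<close>

lemma S2_model:
  assumes "homeomorphic_map CP1 S2 \<phi>"
  obtains \<psi> \<psi>' where "continuous_map (top_of_set hopf_base) S2 \<psi>" "continuous_map S2 (top_of_set hopf_base) \<psi>'"
    "\<And>z. norm z = 1 \<Longrightarrow> \<psi> (hopf_model z) = \<phi> (circle_orbit z)"
    "\<And>y. y \<in> hopf_base \<Longrightarrow> \<psi>' (\<psi> y) = y" "\<And>y. y \<in> topspace S2 \<Longrightarrow> \<psi> (\<psi>' y) = y"
proof -
  obtain \<alpha> \<beta> where \<alpha>: "continuous_map (top_of_set hopf_base) CP1 \<alpha>" "\<And>z. norm z = 1 \<Longrightarrow> \<alpha> (hopf_model z) = circle_orbit z"
    and \<beta>: "continuous_map CP1 (top_of_set hopf_base) \<beta>" "\<And>z. norm z = 1 \<Longrightarrow> \<beta> (circle_orbit z) = hopf_model z"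
    by (rule hopf_base_homeomorphic_CP1) (rule that)
  obtain \<phi>' where "homeomorphic_maps CP1 S2 \<phi> \<phi>'"
    using assms unfolding homeomorphic_map_maps by blast
  then have \<phi>: "continuous_map CP1 S2 \<phi>" "continuous_map S2 CP1 \<phi>'"
    "\<And>x. x \<in> topspace CP1 \<Longrightarrow> \<phi>' (\<phi> x) = x" "\<And>y. y \<in> topspace S2 \<Longrightarrow> \<phi> (\<phi>' y) = y"
    unfolding homeomorphic_maps_def by blast+
  have CP1: "topspace CP1 = circle_orbit ` sphere 0 1"
    by (simp add: CP1_def topspace_quotient_topology S3_eq_sphere)
  have \<alpha>\<beta>: "\<alpha> (\<beta> A) = A" if A: "A \<in> topspace CP1" for A
  proof -
    obtain z where "norm z = 1" "A = circle_orbit z"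
      using A unfolding CP1 by force
    then show ?thesis
      using \<alpha>(2) \<beta>(2) by simp
  qed
  show ?thesis
  proof (rule that)
    show "continuous_map (top_of_set hopf_base) S2 (\<phi> \<circ> \<alpha>)"
      by (rule continuous_map_compose [OF \<alpha>(1) \<phi>(1)])
    show "continuous_map S2 (top_of_set hopf_base) (\<beta> \<circ> \<phi>')"
      by (rule continuous_map_compose [OF \<phi>(2) \<beta>(1)])
    show "(\<phi> \<circ> \<alpha>) (hopf_model z) = \<phi> (circle_orbit z)" if "norm z = 1" for z
      using \<alpha>(2) [OF that] by simp
    show "(\<beta> \<circ> \<phi>') ((\<phi> \<circ> \<alpha>) y) = y" if y: "y \<in> hopf_base" for y
    proof -
      obtain z where z: "norm z = 1" "y = hopf_model z"
        using y by auto
      have "circle_orbit z \<in> topspace CP1"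
        using z by (auto simp: CP1)
      then show ?thesis
        using \<alpha>(2) [OF z(1)] \<beta>(2) [OF z(1)] \<phi>(3) z(2) by simp
    qed
    show "(\<phi> \<circ> \<alpha>) ((\<beta> \<circ> \<phi>') y) = y" if "y \<in> topspace S2" for y
    proof -
      have "\<phi>' y \<in> topspace CP1"
        using continuous_map_funspace [OF \<phi>(2)] that by (rule funcset_mem)
      then show ?thesis
        using \<alpha>\<beta> \<phi>(4) [OF that] by simp
    qed
  qed
qed

section \<open>Homotopies on projective space\<close>

lemma quotient_map_proj3: "quotient_map S3 RP3 proj3"
  unfolding RP3_def by (rule quotient_map_quotient_topology)

lemma proj3_eq_iff: "proj3 x = proj3 y \<longleftrightarrow> x = y \<or> x = - y"
  by (auto simp: proj3_def doubleton_eq_iff)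

lemma proj3_minus: "proj3 (- x) = proj3 x"
  by (auto simp: proj3_def)

text \<open>The product of \<open>proj3\<close> with the identity of the interval is again a
  quotient map, because the interval is locally compact and Hausdorff. A homotopy through even maps
  is constant on its fibres and hence descends.\<close>

lemma homotopic_RP3:
  assumes hom: "homotopic_with even_on_sphere S3 Y (f \<circ> proj3) (g \<circ> proj3)"
  shows "homotopic_with (\<lambda>_. True) RP3 Y f g"
proof -
  let ?I = "top_of_set {0..1::real}"
  obtain h where h: "continuous_map (prod_topology ?I S3) Y h" "\<And>x. h (0, x) = f (proj3 x)" "\<And>x. h (1, x) = g (proj3 x)"
    "\<And>t. t \<in> {0..1} \<Longrightarrow> even_on_sphere (\<lambda>x. h (t, x))"
    using hom unfolding homotopic_with_def by auto
  have quot: "quotient_map (prod_topology ?I S3) (prod_topology ?I RP3) (\<lambda>(t, x). (t, proj3 x))"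
    by (rule quotient_map_prod_right [OF _ _ quotient_map_proj3])
      (simp_all add: compact_imp_locally_compact_space compact_space_subtopology Hausdorff_space_subtopology)
  have fib: "h p = h q" if pq: "p \<in> topspace (prod_topology ?I S3)" "q \<in> topspace (prod_topology ?I S3)"
    "(\<lambda>(t, x). (t, proj3 x)) p = (\<lambda>(t, x). (t, proj3 x)) q" for p q
  proof -
    obtain t x s y where "p = (t, x)" "q = (s, y)"
      by (metis surj_pair)
    with pq have *: "p = (t, x)" "q = (t, y)" "t \<in> {0..1}" "norm x = 1" "x = y \<or> x = - y"
      by (auto simp: S3_eq_sphere proj3_eq_iff)
    then show ?thesis
      using h(4) [OF *(3)] by (auto simp: even_on_sphere_def)
  qed
  obtain k where k: "continuous_map (prod_topology ?I RP3) Y k"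
    "\<And>p. p \<in> topspace (prod_topology ?I S3) \<Longrightarrow> k ((\<lambda>(t, x). (t, proj3 x)) p) = h p"
    by (rule quotient_map_lift_exists [OF quot h(1)], rule fib, assumption+, rule that)
  have RP3: "topspace RP3 = proj3 ` topspace S3"
    by (simp add: RP3_def topspace_quotient_topology)
  have "k (t, proj3 x) = h (t, x)" if "t \<in> {0..1}" "x \<in> topspace S3" for t x
    using k(2) [of "(t, x)"] that by simp
  then show ?thesis
    by (subst homotopic_with) (use k(1) h(2,3) in \<open>auto simp: RP3 intro!: exI [of _ k]\<close>)
qed

theorem theorem3p1:
  fixes \<phi> :: "(complex \<times> complex) set \<Rightarrow> real ^ 3"
    and \<theta> :: "(complex \<times> complex) set set \<Rightarrow> complex \<times> complex"
    and \<omega>S :: "(complex \<times> complex) chain set"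
    and \<omega>P :: "(complex \<times> complex) set chain set"
    and d :: "int \<Rightarrow> complex \<times> complex \<Rightarrow> complex \<times> complex"
    and c :: "real ^ 3"
  assumes "homeomorphic_map CP1 S2 \<phi>"
    and "homeomorphic_map (collapse RP3 RP2) S3 \<theta>"
    and "fundamental_class 3 S3 \<omega>S"
    and "fundamental_class 3 RP3 \<omega>P"
    and "has_degree 3 RP3 \<omega>P S3 \<omega>S (q3 \<theta>) 1"
    and "has_degree 3 S3 \<omega>S S3 \<omega>S (q3 \<theta> \<circ> proj3) 2"
    and "\<And>m. has_degree 3 S3 \<omega>S S3 \<omega>S (d m) m"
    and "c \<in> topspace S2"
  shows "homotopy_classes RP3 S2 = {homotopy_class RP3 S2 (h'_seq \<phi> \<theta> d c n) | n. True} \<and>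
         bij_betw (precomp_class S3 S2 proj3) (homotopy_classes RP3 S2) (homotopy_classes S3 S2)"
proof -
  let ?S = "sphere (0::quat) 1"
  let ?h = "h'_seq \<phi> \<theta> d c"
  note \<omega> = assms(3)
  obtain \<psi> \<psi>' where cont\<psi>: "continuous_map (top_of_set hopf_base) S2 \<psi>"
    and cont\<psi>': "continuous_map S2 (top_of_set hopf_base) \<psi>'"
    and \<psi>: "\<And>z. norm z = 1 \<Longrightarrow> \<psi> (hopf_model z) = \<phi> (circle_orbit z)"
    and \<psi>'\<psi>: "\<And>y. y \<in> hopf_base \<Longrightarrow> \<psi>' (\<psi> y) = y" and \<psi>\<psi>': "\<And>y. y \<in> topspace S2 \<Longrightarrow> \<psi> (\<psi>' y) = y"
    by (rule S2_model [OF assms(1)]) (rule that)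
  have cont_hopf: "continuous_map S3 (top_of_set hopf_base) hopf_model"
    by (rule quotient_imp_continuous_map [OF quotient_map_hopf_model])
  \<comment> \<open>Only the parity of the index matters; writing it as an exponent lets the
    property travel with x^n.\<close>
  define PR :: "int \<Rightarrow> (quat \<Rightarrow> quat) \<Rightarrow> bool" where
    "PR n = (if even n then even_on_sphere else odd_on_sphere)" for n
  \<comment> \<open>Antipodal points have the same Hopf image, so odd lifts as well as even ones
    induce even maps to S^2.\<close>
  have PR_hopf: "even_on_sphere (\<lambda>x. \<psi> (hopf_model (j x)))" if "PR n j" for n j
    using that by (auto simp: PR_def even_on_sphere_def odd_on_sphere_def hopf_model_minus split: if_splits)
  have true: "sphere_homotopic f g" if "homotopic_with_canon (PR n) ?S ?S f g" for n f g
    by (rule homotopic_with_mono [OF that]) simp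
  have classify: "\<exists>k. (even k \<longleftrightarrow> even n) \<and> homotopic_with_canon (PR n) ?S ?S G (qpow k)"
    if G: "continuous_on ?S G" "\<And>x. norm x = 1 \<Longrightarrow> norm (G x) = 1" "PR n G" for n G
  proof (cases "even n")
    case True
    then have "even_on_sphere G"
      using G(3) by (simp add: PR_def)
    with G(1,2) obtain k where "homotopic_with_canon even_on_sphere ?S ?S G (qpow (2 * k))"
      by (rule even_sphere_map_homotopic_qpow)
    with True show ?thesis
      by (intro exI [of _ "2 * k"]) (simp add: PR_def)
  next
    case False
    then have "odd_on_sphere G"
      using G(3) by (simp add: PR_def)
    with G(1,2) obtain k where "homotopic_with_canon odd_on_sphere ?S ?S G (qpow (2 * k + 1))"
      by (rule odd_sphere_map_homotopic_qpow)
    with False show ?thesis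
      by (intro exI [of _ "2 * k + 1"]) (simp add: PR_def)
  qed
  \<comment> \<open>This upgrades a free homotopy to one that keeps parity: the classification
    yields some x^k through maps of the parity of G, and degree forces k = n.\<close>
  have refine: "homotopic_with_canon (PR n) ?S ?S G (qpow n)"
    if G: "PR n G" and hom: "sphere_homotopic G (qpow n)" for n G
  proof -
    obtain k where k: "homotopic_with_canon (PR n) ?S ?S G (qpow k)"
      using classify [of G n] sphere_homotopic_imp_maps [OF hom] G by blast
    have "sphere_homotopic (qpow k) (qpow n)"
      using true [OF k] hom homotopic_with_symD homotopic_with_trans by blast
    then have "k = n"
      by (rule sphere_homotopic_qpow_imp_eq [OF \<omega>])
    with k show ?thesis by simp
  qed
  \<comment> \<open>Each h'_n, pulled back to S^3, acquires a lift of the parity of n whose exponent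
    is n. Everything after this works with the powers x^n alone.\<close>
  have rep: "\<exists>G. homotopic_with_canon (PR n) ?S ?S G (qpow n) \<and>
      (\<forall>x\<in>?S. ?h n (proj3 x) = \<psi> (hopf_model (G x)))" for n
  proof -
    consider "n = 0" | m where "n = 2 * m" "m \<noteq> 0" | "odd n"
      by (metis evenE mult_zero_right)
    then show ?thesis
    proof cases
      case 1
      have "\<psi>' c \<in> hopf_base"
        using continuous_map_funspace [OF cont\<psi>'] assms(8) by auto
      then obtain z where z: "norm z = 1" "hopf_model z = \<psi>' c"
        by auto
      have "path_connected ?S"
        by (rule path_connected_sphere) simp
      then have "path_component ?S z qone"
        using z(1) by (simp add: path_connected_component)
      then have "sphere_homotopic (\<lambda>_. z) (\<lambda>_. qone)"
        by (simp add: homotopic_constant_maps)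
      \<comment> \<open>Precomposing with a constant map makes every stage constant and thus
        even.\<close>
      then have "homotopic_with_canon (PR 0) ?S ?S ((\<lambda>_. z) \<circ> (\<lambda>_. qone)) ((\<lambda>_. qone) \<circ> (\<lambda>_. qone))"
        by (rule homotopic_with_compose_continuous_map_right) (simp_all add: PR_def even_on_sphere_def)
      moreover have "\<psi> (hopf_model z) = c"
        using z(2) \<psi>\<psi>' assms(8) by simp
      ultimately show ?thesis
        using 1 by (intro exI [of _ "\<lambda>_. z"]) (simp add: h'_seq_def o_def qpow_def [abs_def])
    next
      case 2
      define Q where "Q = q3 \<theta> \<circ> proj3"
      have Q: "continuous_map S3 S3 Q" "hom_induced 3 S3 {} S3 {} Q \<omega>S = \<omega>S [^]\<^bsub>homology_group 3 S3\<^esub> (2::int)"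
        using assms(6) by (auto simp: has_degree_def Q_def)
      have d: "continuous_map S3 S3 (d m)" "hom_induced 3 S3 {} S3 {} (d m) \<omega>S = \<omega>S [^]\<^bsub>homology_group 3 S3\<^esub> m"
        using assms(7) [of m] by (auto simp: has_degree_def)
      \<comment> \<open>The degree 2 of Q, collapsing after the double covering, is multiplied by
        the degree m of \<open>d m\<close>. The composite is even because \<open>proj3\<close>
        is.\<close>
      have deg: "has_degree 3 S3 \<omega>S S3 \<omega>S (d m \<circ> Q) n"
        unfolding has_degree_def
      proof
        show "continuous_map S3 S3 (d m \<circ> Q)"
          by (rule continuous_map_compose [OF Q(1) d(1)])
        interpret H: group "homology_group 3 S3"
          by simp
        interpret group_hom "homology_group 3 S3" "homology_group 3 S3" "hom_induced 3 S3 {} S3 {} (d m)"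
          by (simp add: group_hom_def group_hom_axioms_def hom_induced_hom)
        have \<omega>c: "\<omega>S \<in> carrier (homology_group 3 S3)"
          using \<omega> by (simp add: fundamental_class_def)
        have "hom_induced 3 S3 {} S3 {} (d m \<circ> Q) \<omega>S = hom_induced 3 S3 {} S3 {} (d m) (hom_induced 3 S3 {} S3 {} Q \<omega>S)"
          using hom_induced_compose' [OF Q(1) _ d(1), of "{}" "{}" "{}" 3 \<omega>S] by simp
        also have "\<dots> = (\<omega>S [^]\<^bsub>homology_group 3 S3\<^esub> m) [^]\<^bsub>homology_group 3 S3\<^esub> (2::int)"
          using hom_int_pow [OF \<omega>c, of 2] by (simp add: Q(2) d(2))
        also have "\<dots> = \<omega>S [^]\<^bsub>homology_group 3 S3\<^esub> n"
          using \<omega>c 2 by (simp add: H.int_pow_pow mult.commute)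
        finally show "hom_induced (int 3) S3 {} S3 {} (d m \<circ> Q) \<omega>S = \<omega>S [^]\<^bsub>homology_group (int 3) S3\<^esub> n"
          by simp
      qed
      have "homotopic_with_canon (PR n) ?S ?S (d m \<circ> Q) (qpow n)"
      proof (rule refine)
        show "PR n (d m \<circ> Q)"
          using 2 by (simp add: PR_def even_on_sphere_def Q_def proj3_minus)
      qed (rule homotopic_qpow_of_degree [OF \<omega> deg])
      moreover have "?h n (proj3 x) = \<psi> (hopf_model ((d m \<circ> Q) x))" if "x \<in> ?S" for x
      proof -
        have "norm ((d m \<circ> Q) x) = 1"
          using continuous_map_funspace [OF continuous_map_compose [OF Q(1) d(1)]] that
          by (auto simp: S3_eq_sphere Pi_iff)
        then show ?thesis
          using 2 by (simp add: h'_seq_def hopf_def \<psi> Q_def)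
      qed
      ultimately show ?thesis by blast
    next
      case 3
      then have "n \<noteq> 0" by auto
      have hom: "sphere_homotopic (power_map n) (qpow n)"
        by (rule power_map_homotopic_qpow [OF \<open>n \<noteq> 0\<close>])
      have "homotopic_with_canon (PR n) ?S ?S (power_map n) (qpow n)"
        using 3 by (intro refine hom) (simp add: PR_def odd_on_sphere_def power_map_minus)
      moreover have "?h n (proj3 x) = \<psi> (hopf_model (power_map n x))" if "x \<in> ?S" for x
        using 3 \<open>n \<noteq> 0\<close> that sphere_homotopic_imp_maps(2) [OF hom, of x]
        by (simp add: h'_seq_def power_map'_proj3 hprime_proj3 \<psi>)
      ultimately show ?thesis by blast
    qed
  qed
  have \<psi>hopf: "homotopic_with Q S3 S2 (\<lambda>x. \<psi> (hopf_model (G x))) (\<lambda>x. \<psi> (hopf_model (G' x)))"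
    if "homotopic_with_canon P ?S ?S G G'" "\<And>j. P j \<Longrightarrow> Q (\<lambda>x. \<psi> (hopf_model (j x)))" for P Q G G'
    using homotopic_with_compose_continuous_map_left [of P S3 S3 G G' S2 "\<psi> \<circ> hopf_model" Q]
      continuous_map_compose [OF cont_hopf cont\<psi>] that
    by (simp add: o_def S3_eq_sphere)
  have cont_h: "continuous_map RP3 S2 (?h n)" for n
  proof -
    obtain G where G: "homotopic_with_canon (PR n) ?S ?S G (qpow n)"
      "\<And>x. x \<in> ?S \<Longrightarrow> ?h n (proj3 x) = \<psi> (hopf_model (G x))"
      using rep by blast
    have "homotopic_with (\<lambda>_. True) S3 S2 (\<lambda>x. \<psi> (hopf_model (G x))) (\<lambda>x. \<psi> (hopf_model (qpow n x)))"
      by (rule \<psi>hopf [OF G(1)]) simp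
    then have "continuous_map S3 S2 (\<lambda>x. \<psi> (hopf_model (G x)))"
      using homotopic_with_imp_continuous_maps by blast
    then have "continuous_map S3 S2 (?h n \<circ> proj3)"
      by (rule continuous_map_eq) (use G(2) in \<open>simp add: S3_eq_sphere\<close>)
    then show ?thesis
      by (rule continuous_compose_quotient_map [OF quotient_map_proj3])
  qed
  \<comment> \<open>A lift of f after \<open>proj3\<close> and a lift of h'_n with the same normal
    form are joined by maps of one parity; their Hopf images are even at every time, so the homotopy
    descends to RP^3.\<close>
  have cover: "\<exists>n. homotopic_with (\<lambda>_. True) RP3 S2 f (?h n)" if f: "continuous_map RP3 S2 f" for f
  proof -
    define F where "F x = \<psi>' (f (proj3 x))" for x
    have contF: "continuous_map S3 (top_of_set hopf_base) F"
      using continuous_map_compose [OF continuous_map_compose [OF continuous_map_proj3 f] cont\<psi>'] by (simp add: o_def F_def [abs_def])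
    have fp: "f (proj3 x) \<in> topspace S2" if "x \<in> ?S" for x
      using continuous_map_funspace [OF continuous_map_compose [OF continuous_map_proj3 f]] that by (auto simp: S3_eq_sphere)
    have 1: "continuous_on ?S F" and 2: "\<And>x. norm x = 1 \<Longrightarrow> F x \<in> hopf_base"
      using contF by (auto simp: S3_eq_sphere Pi_iff)
    have 3: "\<And>x. norm x = 1 \<Longrightarrow> F (- x) = F x"
      by (simp add: F_def proj3_minus)
    obtain G where G: "continuous_on ?S G" "\<And>x. norm x = 1 \<Longrightarrow> norm (G x) = 1"
      "\<And>x. norm x = 1 \<Longrightarrow> hopf_model (G x) = F x"
      "(\<forall>x\<in>?S. G (- x) = G x) \<or> (\<forall>x\<in>?S. G (- x) = - G x)"
      by (rule hopf_lift_even [OF 1 2 3], assumption+, rule that)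
    \<comment> \<open>Here 0 and 1 only name the two parities; the exponent n found next shares the
      parity chosen here.\<close>
    have "PR 0 G \<or> PR 1 G"
      using G(4) by (simp add: PR_def even_on_sphere_def odd_on_sphere_def)
    then obtain n0 where n0: "PR n0 G"
      by blast
    obtain n where n: "even n \<longleftrightarrow> even n0" "homotopic_with_canon (PR n0) ?S ?S G (qpow n)"
      using classify [OF G(1,2) n0] by blast
    have "PR n0 = PR n"
      using n(1) by (simp add: PR_def)
    obtain G' where G': "homotopic_with_canon (PR n) ?S ?S G' (qpow n)"
      "\<And>x. x \<in> ?S \<Longrightarrow> ?h n (proj3 x) = \<psi> (hopf_model (G' x))"
      using rep by blast
    have "homotopic_with_canon (PR n) ?S ?S G G'"
      using n(2) G'(1) homotopic_with_symD homotopic_with_trans unfolding \<open>PR n0 = PR n\<close> by blast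
    then have "homotopic_with even_on_sphere S3 S2 (\<lambda>x. \<psi> (hopf_model (G x))) (\<lambda>x. \<psi> (hopf_model (G' x)))"
      by (rule \<psi>hopf) (rule PR_hopf)
    then have "homotopic_with even_on_sphere S3 S2 (f \<circ> proj3) (?h n \<circ> proj3)"
    proof (rule homotopic_with_eq)
      fix x assume "x \<in> topspace S3"
      then have x: "x \<in> ?S"
        by (simp add: S3_eq_sphere)
      show "(f \<circ> proj3) x = \<psi> (hopf_model (G x))"
        using G(3) [of x] x \<psi>\<psi>' [OF fp [OF x]] by (simp add: F_def)
      show "(?h n \<circ> proj3) x = \<psi> (hopf_model (G' x))"
        using G'(2) [OF x] by simp
    next
      fix h k :: "quat \<Rightarrow> real ^ 3"
      assume "\<And>x. x \<in> topspace S3 \<Longrightarrow> h x = k x"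
      then show "even_on_sphere h = even_on_sphere k"
        by (intro even_on_sphere_cong) (simp add: S3_eq_sphere)
    qed
    then show ?thesis
      by (intro exI homotopic_RP3)
  qed
  \<comment> \<open>Free homotopies on S^3 already separate the indices: lifting through the Hopf
    map returns to the powers x^n and x^m. This gives injectivity on classes as well as distinctness
    of the h'_n.\<close>
  have inj: "n = m" if nm: "homotopic_with (\<lambda>_. True) S3 S2 (?h n \<circ> proj3) (?h m \<circ> proj3)" for n m
  proof -
    obtain G where G: "homotopic_with_canon (PR n) ?S ?S G (qpow n)"
      "\<And>x. x \<in> ?S \<Longrightarrow> ?h n (proj3 x) = \<psi> (hopf_model (G x))"
      using rep by blast
    obtain G' where G': "homotopic_with_canon (PR m) ?S ?S G' (qpow m)"
      "\<And>x. x \<in> ?S \<Longrightarrow> ?h m (proj3 x) = \<psi> (hopf_model (G' x))"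
      using rep by blast
    note GS = sphere_homotopic_imp_maps [OF true [OF G(1)]]
    note GS' = sphere_homotopic_imp_maps [OF true [OF G'(1)]]
    have "homotopic_with (\<lambda>_. True) S3 (top_of_set hopf_base) (\<psi>' \<circ> (?h n \<circ> proj3)) (\<psi>' \<circ> (?h m \<circ> proj3))"
      by (rule homotopic_with_compose_continuous_map_left [OF nm cont\<psi>']) simp
    then have "homotopic_with_canon (\<lambda>_. True) ?S hopf_base (\<lambda>x. hopf_model (G x)) (\<lambda>x. hopf_model (G' x))"
      unfolding S3_eq_sphere
      by (rule homotopic_with_eq) (use G(2) G'(2) \<psi>'\<psi> GS(2) GS'(2) in \<open>simp_all\<close>)
    with GS(1,2) GS'(1,2) have "sphere_homotopic G G'"
      by (rule hopf_homotopic_imp_homotopic)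
    then have "sphere_homotopic (qpow n) (qpow m)"
      using true [OF G(1)] true [OF G'(1)] homotopic_with_symD homotopic_with_trans by blast
    then show ?thesis
      by (rule sphere_homotopic_qpow_imp_eq [OF \<omega>])
  qed
  \<comment> \<open>On S^3 any lift will do, since the homotopy to the lift of h'_n may forget
    parity.\<close>
  have surj: "\<exists>n. homotopic_with (\<lambda>_. True) S3 S2 F (?h n \<circ> proj3)" if F: "continuous_map S3 S2 F" for F
  proof -
    have "continuous_map S3 (top_of_set hopf_base) (\<lambda>x. \<psi>' (F x))"
      using continuous_map_compose [OF F cont\<psi>'] by (simp add: o_def)
    then have 1: "continuous_on ?S (\<lambda>x. \<psi>' (F x))" and 2: "\<And>x. norm x = 1 \<Longrightarrow> \<psi>' (F x) \<in> hopf_base"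
      by (auto simp: S3_eq_sphere Pi_iff)
    obtain G where G: "continuous_on ?S G" "\<And>x. norm x = 1 \<Longrightarrow> norm (G x) = 1"
      "\<And>x. norm x = 1 \<Longrightarrow> hopf_model (G x) = \<psi>' (F x)"
      by (rule hopf_lift_sphere [OF 1 2], assumption+, rule that)
    obtain n where n: "sphere_homotopic G (qpow n)"
      using G(1,2) by (rule sphere_map_homotopic_qpow)
    obtain G' where G': "homotopic_with_canon (PR n) ?S ?S G' (qpow n)"
      "\<And>x. x \<in> ?S \<Longrightarrow> ?h n (proj3 x) = \<psi> (hopf_model (G' x))"
      using rep by blast
    have "sphere_homotopic G G'"
      using n true [OF G'(1)] homotopic_with_symD homotopic_with_trans by blast
    then have "homotopic_with (\<lambda>_. True) S3 S2 (\<lambda>x. \<psi> (hopf_model (G x))) (\<lambda>x. \<psi> (hopf_model (G' x)))"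
      by (rule \<psi>hopf) simp
    then have "homotopic_with (\<lambda>_. True) S3 S2 F (?h n \<circ> proj3)"
    proof (rule homotopic_with_eq)
      fix x assume x: "x \<in> topspace S3"
      then have "F x \<in> topspace S2"
        using continuous_map_funspace [OF F] by auto
      then show "F x = \<psi> (hopf_model (G x))"
        using G(3) [of x] x \<psi>\<psi>' by (simp add: S3_eq_sphere)
      show "(?h n \<circ> proj3) x = \<psi> (hopf_model (G' x))"
        using G'(2) [of x] x by (simp add: S3_eq_sphere)
    qed simp
    then show ?thesis by blast
  qed
  have classes: "homotopy_classes RP3 S2 = {homotopy_class RP3 S2 (?h n) | n. True}"
  proof
    show "homotopy_classes RP3 S2 \<subseteq> {homotopy_class RP3 S2 (?h n) | n. True}"
      unfolding homotopy_classes_def using cover homotopy_class_eq by blast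
    show "{homotopy_class RP3 S2 (?h n) | n. True} \<subseteq> homotopy_classes RP3 S2"
      unfolding homotopy_classes_def using cont_h by blast
  qed
  have pre: "precomp_class S3 S2 proj3 (homotopy_class RP3 S2 (?h n)) = homotopy_class S3 S2 (?h n \<circ> proj3)" for n
    by (rule precomp_class_eq [OF continuous_map_proj3 cont_h])
  have cont_hp: "continuous_map S3 S2 (?h n \<circ> proj3)" for n
    by (rule continuous_map_compose [OF continuous_map_proj3 cont_h])
  have "inj_on (precomp_class S3 S2 proj3) (homotopy_classes RP3 S2)"
  proof (rule inj_onI)
    fix A B assume "A \<in> homotopy_classes RP3 S2" "B \<in> homotopy_classes RP3 S2"
      and eq: "precomp_class S3 S2 proj3 A = precomp_class S3 S2 proj3 B"
    then obtain n m where nm: "A = homotopy_class RP3 S2 (?h n)" "B = homotopy_class RP3 S2 (?h m)"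
      unfolding classes by blast
    have "?h m \<circ> proj3 \<in> homotopy_class S3 S2 (?h m \<circ> proj3)"
      using cont_hp by (simp add: homotopy_class_def)
    then have "?h m \<circ> proj3 \<in> homotopy_class S3 S2 (?h n \<circ> proj3)"
      using eq by (simp add: nm pre)
    then have "n = m"
      by (intro inj) (simp add: homotopy_class_def)
    then show "A = B"
      by (simp add: nm)
  qed
  moreover have "precomp_class S3 S2 proj3 ` homotopy_classes RP3 S2 = homotopy_classes S3 S2"
  proof
    show "precomp_class S3 S2 proj3 ` homotopy_classes RP3 S2 \<subseteq> homotopy_classes S3 S2"
      unfolding classes using pre cont_hp by (auto simp: homotopy_classes_def)
    show "homotopy_classes S3 S2 \<subseteq> precomp_class S3 S2 proj3 ` homotopy_classes RP3 S2"
    proof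
      fix C assume "C \<in> homotopy_classes S3 S2"
      then obtain F where F: "continuous_map S3 S2 F" "C = homotopy_class S3 S2 F"
        by (auto simp: homotopy_classes_def)
      obtain n where n: "homotopic_with (\<lambda>_. True) S3 S2 F (?h n \<circ> proj3)"
        using surj [OF F(1)] by blast
      have "C = precomp_class S3 S2 proj3 (homotopy_class RP3 S2 (?h n))"
        unfolding pre F(2) by (rule homotopy_class_eq [OF n])
      then show "C \<in> precomp_class S3 S2 proj3 ` homotopy_classes RP3 S2"
        unfolding classes by blast
    qed
  qed
  ultimately show ?thesis
    using classes by (simp add: bij_betw_def)
qed

end
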